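(* Let $T>0$ and let $A\in\mathcal{H}(E_1,E_0)$. Assume that there are $\gamma\in[0,1]$, $\theta\in(0,1]$ with $(\gamma,\theta)\neq(0,1)$, $\nu\in[0,1)$, $\ell>0$ and a constant $c_T>0$ such that $$f:C_{\theta}((0,T],E_\theta)\to C_{\nu}((0,T],E_\gamma)\qquad\text{and}\qquad \Sigma_T:C_{\theta}((0,T],E_\theta)\to E_0$$ are Lipschitz mappings with $f(0)=0$ satisfying $$\|f(v)-f(w)\|_{C_{\nu}((0,T],E_\gamma)}\le c_T\,L^{\ell}\,\|v-w\|_{C_{\theta}((0,T],E_\theta)},\qquad \|\Sigma_T(v)-\Sigma_T(w)\|_0\le c_T\,L^{\ell}\,\|v-w\|_{C_{\theta}((0,T],E_\theta)}$$ for all $L\in(0,1)$ and all $v,w\in C_{\theta}((0,T],E_\theta)$ with $$\|v\|_{C_{\theta}((0,T],E_\theta)}+\|w\|_{C_{\theta}((0,T],E_\theta)}\le L,\qquad \sup_{t\in(0,T]}\big(\|v(t)\|_0+\|w(t)\|_0\big)\le L .$$ Then there is $m(T)>0$ such that, provided $\|\Sigma_T(0)\|_0\le m(T)$, the problem $$u'=Au+f(u,t),\quad t\in(0,T],\qquad u(0)=\Sigma_T(u),$$ has a unique global mild solution $$u\in C([0,T],E_0)\cap C_\theta((0,T],E_\theta).$$ Moreover, if $\gamma>0$, then $$u\in C^1((0,T],E_0)\cap C((0,T],E_1)$$ is a strong solution to this problem.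
   Context: $E_0,E_1$ are Banach spaces with $E_1$ densely and continuously embedded in $E_0$; $\|\cdot\|_0,\|\cdot\|_1$ are their norms. $A\in\mathcal{H}(E_1,E_0)$ means that $A$ is the generator of an analytic semigroup $(e^{tA})_{t\ge0}$ on $E_0$ with domain $E_1$. For $\theta\in(0,1)$, $(\cdot,\cdot)_\theta$ is an arbitrary admissible interpolation functor of exponent $\theta$ (an interpolation functor of exponent $\theta$ for which $E_1$ is dense in $(E_0,E_1)_\theta$ whenever $E_1$ is dense in $E_0$; e.g. complex interpolation, or real interpolation with finite second parameter), and $E_\theta:=(E_0,E_1)_\theta$ with norm $\|\cdot\|_\theta$; for $\theta=0,1$ these are the given spaces. For $\mu\in\mathbb{R}$, $C_\mu((0,T],E_\theta)$ is the Banach space of all $u\in C((0,T],E_\theta)$ with $t^\mu u(t)\to0$ in $E_\theta$ as $t\to0^+$, with norm $\|u\|_{C_\mu((0,T],E_\theta)}:=\sup\{t^\mu\|u(t)\|_\theta: t\in(0,T]\}$. Notation: $f(u,t):=f(u)(t)$ for $t\in(0,T]$, so $f$ may depend nonlocally in time on $u$. A mild solution is a function $u$ satisfying $u(t)=e^{tA}\Sigma_T(u)+\int_0^te^{(t-s)A}f(u,s)\,\mathrm{d}s$ for $t\in[0,T]$. A strong solution has in addition the regularity $C^1((0,T],E_0)\cap C((0,T],E_1)$ and satisfies the differential equation pointwise on $(0,T]$.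
   Formalization: Uniqueness is claimed only among mild solutions whose C_θ-norm and sup-norm in E_0 are at most some r>0 (independent of f and Σ_T); in the whole class it fails, e.g. E_0=E_1=R, A=0, f=0, T=1, Σ_T(v)=min(v(1)^2,4) has solutions 0, 1 and 4. *)

theory Defs
  imports "HOL-Analysis.Analysis"
begin

text \<open>
  Scalars: a complete normed field over the reals (class \<open>{real_normed_field, banach}\<close>) is, up to
  isomorphism, the field of real or of complex numbers, so a type variable of this sort covers
  Banach spaces over both.  The space \<open>E\<^sub>0\<close> is a whole type \<open>'a :: banach\<close> with a compatible scalar
  multiplication \<open>scl\<close>; the other spaces are linear subspaces of it carrying a norm of their own.
\<close>

definition banach_scalars :: "('k::{real_normed_field,banach} \<Rightarrow> 'a::banach \<Rightarrow> 'a) \<Rightarrow> bool" where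
  "banach_scalars scl \<longleftrightarrow>
     vector_space scl \<and>
     (\<forall>r x. scl (of_real r) x = r *\<^sub>R x) \<and>
     (\<forall>c x. norm (scl c x) = norm c * norm x)"

record 'a nspace =
  carr :: "'a set"
  nrm :: "'a \<Rightarrow> real"

text \<open>
  \<open>nrm X\<close> is only meaningful on \<open>carr X\<close>.  The default value 0 is irrelevant for the topology; it is
  there because locale \<open>Metric_space\<close> demands nonnegativity and symmetry on the whole type.
\<close>

definition ndist :: "'a::ab_group_add nspace \<Rightarrow> 'a \<Rightarrow> 'a \<Rightarrow> real" where
  "ndist X x y = (if x \<in> carr X \<and> y \<in> carr X then nrm X (x - y) else 0)"

definition ntop :: "'a::ab_group_add nspace \<Rightarrow> 'a topology" where
  "ntop X = Metric_space.mtopology (carr X) (ndist X)"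

definition banach_space ::
  "('k::real_normed_field \<Rightarrow> 'a::ab_group_add \<Rightarrow> 'a) \<Rightarrow> 'a nspace \<Rightarrow> bool" where
  "banach_space scl X \<longleftrightarrow>
     module.subspace scl (carr X) \<and>
     (\<forall>x\<in>carr X. nrm X x \<ge> 0 \<and> (nrm X x = 0 \<longleftrightarrow> x = 0)) \<and>
     (\<forall>x\<in>carr X. \<forall>y\<in>carr X. nrm X (x + y) \<le> nrm X x + nrm X y) \<and>
     (\<forall>c. \<forall>x\<in>carr X. nrm X (scl c x) = norm c * nrm X x) \<and>
     Metric_space.mcomplete (carr X) (ndist X)"

definition whole_space :: "'a::real_normed_vector nspace" where
  "whole_space = \<lparr>carr = UNIV, nrm = norm\<rparr>"

definition bounded_by :: "'a nspace \<Rightarrow> 'a nspace \<Rightarrow> ('a \<Rightarrow> 'a) \<Rightarrow> real \<Rightarrow> bool" where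
  "bounded_by X Y B M \<longleftrightarrow>
     0 \<le> M \<and> (\<forall>x\<in>carr X. B x \<in> carr Y \<and> nrm Y (B x) \<le> M * nrm X x)"

definition cont_embedded :: "'a nspace \<Rightarrow> 'a nspace \<Rightarrow> bool" where
  "cont_embedded X Y \<longleftrightarrow> (\<exists>M. bounded_by X Y (\<lambda>x. x) M)"

definition dense_in :: "'a::ab_group_add nspace \<Rightarrow> 'a nspace \<Rightarrow> bool" where
  "dense_in X Y \<longleftrightarrow> carr X \<subseteq> carr Y \<and> ntop Y closure_of carr X = carr Y"


subsection \<open>Interpolation functors\<close>

definition hausdorff_tvs ::
  "('k::real_normed_field \<Rightarrow> 'a::ab_group_add \<Rightarrow> 'a) \<Rightarrow> 'a topology \<Rightarrow> bool" where
  "hausdorff_tvs scl Z \<longleftrightarrow>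
     topspace Z = UNIV \<and> Hausdorff_space Z \<and>
     continuous_map (prod_topology Z Z) Z (\<lambda>(x, y). x + y) \<and>
     continuous_map (prod_topology euclidean Z) Z (\<lambda>(c, x). scl c x)"

definition banach_couple ::
  "('k::real_normed_field \<Rightarrow> 'a::ab_group_add \<Rightarrow> 'a) \<Rightarrow> 'a nspace \<Rightarrow> 'a nspace \<Rightarrow> bool" where
  "banach_couple scl X\<^sub>0 X\<^sub>1 \<longleftrightarrow>
     banach_space scl X\<^sub>0 \<and> banach_space scl X\<^sub>1 \<and>
     (\<exists>Z. hausdorff_tvs scl Z \<and>
          continuous_map (ntop X\<^sub>0) Z (\<lambda>x. x) \<and> continuous_map (ntop X\<^sub>1) Z (\<lambda>x. x))"

definition int_space :: "'a nspace \<Rightarrow> 'a nspace \<Rightarrow> 'a nspace" where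
  "int_space X\<^sub>0 X\<^sub>1 = \<lparr>carr = carr X\<^sub>0 \<inter> carr X\<^sub>1, nrm = (\<lambda>x. max (nrm X\<^sub>0 x) (nrm X\<^sub>1 x))\<rparr>"

definition sum_space :: "'a::ab_group_add nspace \<Rightarrow> 'a nspace \<Rightarrow> 'a nspace" where
  "sum_space X\<^sub>0 X\<^sub>1 =
     \<lparr>carr = {a + b | a b. a \<in> carr X\<^sub>0 \<and> b \<in> carr X\<^sub>1},
      nrm = (\<lambda>x. Inf {nrm X\<^sub>0 a + nrm X\<^sub>1 b | a b. a \<in> carr X\<^sub>0 \<and> b \<in> carr X\<^sub>1 \<and> x = a + b})\<rparr>"

text \<open>
  The couples range over all Banach couples inside the ambient vector space \<open>'a\<close>.  A morphism
  \<open>(X\<^sub>0, X\<^sub>1) \<rightarrow> (Y\<^sub>0, Y\<^sub>1)\<close> is a linear map \<open>X\<^sub>0 + X\<^sub>1 \<rightarrow> Y\<^sub>0 + Y\<^sub>1\<close> that is bounded from \<open>X\<^sub>j\<close> to \<open>Y\<^sub>j\<close>;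
  each such map extends to a linear map on \<open>'a\<close>, so taking \<open>B\<close> linear on \<open>'a\<close> loses nothing.
  The functor acts on morphisms by restriction.  The last clause is
  \<open>\<parallel>B\<parallel> \<le> c \<parallel>B\<parallel>\<^sub>0\<^sup>1\<^sup>-\<^sup>\<theta> \<parallel>B\<parallel>\<^sub>1\<^sup>\<theta>\<close>, written with bounds for the operator norms.
\<close>

definition interpolation_functor ::
  "('k::real_normed_field \<Rightarrow> 'a::ab_group_add \<Rightarrow> 'a) \<Rightarrow> real \<Rightarrow>
   ('a nspace \<Rightarrow> 'a nspace \<Rightarrow> 'a nspace) \<Rightarrow> bool" where
  "interpolation_functor scl \<theta> F \<longleftrightarrow>
     (\<forall>X\<^sub>0 X\<^sub>1. banach_couple scl X\<^sub>0 X\<^sub>1 \<longrightarrow>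
        banach_space scl (F X\<^sub>0 X\<^sub>1) \<and>
        cont_embedded (int_space X\<^sub>0 X\<^sub>1) (F X\<^sub>0 X\<^sub>1) \<and>
        cont_embedded (F X\<^sub>0 X\<^sub>1) (sum_space X\<^sub>0 X\<^sub>1)) \<and>
     (\<exists>c>0. \<forall>X\<^sub>0 X\<^sub>1 Y\<^sub>0 Y\<^sub>1 B M\<^sub>0 M\<^sub>1.
        banach_couple scl X\<^sub>0 X\<^sub>1 \<longrightarrow> banach_couple scl Y\<^sub>0 Y\<^sub>1 \<longrightarrow>
        Vector_Spaces.linear scl scl B \<longrightarrow>
        bounded_by X\<^sub>0 Y\<^sub>0 B M\<^sub>0 \<longrightarrow> bounded_by X\<^sub>1 Y\<^sub>1 B M\<^sub>1 \<longrightarrow>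
        bounded_by (F X\<^sub>0 X\<^sub>1) (F Y\<^sub>0 Y\<^sub>1) B (c * M\<^sub>0 powr (1 - \<theta>) * M\<^sub>1 powr \<theta>))"

definition admissible_functor ::
  "('k::real_normed_field \<Rightarrow> 'a::ab_group_add \<Rightarrow> 'a) \<Rightarrow> real \<Rightarrow>
   ('a nspace \<Rightarrow> 'a nspace \<Rightarrow> 'a nspace) \<Rightarrow> bool" where
  "admissible_functor scl \<theta> F \<longleftrightarrow>
     interpolation_functor scl \<theta> F \<and>
     (\<forall>X\<^sub>0 X\<^sub>1. banach_couple scl X\<^sub>0 X\<^sub>1 \<longrightarrow> cont_embedded X\<^sub>1 X\<^sub>0 \<longrightarrow>
        dense_in X\<^sub>1 X\<^sub>0 \<longrightarrow> dense_in X\<^sub>1 (F X\<^sub>0 X\<^sub>1))"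

definition interp ::
  "(real \<Rightarrow> 'a nspace \<Rightarrow> 'a nspace \<Rightarrow> 'a nspace) \<Rightarrow> 'a::real_normed_vector nspace \<Rightarrow> real \<Rightarrow> 'a nspace"
  where
  "interp F E\<^sub>1 \<theta> =
     (if \<theta> = 0 then whole_space else if \<theta> = 1 then E\<^sub>1 else F \<theta> whole_space E\<^sub>1)"


subsection \<open>Analytic semigroups\<close>

definition c0_semigroup ::
  "('k::{real_normed_field,banach} \<Rightarrow> 'a::banach \<Rightarrow> 'a) \<Rightarrow> (real \<Rightarrow> 'a \<Rightarrow> 'a) \<Rightarrow> bool" where
  "c0_semigroup scl S \<longleftrightarrow>
     (\<forall>t\<ge>0. bounded_linear (S t) \<and> Vector_Spaces.linear scl scl (S t)) \<and>
     S 0 = (\<lambda>x. x) \<and>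
     (\<forall>s\<ge>0. \<forall>t\<ge>0. \<forall>x. S (s + t) x = S s (S t x)) \<and>
     (\<forall>x. ((\<lambda>t. S t x) \<longlongrightarrow> x) (at_right 0))"

definition generator :: "(real \<Rightarrow> 'a::real_normed_vector \<Rightarrow> 'a) \<Rightarrow> 'a set \<Rightarrow> ('a \<Rightarrow> 'a) \<Rightarrow> bool" where
  "generator S D A \<longleftrightarrow>
     (\<forall>x y. ((\<lambda>h. (S h x - x) /\<^sub>R h) \<longlongrightarrow> y) (at_right 0) \<longleftrightarrow> x \<in> D \<and> y = A x)"

text \<open>
  The complexification of the (real) space \<open>'a\<close> is \<open>'a \<times> 'a\<close>, with \<open>(x, y)\<close> standing for \<open>x + iy\<close>.
  The product norm is not homogeneous for complex scalars but is equivalent to one that is.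
  If \<open>'a\<close> is already a complex space, its real complexification is the direct sum of \<open>'a\<close> and its
  conjugate, so that analyticity there is the same as analyticity on \<open>'a\<close>.
\<close>

definition cscale :: "complex \<Rightarrow> 'a::real_vector \<times> 'a \<Rightarrow> 'a \<times> 'a" where
  "cscale c p =
     (Re c *\<^sub>R fst p - Im c *\<^sub>R snd p, Re c *\<^sub>R snd p + Im c *\<^sub>R fst p)"

definition sector :: "real \<Rightarrow> complex set" where
  "sector \<phi> = {z. z \<noteq> 0 \<and> \<bar>Arg z\<bar> < \<phi>}"

definition analytic_semigroup ::
  "('k::{real_normed_field,banach} \<Rightarrow> 'a::banach \<Rightarrow> 'a) \<Rightarrow> (real \<Rightarrow> 'a \<Rightarrow> 'a) \<Rightarrow> bool" where
  "analytic_semigroup scl S \<longleftrightarrow>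
     c0_semigroup scl S \<and>
     (\<exists>\<phi>. 0 < \<phi> \<and> \<phi> \<le> pi / 2 \<and>
       (\<exists>H :: complex \<Rightarrow> ('a \<times> 'a) \<Rightarrow>\<^sub>L ('a \<times> 'a).
          (\<forall>t>0. \<forall>x y. blinfun_apply (H (complex_of_real t)) (x, y) = (S t x, S t y)) \<and>
          (\<forall>z\<in>sector \<phi>. \<forall>c p. blinfun_apply (H z) (cscale c p) = cscale c (blinfun_apply (H z) p)) \<and>
          (\<forall>z\<in>sector \<phi>. \<exists>D. (H has_derivative D) (at z) \<and>
             (\<forall>h p. blinfun_apply (D h) p = cscale h (blinfun_apply (D 1) p))) \<and>
          (\<forall>z\<in>sector \<phi>. \<forall>w\<in>sector \<phi>. H (z + w) = H z o\<^sub>L H w) \<and>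
          (\<forall>p. ((\<lambda>z. blinfun_apply (H z) p) \<longlongrightarrow> p) (at 0 within sector \<phi>))))"

text \<open>\<open>A \<in> \<H>(E\<^sub>1, E\<^sub>0)\<close> with \<open>S t = e\<^sup>t\<^sup>A\<close>; the generator determines the semigroup.\<close>

definition generates_analytic ::
  "('k::{real_normed_field,banach} \<Rightarrow> 'a::banach \<Rightarrow> 'a) \<Rightarrow> 'a nspace \<Rightarrow> ('a \<Rightarrow> 'a) \<Rightarrow>
   (real \<Rightarrow> 'a \<Rightarrow> 'a) \<Rightarrow> bool" where
  "generates_analytic scl E\<^sub>1 A S \<longleftrightarrow> analytic_semigroup scl S \<and> generator S (carr E\<^sub>1) A"


subsection \<open>Weighted spaces and solutions\<close>

text \<open>Functions on \<open>(0,T]\<close> are total functions whose values outside \<open>(0,T]\<close> are irrelevant.\<close>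

definition cw_space :: "real \<Rightarrow> real \<Rightarrow> 'a::ab_group_add nspace \<Rightarrow> (real \<Rightarrow> 'a) set" where
  "cw_space T \<mu> X =
     {u. continuous_map (top_of_set {0<..T}) (ntop X) u \<and>
         ((\<lambda>t. t powr \<mu> * nrm X (u t)) \<longlongrightarrow> 0) (at_right 0)}"

definition cw_norm :: "real \<Rightarrow> real \<Rightarrow> 'a nspace \<Rightarrow> (real \<Rightarrow> 'a) \<Rightarrow> real" where
  "cw_norm T \<mu> X u = (SUP t\<in>{0<..T}. t powr \<mu> * nrm X (u t))"

definition mild_solution ::
  "real \<Rightarrow> (real \<Rightarrow> 'a::banach \<Rightarrow> 'a) \<Rightarrow> ((real \<Rightarrow> 'a) \<Rightarrow> real \<Rightarrow> 'a) \<Rightarrow>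
   ((real \<Rightarrow> 'a) \<Rightarrow> 'a) \<Rightarrow> (real \<Rightarrow> 'a) \<Rightarrow> bool" where
  "mild_solution T S f \<Sigma> u \<longleftrightarrow>
     (\<forall>t\<in>{0..T}.
        (\<lambda>s. S (t - s) (f u s)) integrable_on {0..t} \<and>
        u t = S t (\<Sigma> u) + integral {0..t} (\<lambda>s. S (t - s) (f u s)))"

definition strong_solution ::
  "real \<Rightarrow> 'a::banach nspace \<Rightarrow> ('a \<Rightarrow> 'a) \<Rightarrow> (real \<Rightarrow> 'a \<Rightarrow> 'a) \<Rightarrow>
   ((real \<Rightarrow> 'a) \<Rightarrow> real \<Rightarrow> 'a) \<Rightarrow> ((real \<Rightarrow> 'a) \<Rightarrow> 'a) \<Rightarrow> (real \<Rightarrow> 'a) \<Rightarrow> bool" where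
  "strong_solution T E\<^sub>1 A S f \<Sigma> u \<longleftrightarrow>
     mild_solution T S f \<Sigma> u \<and>
     continuous_map (top_of_set {0<..T}) (ntop E\<^sub>1) u \<and>
     (\<exists>u'. continuous_on {0<..T} u' \<and>
        (\<forall>t\<in>{0<..T}. (u has_vector_derivative u' t) (at t within {0<..T}) \<and>
                      u' t = A (u t) + f u t)) \<and>
     u 0 = \<Sigma> u"

end

theory Submission
  imports Defs
begin

text \<open>
  A mild solution is a fixed point of \<open>v \<mapsto> e\<^sup>t\<^sup>A \<Sigma>(v) + \<integral>\<^sub>0\<^sup>t e\<^bsup>(t-s)A\<^esup> f(v, s) ds\<close>.  On functions
  of size at most \<open>r\<close>, in the norm of \<open>C\<^sub>\<theta>((0,T], E\<^sub>\<theta>)\<close> and in the supremum norm of \<open>E\<^sub>0\<close>, the Lipschitz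
  constants of \<open>f\<close> and \<open>\<Sigma>\<close> are \<open>O(r\<^sup>l)\<close>.  As soon as \<open>(x, h) \<mapsto> e\<^sup>t\<^sup>A x + \<integral>\<^sub>0\<^sup>t e\<^bsup>(t-s)A\<^esup> h(s) ds\<close> is bounded
  from \<open>E\<^sub>0 \<times> C\<^sub>\<nu>((0,T], E\<^sub>\<gamma>)\<close> to both of these spaces, the map is a contraction for small \<open>r\<close>, and it
  leaves the ball invariant because \<open>f(0) = 0\<close> and \<open>\<Sigma>(0)\<close> is small (\<open>small_data_solution\<close>).

  That bound comes from smoothing.  Analyticity gives \<open>\<parallel>A e\<^sup>t\<^sup>A\<parallel> = O(1/t)\<close> by Cauchy's estimate on discs
  in the sector (\<open>analytic_semigroup_estimates\<close>), and since the norm of \<open>E\<^sub>1\<close> is equivalent to the graph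
  norm (\<open>graph_norm\<close>), \<open>e\<^sup>t\<^sup>A\<close> has norm \<open>O(1/t)\<close> from \<open>E\<^sub>0\<close> to \<open>E\<^sub>1\<close>.  Interpolation yields
  \<open>O(t\<^bsup>-\<theta>\<^esup>)\<close> from \<open>E\<^sub>0\<close> to \<open>E\<^sub>\<theta>\<close> (\<open>interp_smoothing\<close>) and \<open>O(t\<^bsup>\<gamma>-1\<^esup>)\<close> from \<open>E\<^sub>\<gamma>\<close> to \<open>E\<^sub>1\<close>
  (\<open>interp_to_E1\<close>).  One of the two is integrable in every case: the first if \<open>\<theta> < 1\<close>, the second if
  \<open>\<theta> = 1\<close>, where \<open>\<gamma> > 0\<close>.  The convolution of \<open>t\<^bsup>-\<alpha>\<^esup>\<close> and \<open>t\<^bsup>-\<nu>\<^esup>\<close> is a multiple of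
  \<open>t\<^bsup>1-\<alpha>-\<nu>\<^esup>\<close>, and multiplied by \<open>t\<^sup>\<theta>\<close> it tends to 0 because \<open>\<alpha> \<le> \<theta>\<close> and \<open>\<nu> < 1\<close>
  (\<open>nrm_w_le\<close>, \<open>mild_cw\<close>).

  If \<open>\<gamma> > 0\<close>, the second kernel shows in the same way that the solution is continuous into \<open>E\<^sub>1\<close>, and the
  variation of constants formula over short intervals gives the differential equation
  (\<open>mild_imp_strong\<close>).

  The smaller spaces are subsets of the type of \<open>E\<^sub>0\<close> with norms of their own.  Integrals are taken
  in \<open>E\<^sub>0\<close>.  For \<open>\<epsilon> > 0\<close> the map \<open>x \<mapsto> \<parallel>e\<^bsup>\<epsilon>A\<^esup> x\<parallel>\<^sub>Y\<close> is a continuous seminorm on \<open>E\<^sub>0\<close>, so it can be moved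
  under such an integral (\<open>seminorm_integral_le\<close>); this is how an integral is located in a smaller
  space \<open>Y\<close> (\<open>tail_integral_Y\<close>).
\<close>

section \<open>Normed subspaces of a vector space\<close>

text \<open>
  Real scalars suffice for all norm estimates below.  The general scalars of \<^const>\<open>banach_space\<close>
  matter only where the interpolation functors are applied.
\<close>

locale normed_subspace =
  fixes X :: "'a::real_vector nspace"
  assumes zero_mem [simp]: "0 \<in> carr X"
    and add_mem: "x \<in> carr X \<Longrightarrow> y \<in> carr X \<Longrightarrow> x + y \<in> carr X"
    and scale_mem: "x \<in> carr X \<Longrightarrow> r *\<^sub>R x \<in> carr X"
    and nrm_ge0: "x \<in> carr X \<Longrightarrow> 0 \<le> nrm X x"
    and nrm_eq0: "x \<in> carr X \<Longrightarrow> nrm X x = 0 \<longleftrightarrow> x = 0"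
    and nrm_add: "x \<in> carr X \<Longrightarrow> y \<in> carr X \<Longrightarrow> nrm X (x + y) \<le> nrm X x + nrm X y"
    and nrm_scale: "x \<in> carr X \<Longrightarrow> nrm X (r *\<^sub>R x) = \<bar>r\<bar> * nrm X x"
begin

lemma nrm_zero [simp]: "nrm X 0 = 0"
  by (simp add: nrm_eq0)

lemma minus_mem: "x \<in> carr X \<Longrightarrow> - x \<in> carr X"
  using scale_mem[of x "-1"] by simp

lemma diff_mem: "x \<in> carr X \<Longrightarrow> y \<in> carr X \<Longrightarrow> x - y \<in> carr X"
  using add_mem[of x "- y"] minus_mem by simp

lemma nrm_minus: "x \<in> carr X \<Longrightarrow> nrm X (- x) = nrm X x"
  using nrm_scale[of x "-1"] by simp

lemma nrm_commute: "x \<in> carr X \<Longrightarrow> y \<in> carr X \<Longrightarrow> nrm X (x - y) = nrm X (y - x)"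
  using nrm_minus[of "x - y"] diff_mem by simp

lemma nrm_diff: "x \<in> carr X \<Longrightarrow> y \<in> carr X \<Longrightarrow> nrm X (x - y) \<le> nrm X x + nrm X y"
  using nrm_add[of x "- y"] minus_mem nrm_minus by simp

lemma nrm_triangle:
  "x \<in> carr X \<Longrightarrow> y \<in> carr X \<Longrightarrow> z \<in> carr X \<Longrightarrow> nrm X (x - z) \<le> nrm X (x - y) + nrm X (y - z)"
  using nrm_add[of "x - y" "y - z"] diff_mem by simp

lemma nrm_le_add_diff: "x \<in> carr X \<Longrightarrow> y \<in> carr X \<Longrightarrow> nrm X x \<le> nrm X y + nrm X (x - y)"
  using nrm_add[of y "x - y"] diff_mem by simp

lemma nrm_diff_ge: "x \<in> carr X \<Longrightarrow> y \<in> carr X \<Longrightarrow> \<bar>nrm X x - nrm X y\<bar> \<le> nrm X (x - y)"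
  using nrm_le_add_diff[of x y] nrm_le_add_diff[of y x] nrm_commute[of x y] by linarith

lemma metric: "Metric_space (carr X) (ndist X)"
proof
  fix x y z
  show "0 \<le> ndist X x y"
    by (simp add: ndist_def nrm_ge0 diff_mem)
  show "ndist X x y = ndist X y x"
    by (simp add: ndist_def nrm_commute)
  assume "x \<in> carr X" "y \<in> carr X"
  then show "(ndist X x y = 0) = (x = y)"
    by (simp add: ndist_def nrm_eq0 diff_mem)
  assume "z \<in> carr X"
  with \<open>x \<in> carr X\<close> \<open>y \<in> carr X\<close> show "ndist X x z \<le> ndist X x y + ndist X y z"
    by (simp add: ndist_def nrm_triangle)
qed

sublocale M: Metric_space "carr X" "ndist X"
  by (rule metric)

lemma limitin_ntop:
  "limitin (ntop X) f l F \<longleftrightarrow>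
     l \<in> carr X \<and> eventually (\<lambda>x. f x \<in> carr X) F \<and> ((\<lambda>x. nrm X (f x - l)) \<longlongrightarrow> 0) F"
proof -
  have "((\<lambda>x. ndist X (f x) l) \<longlongrightarrow> 0) F \<longleftrightarrow> ((\<lambda>x. nrm X (f x - l)) \<longlongrightarrow> 0) F"
    if "l \<in> carr X" "eventually (\<lambda>x. f x \<in> carr X) F"
    by (rule tendsto_cong) (use that in \<open>auto simp: ndist_def elim: eventually_mono\<close>)
  then show ?thesis
    unfolding ntop_def M.limitin_metric_dist_null by blast
qed

lemma continuous_map_ntop:
  fixes u :: "'b::metric_space \<Rightarrow> 'a"
  shows "continuous_map (top_of_set S) (ntop X) u \<longleftrightarrow>
    (\<forall>t\<in>S. u t \<in> carr X \<and> ((\<lambda>s. nrm X (u s - u t)) \<longlongrightarrow> 0) (at t within S))"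
proof -
  have within: "atin_within euclidean t S = at t within S" for t :: 'b
    by (rule filter_eqI) (auto simp: eventually_atin_within eventually_at_topological)
  have ev: "eventually (\<lambda>s. u s \<in> carr X) (at t within S)" if "\<forall>t\<in>S. u t \<in> carr X" for t
    using that by (auto simp: eventually_at_filter)
  show ?thesis
    unfolding continuous_map_atin limitin_ntop
    using ev by (auto simp: atin_subtopology_within within)
qed

lemma continuous_on_nrm:
  fixes u :: "'b::metric_space \<Rightarrow> 'a"
  assumes "continuous_map (top_of_set S) (ntop X) u"
  shows "continuous_on S (\<lambda>t. nrm X (u t))"
  unfolding continuous_on_def
proof
  fix t assume t: "t \<in> S"
  have "((\<lambda>s. nrm X (u s - u t)) \<longlongrightarrow> 0) (at t within S)"
    using assms t by (simp add: continuous_map_ntop)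
  then show "((\<lambda>s. nrm X (u s)) \<longlongrightarrow> nrm X (u t)) (at t within S)"
  proof (rule metric_tendsto_imp_tendsto)
    show "\<forall>\<^sub>F s in at t within S. dist (nrm X (u s)) (nrm X (u t)) \<le> dist (nrm X (u s - u t)) 0"
      using assms t unfolding eventually_at_filter continuous_map_ntop
      by (auto simp: dist_real_def intro!: always_eventually nrm_diff_ge order_trans[OF nrm_diff_ge])
  qed
qed

text \<open>
  Local uniform limits of continuous functions are continuous.  This form serves for integrals that
  are approximated by their values smoothed for a short time, and for limits in weighted norms.
\<close>

lemma continuous_map_ntop_approx:
  fixes u :: "'b::metric_space \<Rightarrow> 'a"
  assumes mem: "\<And>t. t \<in> S \<Longrightarrow> u t \<in> carr X"
    and approx: "\<And>t e. t \<in> S \<Longrightarrow> 0 < e \<Longrightarrow>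
      \<exists>d>0. \<exists>v. (\<forall>s\<in>S. dist s t < d \<longrightarrow> v s \<in> carr X \<and> nrm X (u s - v s) \<le> e) \<and>
        ((\<lambda>s. nrm X (v s - v t)) \<longlongrightarrow> 0) (at t within S)"
  shows "continuous_map (top_of_set S) (ntop X) u"
  unfolding continuous_map_ntop
proof (intro ballI conjI mem)
  fix t assume t: "t \<in> S"
  show "((\<lambda>s. nrm X (u s - u t)) \<longlongrightarrow> 0) (at t within S)"
    unfolding tendsto_iff
  proof (intro allI impI)
    fix e :: real assume e: "0 < e"
    then obtain d v where d: "d > 0"
      and v: "\<forall>s\<in>S. dist s t < d \<longrightarrow> v s \<in> carr X \<and> nrm X (u s - v s) \<le> e / 4"
      and lim: "((\<lambda>s. nrm X (v s - v t)) \<longlongrightarrow> 0) (at t within S)"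
      using approx[OF t, of "e / 4"] by auto
    have "\<forall>\<^sub>F s in at t within S. nrm X (v s - v t) < e / 4"
      using lim e by (intro order_tendstoD) auto
    moreover have "\<forall>\<^sub>F s in at t within S. s \<in> S \<and> dist s t < d"
      using d unfolding eventually_at by auto
    ultimately show "\<forall>\<^sub>F s in at t within S. dist (nrm X (u s - u t)) 0 < e"
    proof eventually_elim
      case (elim s)
      have m: "v t \<in> carr X" "nrm X (u t - v t) \<le> e / 4" "v s \<in> carr X" "nrm X (u s - v s) \<le> e / 4"
        using v t d elim by auto
      have "nrm X (u s - u t) \<le> nrm X (u s - v s) + (nrm X (v s - v t) + nrm X (v t - u t))"
        using nrm_triangle[of "u s" "v s" "u t"] nrm_triangle[of "v s" "v t" "u t"] m mem t elim
        by auto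
      with m elim e have "nrm X (u s - u t) < e"
        using nrm_commute[of "v t" "u t"] mem[OF t] by linarith
      then show ?case
        using nrm_ge0[of "u s - u t"] diff_mem mem elim t by auto
    qed
  qed
qed (use mem in auto)

end

locale banach_subspace = normed_subspace +
  assumes mcomplete: "Metric_space.mcomplete (carr X) (ndist X)"
begin

lemma Cauchy_convergent:
  assumes mem: "\<And>n. \<sigma> n \<in> carr X"
    and cau: "\<And>e. 0 < e \<Longrightarrow> \<exists>N. \<forall>m\<ge>N. \<forall>n\<ge>N. nrm X (\<sigma> m - \<sigma> n) < e"
  obtains x where "x \<in> carr X" "(\<lambda>n. nrm X (\<sigma> n - x)) \<longlonglongrightarrow> 0"
proof -
  have "M.MCauchy \<sigma>"
    unfolding M.MCauchy_def
  proof (intro conjI allI impI)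
    show "range \<sigma> \<subseteq> carr X"
      using mem by auto
    fix e :: real assume "0 < e"
    from cau[OF this] obtain N where "\<forall>m\<ge>N. \<forall>n\<ge>N. nrm X (\<sigma> m - \<sigma> n) < e" by blast
    then show "\<exists>N. \<forall>m n. N \<le> m \<longrightarrow> N \<le> n \<longrightarrow> ndist X (\<sigma> m) (\<sigma> n) < e"
      using mem by (auto simp: ndist_def intro!: exI[of _ N])
  qed
  then obtain x where "limitin (ntop X) \<sigma> x sequentially"
    using mcomplete unfolding M.mcomplete_def ntop_def by blast
  then show ?thesis
    using that unfolding limitin_ntop by blast
qed

end

lemma (in normed_subspace) banach_subspaceI:
  assumes "\<And>\<sigma>. (\<And>n. \<sigma> n \<in> carr X) \<Longrightarrow>
      (\<And>e. 0 < e \<Longrightarrow> \<exists>N. \<forall>m\<ge>N. \<forall>n\<ge>N. nrm X (\<sigma> m - \<sigma> n) < e) \<Longrightarrow>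
      \<exists>x\<in>carr X. (\<lambda>n. nrm X (\<sigma> n - x)) \<longlonglongrightarrow> 0"
  shows "banach_subspace X"
proof unfold_locales
  show "M.mcomplete"
    unfolding M.mcomplete_def
  proof (intro allI impI)
    fix \<sigma> assume c: "M.MCauchy \<sigma>"
    then have mem: "\<sigma> n \<in> carr X" for n
      by (auto simp: M.MCauchy_def)
    have "\<exists>N. \<forall>m\<ge>N. \<forall>n\<ge>N. nrm X (\<sigma> m - \<sigma> n) < e" if "0 < e" for e
      using c that mem unfolding M.MCauchy_def ndist_def by simp
    from assms[OF mem this] obtain x where "x \<in> carr X" "(\<lambda>n. nrm X (\<sigma> n - x)) \<longlonglongrightarrow> 0"
      by blast
    then have "limitin (ntop X) \<sigma> x sequentially"
      using mem by (simp add: limitin_ntop)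
    then show "\<exists>x. limitin M.mtopology \<sigma> x sequentially"
      unfolding ntop_def by blast
  qed
qed

section \<open>Comparison of complete norms\<close>

text \<open>
  The open mapping argument.  By Baire's theorem some ball of \<open>Y\<close> is \<open>X\<close>-dense in an \<open>X\<close>-ball, so
  every \<open>x\<close> can be approximated in \<open>X\<close> by an element whose \<open>Y\<close>-norm is controlled by that of \<open>x\<close>;
  applying this to the successive remainders writes \<open>x\<close> as a series that also converges in \<open>Y\<close>.
\<close>

lemma comparable_norms:
  fixes X Y :: "'a::real_vector nspace"
  assumes X: "banach_subspace X" and Y: "banach_subspace Y"
    and sub: "carr X \<subseteq> carr Y"
    and closed: "\<And>\<sigma> x y. (\<And>n. \<sigma> n \<in> carr X) \<Longrightarrow> x \<in> carr X \<Longrightarrow> y \<in> carr Y \<Longrightarrow>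
      (\<lambda>n. nrm X (\<sigma> n - x)) \<longlonglongrightarrow> 0 \<Longrightarrow> (\<lambda>n. nrm Y (\<sigma> n - y)) \<longlonglongrightarrow> 0 \<Longrightarrow> x = y"
  obtains C where "0 \<le> C" "\<And>x. x \<in> carr X \<Longrightarrow> nrm Y x \<le> C * nrm X x"
proof -
  interpret X: banach_subspace X by fact
  interpret Y: banach_subspace Y by fact
  define B where "B n = {x \<in> carr X. nrm Y x \<le> real n}" for n
  define cB where "cB n = X.M.mtopology closure_of (B n)" for n
  have "carr X \<subseteq> \<Union>(range cB)"
  proof
    fix x assume x: "x \<in> carr X"
    obtain n where "nrm Y x \<le> real n"
      using real_arch_simple by blast
    then have "x \<in> B n"
      using x by (simp add: B_def)
    moreover have "B n \<subseteq> cB n"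
      unfolding cB_def by (rule closure_of_subset) (auto simp: B_def)
    ultimately show "x \<in> \<Union>(range cB)" by auto
  qed
  moreover have "\<Union>(range cB) \<subseteq> carr X"
    unfolding cB_def using closure_of_subset_topspace[of X.M.mtopology] by auto
  ultimately have "\<Union>(range cB) = carr X" by blast
  then have "X.M.mtopology interior_of \<Union>(range cB) \<noteq> {}"
    using X.zero_mem interior_of_topspace[of X.M.mtopology] by (metis X.M.topspace_mtopology empty_iff)
  then have "\<exists>n. X.M.mtopology interior_of cB n \<noteq> {}"
  proof (rule contrapos_np)
    assume "\<nexists>n. X.M.mtopology interior_of cB n \<noteq> {}"
    then show "X.M.mtopology interior_of \<Union>(range cB) = {}"
      by (intro X.M.metric_Baire_category_alt[OF X.mcomplete]) (auto simp: cB_def)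
  qed
  then obtain N x0 e where x0: "x0 \<in> carr X" and e: "0 < e" and ball: "X.M.mball x0 e \<subseteq> cB N"
    by (auto simp: X.M.metric_interior_of)
  have near: "\<exists>z\<in>carr X. nrm X (x - z) < d \<and> nrm Y z \<le> 2 * real N"
    if x: "x \<in> carr X" "nrm X x < e" and d: "0 < d" for x d
  proof -
    have near': "\<exists>z\<in>B N. nrm X (y - z) < d / 2" if "y \<in> carr X" "nrm X (x0 - y) < e" for y
    proof -
      have "y \<in> cB N"
        using ball that x0 by (auto simp: ndist_def subset_eq)
      then obtain z where "z \<in> B N" "z \<in> X.M.mball y (d / 2)"
        unfolding cB_def X.M.metric_closure_of using half_gt_zero[OF d] by blast
      then show ?thesis
        by (auto simp: ndist_def split: if_splits)
    qed
    obtain z1 where z1: "z1 \<in> B N" "nrm X (x0 + x - z1) < d / 2"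
      using near'[of "x0 + x"] x x0 X.add_mem X.nrm_minus[of x] by auto
    obtain z2 where z2: "z2 \<in> B N" "nrm X (x0 - z2) < d / 2"
      using near'[of x0] x0 e by auto
    have m: "z1 \<in> carr X" "z2 \<in> carr X"
      using z1 z2 by (auto simp: B_def)
    have "nrm X ((x0 + x - z1) - (x0 - z2)) \<le> nrm X (x0 + x - z1) + nrm X (x0 - z2)"
      using m x x0 by (intro X.nrm_diff X.diff_mem X.add_mem)
    then have "nrm X (x - (z1 - z2)) < d"
      using z1 z2 by (simp add: algebra_simps)
    moreover have "nrm Y (z1 - z2) \<le> 2 * real N"
      using Y.nrm_diff[of z1 z2] z1 z2 subsetD[OF sub m(1)] subsetD[OF sub m(2)] by (auto simp: B_def)
    ultimately show ?thesis
      using m X.diff_mem by blast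
  qed
  define C where "C = 4 * real N / e"
  have C: "0 \<le> C" using e by (simp add: C_def)
  have step: "\<exists>z\<in>carr X. nrm X (x - z) \<le> b / 2 \<and> nrm Y z \<le> C * b"
    if x: "x \<in> carr X" "nrm X x \<le> b" "0 < b" for x b
  proof -
    define r where "r = e / (2 * b)"
    have r: "0 < r" using e x by (simp add: r_def)
    have "nrm X (r *\<^sub>R x) < e"
    proof -
      have "r * nrm X x \<le> r * b" using x r by simp
      also have "\<dots> < e" using x e by (simp add: r_def)
      finally show ?thesis using x r by (simp add: X.nrm_scale)
    qed
    then obtain z where z: "z \<in> carr X" "nrm X (r *\<^sub>R x - z) < r * b / 2" "nrm Y z \<le> 2 * real N"
      using near[of "r *\<^sub>R x" "r * b / 2"] r x X.scale_mem by auto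
    let ?z = "(1 / r) *\<^sub>R z"
    have "x - ?z = (1 / r) *\<^sub>R (r *\<^sub>R x - z)"
      using r by (simp add: algebra_simps)
    then have "nrm X (x - ?z) = nrm X (r *\<^sub>R x - z) / r"
      using r x z X.scale_mem X.diff_mem by (simp add: X.nrm_scale)
    moreover have "nrm X (r *\<^sub>R x - z) / r \<le> b / 2"
      using z(2) r by (simp add: field_simps)
    moreover have "nrm Y ?z = nrm Y z / r"
      using r z sub by (auto simp: Y.nrm_scale)
    moreover have "nrm Y z / r \<le> 2 * real N / r"
      using z r by (intro divide_right_mono) auto
    moreover have "2 * real N / r = C * b"
      using x e by (simp add: r_def C_def)
    ultimately show ?thesis
      using X.scale_mem[OF z(1)] by (intro bexI[of _ ?z]) auto
  qed
  have main: "nrm Y x \<le> 2 * C * nrm X x" if x: "x \<in> carr X" "x \<noteq> 0" for x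
  proof -
    define b where "b = nrm X x"
    have b: "0 < b"
      using x X.nrm_ge0[of x] X.nrm_eq0[of x] by (simp add: b_def)
    define Z where "Z y c = (SOME z. z \<in> carr X \<and> nrm X (y - z) \<le> c / 2 \<and> nrm Y z \<le> C * c)" for y c
    have Z: "Z y c \<in> carr X \<and> nrm X (y - Z y c) \<le> c / 2 \<and> nrm Y (Z y c) \<le> C * c"
      if "y \<in> carr X" "nrm X y \<le> c" "0 < c" for y c
      unfolding Z_def by (rule someI_ex) (use step[OF that] in blast)
    define R where "R = rec_nat x (\<lambda>k r. r - Z r (b / 2 ^ k))"
    have R0: "R 0 = x" and RS: "R (Suc k) = R k - Z (R k) (b / 2 ^ k)" for k
      by (simp_all add: R_def)
    have R: "R k \<in> carr X \<and> nrm X (R k) \<le> b / 2 ^ k" for k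
    proof (induction k)
      case (Suc k)
      then show ?case
        using Z[of "R k" "b / 2 ^ k"] b by (auto simp: RS X.diff_mem field_simps)
    qed (use x in \<open>auto simp: R0 b_def\<close>)
    have YR: "nrm Y (R k - R (Suc k)) \<le> C * (b / 2 ^ k)" for k
      using Z[of "R k" "b / 2 ^ k"] R[of k] b by (simp add: RS)
    have RY: "R k \<in> carr Y" for k using R sub by auto
    have tel: "nrm Y (R m - R (m + n)) \<le> C * b * (2 / 2 ^ m)" for m n
    proof -
      have "nrm Y (R m - R (m + n)) \<le> C * b * (2 / 2 ^ m - 2 / 2 ^ (m + n))"
      proof (induction n)
        case (Suc n)
        have "nrm Y (R m - R (m + Suc n)) \<le> nrm Y (R m - R (m + n)) + nrm Y (R (m + n) - R (Suc (m + n)))"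
          using Y.nrm_triangle[OF RY[of m] RY[of "m + n"] RY[of "Suc (m + n)"]] by simp
        also have "\<dots> \<le> C * b * (2 / 2 ^ m - 2 / 2 ^ (m + n)) + C * (b / 2 ^ (m + n))"
          using Suc YR[of "m + n"] by linarith
        also have "\<dots> = C * b * (2 / 2 ^ m - 2 / 2 ^ (m + Suc n))"
          by (simp add: field_simps)
        finally show ?case .
      qed simp
      also have "\<dots> \<le> C * b * (2 / 2 ^ m)"
        using C b by (intro mult_left_mono) auto
      finally show ?thesis .
    qed
    have small: "(\<lambda>m. C * b * (2 / 2 ^ m)) \<longlonglongrightarrow> 0"
      by (intro tendsto_mult_right_zero LIMSEQ_divide_realpow_zero) auto
    have cau: "\<exists>N. \<forall>m\<ge>N. \<forall>n\<ge>N. nrm Y (R m - R n) < d" if d: "0 < d" for d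
    proof -
      obtain N where N: "\<And>m. m \<ge> N \<Longrightarrow> C * b * (2 / 2 ^ m) < d"
        using order_tendstoD(2)[OF small d] unfolding eventually_sequentially by blast
      have *: "nrm Y (R m - R n) < d" if "N \<le> m" "m \<le> n" for m n
        using tel[of m "n - m"] N[OF that(1)] that by auto
      have "nrm Y (R m - R n) < d" if "N \<le> m" "N \<le> n" for m n
        using *[of m n] *[of n m] that Y.nrm_commute[OF RY[of m] RY[of n]] by (cases "m \<le> n") auto
      then show ?thesis by blast
    qed
    obtain y where y: "y \<in> carr Y" "(\<lambda>n. nrm Y (R n - y)) \<longlonglongrightarrow> 0"
      using Y.Cauchy_convergent[OF RY cau] .
    have "(\<lambda>n. nrm X (R n - 0)) \<longlonglongrightarrow> 0"
    proof (rule real_tendsto_sandwich[where f = "\<lambda>_. 0" and h = "\<lambda>n. b / 2 ^ n"])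
      show "\<forall>\<^sub>F n in sequentially. 0 \<le> nrm X (R n - 0)" using R by (simp add: X.nrm_ge0)
      show "\<forall>\<^sub>F n in sequentially. nrm X (R n - 0) \<le> b / 2 ^ n" using R by simp
      show "(\<lambda>n. b / 2 ^ n) \<longlonglongrightarrow> 0" by (rule LIMSEQ_divide_realpow_zero) auto
    qed auto
    from closed[of R 0 y, OF _ _ y(1) this y(2)] R have "y = 0" by simp
    have "nrm Y x \<le> C * b * 2"
    proof (rule field_le_epsilon)
      fix d :: real assume "0 < d"
      then obtain n where n: "nrm Y (R n) < d"
        using order_tendstoD(2)[OF y(2), of d] \<open>y = 0\<close> by (auto simp: eventually_sequentially)
      have "nrm Y x \<le> nrm Y (R n) + nrm Y (R 0 - R n)"
        using Y.nrm_le_add_diff[OF RY[of 0] RY[of n]] R0 by simp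
      then show "nrm Y x \<le> C * b * 2 + d"
        using tel[of 0 n] n by simp
    qed
    then show ?thesis by (simp add: b_def)
  qed
  show ?thesis
  proof (rule that[of "2 * C"])
    show "0 \<le> 2 * C" using C by simp
    show "nrm Y x \<le> 2 * C * nrm X x" if "x \<in> carr X" for x
      using main[OF that] by (cases "x = 0") auto
  qed
qed

lemma banach_subspace_whole: "banach_subspace (whole_space :: 'v::banach nspace)"
proof -
  interpret normed_subspace "whole_space :: 'v nspace"
    by unfold_locales (auto simp: whole_space_def norm_triangle_ineq)
  show ?thesis
  proof (rule banach_subspaceI)
    fix \<sigma> :: "nat \<Rightarrow> 'v"
    assume "\<And>e. 0 < e \<Longrightarrow> \<exists>N. \<forall>m\<ge>N. \<forall>n\<ge>N. nrm whole_space (\<sigma> m - \<sigma> n) < e"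
    then have "Cauchy \<sigma>"
      unfolding Cauchy_iff by (simp add: whole_space_def)
    then obtain x where "\<sigma> \<longlonglongrightarrow> x"
      using Cauchy_convergent_iff convergent_def by blast
    then have "(\<lambda>n. norm (\<sigma> n - x)) \<longlonglongrightarrow> 0"
      by (simp add: tendsto_norm_zero_iff LIM_zero_iff)
    then show "\<exists>x\<in>carr whole_space. (\<lambda>n. nrm whole_space (\<sigma> n - x)) \<longlonglongrightarrow> 0"
      by (auto simp: whole_space_def)
  qed
qed

lemma carr_whole [simp]: "carr whole_space = UNIV"
  and nrm_whole [simp]: "nrm whole_space = norm"
  by (simp_all add: whole_space_def)

text \<open>
  Uniform boundedness is the comparison of the given norm with \<open>x \<mapsto> \<parallel>x\<parallel> + sup\<^sub>n \<parallel>H\<^sub>n x\<parallel>\<close>, which is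
  complete as well.
\<close>

lemma uniform_boundedness:
  fixes H :: "nat \<Rightarrow> 'v::banach \<Rightarrow> 'w::real_normed_vector"
  assumes lin: "\<And>n. bounded_linear (H n)"
    and bdd: "\<And>x. bounded (range (\<lambda>n. H n x))"
  obtains C where "\<And>n x. norm (H n x) \<le> C * norm x"
proof -
  define p where "p x = norm x + (SUP n. norm (H n x))" for x
  have bda: "bdd_above (range (\<lambda>n. norm (H n x)))" for x
    using bdd[of x] by (auto simp: bounded_iff bdd_above_def)
  have le_p: "norm x + norm (H n x) \<le> p x" for n x
    unfolding p_def using cSUP_upper[OF _ bda[of x], of n] by simp
  have p_le: "p x \<le> a" if "\<And>n. norm x + norm (H n x) \<le> a" for x a
    unfolding p_def using cSUP_least[of UNIV "\<lambda>n. norm (H n x)" "a - norm x"] that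
    by (simp add: le_diff_eq add.commute)
  let ?Y = "\<lparr>carr = UNIV, nrm = p\<rparr> :: 'v nspace"
  interpret H: bounded_linear "H n" for n by (rule lin)
  have norm_p: "norm x \<le> p x" for x
    using le_p[of x 0] by (smt (verit) norm_ge_zero)
  interpret Y: normed_subspace ?Y
  proof (unfold_locales, simp_all)
    fix x y :: 'v and r :: real
    show "0 \<le> p x" using norm_p[of x] norm_ge_zero[of x] by linarith
    show "p x = 0 \<longleftrightarrow> x = 0"
    proof
      assume "p x = 0"
      then show "x = 0" using norm_p[of x] by simp
    qed (simp add: p_def H.zero)
    show "p (x + y) \<le> p x + p y"
    proof (rule p_le)
      fix n
      show "norm (x + y) + norm (H n (x + y)) \<le> p x + p y"
        using le_p[of x n] le_p[of y n] norm_triangle_ineq[of x y]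
          norm_triangle_ineq[of "H n x" "H n y"] by (simp add: H.add)
    qed
    have *: "p (r *\<^sub>R x) \<le> \<bar>r\<bar> * p x" for r x
    proof (rule p_le)
      fix n
      have "\<bar>r\<bar> * (norm x + norm (H n x)) \<le> \<bar>r\<bar> * p x"
        using le_p by (rule mult_left_mono) simp
      then show "norm (r *\<^sub>R x) + norm (H n (r *\<^sub>R x)) \<le> \<bar>r\<bar> * p x"
        by (simp add: H.scaleR algebra_simps)
    qed
    show "p (r *\<^sub>R x) = \<bar>r\<bar> * p x"
    proof (cases "r = 0")
      case True
      then show ?thesis by (simp add: p_def H.zero)
    next
      case False
      have "\<bar>r\<bar> * p x \<le> p (r *\<^sub>R x)"
        using *[of "1 / r" "r *\<^sub>R x"] False by (simp add: field_simps)
      with *[of r x] show ?thesis by simp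
    qed
  qed
  have Y: "banach_subspace ?Y"
  proof (rule Y.banach_subspaceI)
    fix \<sigma> :: "nat \<Rightarrow> 'v"
    assume c: "\<And>e. 0 < e \<Longrightarrow> \<exists>N. \<forall>m\<ge>N. \<forall>n\<ge>N. nrm ?Y (\<sigma> m - \<sigma> n) < e"
    have "Cauchy \<sigma>"
      unfolding Cauchy_iff
    proof (intro allI impI)
      fix e :: real assume "0 < e"
      then obtain N where "\<forall>m\<ge>N. \<forall>n\<ge>N. p (\<sigma> m - \<sigma> n) < e" using c[of e] by auto
      then show "\<exists>M. \<forall>m\<ge>M. \<forall>n\<ge>M. norm (\<sigma> m - \<sigma> n) < e"
        using norm_p by (meson le_less_trans)
    qed
    then obtain x where x: "\<sigma> \<longlonglongrightarrow> x"
      using Cauchy_convergent_iff convergent_def by blast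
    have "(\<lambda>n. p (\<sigma> n - x)) \<longlonglongrightarrow> 0"
      unfolding tendsto_iff
    proof (intro allI impI)
      fix e :: real assume e: "0 < e"
      then obtain N where N: "\<And>m n. m \<ge> N \<Longrightarrow> n \<ge> N \<Longrightarrow> p (\<sigma> m - \<sigma> n) < e / 2"
        using c[of "e / 2"] by auto
      have "p (\<sigma> m - x) \<le> e / 2" if m: "m \<ge> N" for m
      proof (rule p_le)
        fix k
        have "(\<lambda>n. norm (\<sigma> m - \<sigma> n) + norm (H k (\<sigma> m - \<sigma> n)))
          \<longlonglongrightarrow> norm (\<sigma> m - x) + norm (H k (\<sigma> m - x))"
          by (intro tendsto_intros H.tendsto x)
        moreover have "\<forall>\<^sub>F n in sequentially. norm (\<sigma> m - \<sigma> n) + norm (H k (\<sigma> m - \<sigma> n)) \<le> e / 2"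
          using N[OF m] le_p by (intro eventually_sequentiallyI[of N]) (meson le_less_trans less_imp_le)
        ultimately show "norm (\<sigma> m - x) + norm (H k (\<sigma> m - x)) \<le> e / 2"
          by (rule tendsto_upperbound) simp
      qed
      then show "\<forall>\<^sub>F n in sequentially. dist (p (\<sigma> n - x)) 0 < e"
        using e Y.nrm_ge0 by (intro eventually_sequentiallyI[of N]) force
    qed
    then show "\<exists>x\<in>carr ?Y. (\<lambda>n. nrm ?Y (\<sigma> n - x)) \<longlonglongrightarrow> 0"
      by auto
  qed
  obtain C where C: "\<And>x. p x \<le> C * norm x"
  proof (rule comparable_norms[OF banach_subspace_whole Y])
    fix \<sigma> :: "nat \<Rightarrow> 'v" and x y
    assume 1: "(\<lambda>n. nrm whole_space (\<sigma> n - x)) \<longlonglongrightarrow> 0" and 2: "(\<lambda>n. nrm ?Y (\<sigma> n - y)) \<longlonglongrightarrow> 0"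
    have "(\<lambda>n. norm (\<sigma> n - y)) \<longlonglongrightarrow> 0"
      using 2 by (intro tendsto_sandwich[OF _ _ tendsto_const[of 0] 2]) (auto simp: norm_p)
    with 1 have "\<sigma> \<longlonglongrightarrow> x" "\<sigma> \<longlonglongrightarrow> y"
      by (simp_all add: tendsto_norm_zero_iff LIM_zero_iff)
    then show "x = y" by (rule LIMSEQ_unique)
  qed auto
  show ?thesis
    by (rule that[of C]) (use C le_p in \<open>smt (verit) norm_ge_zero\<close>)
qed


section \<open>Cauchy's estimate on a complexified Banach space\<close>

lemma cscale_simps:
  "cscale c (cscale d p) = cscale (c * d) p" "cscale 1 p = p" "cscale (of_real r) p = r *\<^sub>R p"
  "cscale c 0 = 0" "cscale 0 p = 0"
  by (auto simp: cscale_def prod_eq_iff algebra_simps)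

lemma norm_cscale_le: "norm (cscale c p) \<le> 2 * cmod c * norm p"
proof -
  have *: "norm (a *\<^sub>R x + b *\<^sub>R y) \<le> cmod (Complex a b) * norm (x, y)" for a b and x y :: 'a
  proof -
    have "norm (a *\<^sub>R x + b *\<^sub>R y) \<le> \<bar>a\<bar> * norm x + \<bar>b\<bar> * norm y"
      by (metis norm_scaleR norm_triangle_ineq)
    also have "\<dots> \<le> sqrt (a\<^sup>2 + b\<^sup>2) * sqrt ((norm x)\<^sup>2 + (norm y)\<^sup>2)"
    proof (rule power2_le_imp_le)
      have "(\<bar>a\<bar> * norm x + \<bar>b\<bar> * norm y)\<^sup>2 + (\<bar>a\<bar> * norm y - \<bar>b\<bar> * norm x)\<^sup>2
          = (\<bar>a\<bar>\<^sup>2 + \<bar>b\<bar>\<^sup>2) * ((norm x)\<^sup>2 + (norm y)\<^sup>2)"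
        by algebra
      moreover have "0 \<le> (\<bar>a\<bar> * norm y - \<bar>b\<bar> * norm x)\<^sup>2" by simp
      ultimately have "(\<bar>a\<bar> * norm x + \<bar>b\<bar> * norm y)\<^sup>2 \<le> (a\<^sup>2 + b\<^sup>2) * ((norm x)\<^sup>2 + (norm y)\<^sup>2)"
        by (simp only: power2_abs)
      then show "(\<bar>a\<bar> * norm x + \<bar>b\<bar> * norm y)\<^sup>2 \<le> (sqrt (a\<^sup>2 + b\<^sup>2) * sqrt ((norm x)\<^sup>2 + (norm y)\<^sup>2))\<^sup>2"
        by (simp add: power_mult_distrib)
    qed simp
    finally show ?thesis by (simp add: norm_Pair complex_norm)
  qed
  obtain x y where p: "p = (x, y)" by (cases p)
  have "norm (cscale c p) \<le> norm (fst (cscale c p)) + norm (snd (cscale c p))"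
    by (metis norm_Pair_le prod.collapse)
  moreover have "norm (fst (cscale c p)) \<le> cmod c * norm p"
    using *[of "Re c" x "- Im c" y] p by (simp add: cscale_def cmod_def)
  moreover have "norm (snd (cscale c p)) \<le> cmod c * norm p"
    using *[of "Im c" x "Re c" y] p by (simp add: cscale_def cmod_def add.commute)
  ultimately show ?thesis by linarith
qed

lemma bounded_bilinear_cscale: "bounded_bilinear (cscale :: complex \<Rightarrow> 'a::real_normed_vector \<times> 'a \<Rightarrow> _)"
proof
  show "\<exists>K. \<forall>c (p :: 'a \<times> 'a). norm (cscale c p) \<le> norm c * norm p * K"
  proof (intro exI allI)
    show "norm (cscale c p) \<le> norm c * norm p * 2" for c and p :: "'a \<times> 'a"
      using norm_cscale_le[of c p] by (simp add: mult_ac)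
  qed
qed (auto simp: cscale_def prod_eq_iff algebra_simps)

interpretation cscale: bounded_bilinear cscale
  by (rule bounded_bilinear_cscale)

lemma has_vector_derivative_cis:
  "((\<lambda>t. cis t) has_vector_derivative \<i> * cis t) (at t within S)"
proof -
  have "((\<lambda>z. exp (\<i> * z)) has_field_derivative \<i> * cis t) (at (of_real t))"
    by (auto intro!: derivative_eq_intros simp: cis_conv_exp)
  from has_vector_derivative_real_field[OF this] show ?thesis
    by (simp add: cis_conv_exp has_vector_derivative_at_within)
qed

text \<open>
  With \<open>I(\<rho>) = \<integral> e\<^bsup>-it\<^esup> f(z\<^sub>0 + \<rho> e\<^bsup>it\<^esup>) dt\<close> and \<open>K(\<rho>) = \<integral> f'(z\<^sub>0 + \<rho> e\<^bsup>it\<^esup>) dt\<close> over a period,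
  differentiation under the integral gives \<open>I' = K\<close> and integration by parts gives \<open>I = \<rho> K\<close>.  Hence \<open>K\<close> is
  constant, equal to \<open>2\<pi> f'(z\<^sub>0)\<close>, and \<open>f'(z\<^sub>0) = I(R) / (2\<pi>R)\<close>.  The factor 2 appears because the product
  norm is not homogeneous for complex scalars.
\<close>

lemma cauchy_estimate:
  fixes f f' :: "complex \<Rightarrow> 'a::banach \<times> 'a"
  assumes R: "0 < R"
    and der: "\<And>z. z \<in> cball z0 R \<Longrightarrow> (f has_derivative (\<lambda>h. cscale h (f' z))) (at z)"
    and cont: "continuous_on (cball z0 R) f'"
    and bound: "\<And>z. z \<in> cball z0 R \<Longrightarrow> norm (f z) \<le> B"
  shows "norm (f' z0) \<le> 2 * B / R"
proof -
  let ?z = "\<lambda>\<rho> t. z0 + of_real \<rho> * cis t"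
  have z: "?z \<rho> t \<in> cball z0 R" if "\<rho> \<in> {0..R}" for \<rho> t
    using that by (simp add: dist_norm norm_mult)
  define I where "I \<rho> = integral {0..2*pi} (\<lambda>t. cscale (cis (-t)) (f (?z \<rho> t)))" for \<rho>
  define K where "K \<rho> = integral {0..2*pi} (\<lambda>t. f' (?z \<rho> t))" for \<rho>
  have chain: "((\<lambda>s. f (g s)) has_vector_derivative cscale g' (f' (g s0))) (at s0 within S)"
    if "(g has_vector_derivative g') (at s0 within S)" "g s0 \<in> cball z0 R" for g g' s0 S
    using vector_derivative_diff_chain_within[OF that(1) has_derivative_at_withinI[OF der[OF that(2)]]]
    by (simp add: o_def)
  have contf: "continuous_on (cball z0 R) f"
    by (meson der has_derivative_at_withinI has_derivative_continuous_on)
  have int1: "(\<lambda>t. cscale (cis (-t)) (f (?z \<rho> t))) integrable_on {0..2*pi}" if "\<rho> \<in> {0..R}" for \<rho>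
    using z[OF that] by (intro integrable_continuous_real cscale.continuous_on continuous_intros
        continuous_on_compose2[OF contf]) auto
  have int2: "(\<lambda>t. f' (?z \<rho> t)) integrable_on {0..2*pi}" if "\<rho> \<in> {0..R}" for \<rho>
    using z[OF that] by (intro integrable_continuous_real continuous_intros
        continuous_on_compose2[OF cont]) auto
  have cont2: "continuous_on ({0..R} \<times> cbox 0 (2 * pi)) (\<lambda>(\<rho>, t). f' (?z \<rho> t))"
    unfolding case_prod_unfold using z
    by (intro continuous_intros continuous_on_compose2[OF cont]) auto
  have contK: "continuous_on {0..R} K"
    unfolding K_def using integral_continuous_on_param[OF cont2] by simp
  have derI: "(I has_vector_derivative K \<rho>) (at \<rho> within {0..R})" if \<rho>: "\<rho> \<in> {0..R}" for \<rho>
  proof -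
    have "((\<lambda>\<rho>. integral (cbox 0 (2*pi)) (\<lambda>t. cscale (cis (-t)) (f (?z \<rho> t)))) has_vector_derivative
        integral (cbox 0 (2*pi)) (\<lambda>t. f' (?z \<rho> t))) (at \<rho> within {0..R})"
    proof (rule leibniz_rule_vector_derivative[OF _ _ cont2 \<rho>])
      fix r t assume r: "r \<in> {0..R}"
      have "((\<lambda>r. ?z r t) has_vector_derivative cis t) (at r within {0..R})"
        by (auto intro!: derivative_eq_intros simp: has_vector_derivative_def scaleR_conv_of_real)
      from chain[OF this z[OF r]]
      have "((\<lambda>r. cscale (cis (-t)) (f (?z r t))) has_vector_derivative
          cscale (cis (-t)) (cscale (cis t) (f' (?z r t)))) (at r within {0..R})"
        by (rule bounded_linear.has_vector_derivative[OF cscale.bounded_linear_right])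
      then show "((\<lambda>r. cscale (cis (-t)) (f (?z r t))) has_vector_derivative f' (?z r t)) (at r within {0..R})"
        by (simp add: cscale_simps cis_mult)
    qed (use int1 in auto)
    then show ?thesis by (simp add: I_def[abs_def] K_def)
  qed
  \<comment> \<open>The integral of \<open>d/dt (\<i> e\<^bsup>-it\<^esup> f(z\<^sub>0 + \<rho> e\<^bsup>it\<^esup>))\<close> over a period vanishes.\<close>
  have IK: "I \<rho> = \<rho> *\<^sub>R K \<rho>" if \<rho>: "\<rho> \<in> {0..R}" for \<rho>
  proof -
    let ?G = "\<lambda>t. cscale (\<i> * cis (-t)) (f (?z \<rho> t))"
    have "(?G has_vector_derivative cscale (cis (-t)) (f (?z \<rho> t)) - \<rho> *\<^sub>R f' (?z \<rho> t)) (at t within {0..2*pi})"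
      for t
    proof -
      have 1: "((\<lambda>t. ?z \<rho> t) has_vector_derivative of_real \<rho> * (\<i> * cis t)) (at t within {0..2*pi})"
        using has_vector_derivative_add[OF has_vector_derivative_const
            has_vector_derivative_mult_right[OF has_vector_derivative_cis]] by simp
      have "((\<lambda>t. cis (- t)) has_vector_derivative (- 1) *\<^sub>R (\<i> * cis (- t))) (at t within {0..2*pi})"
        using vector_diff_chain_within[OF _ has_vector_derivative_cis, of uminus "-1" t "{0..2*pi}"]
        by (simp add: o_def has_vector_derivative_minus)
      from has_vector_derivative_mult_right[OF this, of \<i>]
      have 2: "((\<lambda>t. \<i> * cis (- t)) has_vector_derivative cis (- t)) (at t within {0..2*pi})"
        by (simp flip: mult.assoc)
      show ?thesis
      proof -
        have "\<i> * cis (- t) * (of_real \<rho> * (\<i> * cis t)) = (\<i> * \<i>) * of_real \<rho> * (cis (- t) * cis t)"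
          by (simp only: mult_ac)
        also have "\<dots> = of_real (- \<rho>)"
          unfolding cis_mult by simp
        finally have "cscale (\<i> * cis (- t)) (cscale (of_real \<rho> * (\<i> * cis t)) q) = (- \<rho>) *\<^sub>R q" for q :: "'a \<times> 'a"
          by (simp only: cscale_simps)
        with cscale.has_vector_derivative[OF 2 chain[OF 1 z[OF \<rho>]]] show ?thesis by simp
      qed
    qed
    then have 1: "((\<lambda>t. cscale (cis (-t)) (f (?z \<rho> t)) - \<rho> *\<^sub>R f' (?z \<rho> t)) has_integral ?G (2*pi) - ?G 0) {0..2*pi}"
      by (intro fundamental_theorem_of_calculus) auto
    have 2: "((\<lambda>t. cscale (cis (-t)) (f (?z \<rho> t)) - \<rho> *\<^sub>R f' (?z \<rho> t)) has_integral I \<rho> - \<rho> *\<^sub>R K \<rho>) {0..2*pi}"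
      unfolding I_def K_def
      by (intro has_integral_diff has_integral_cmul integrable_integral int1 int2 \<rho>)
    have "cis (- (2 * pi)) = 1"
      using cis_cnj[of "2 * pi"] by simp
    then have "?G (2*pi) - ?G 0 = 0"
      by simp
    with has_integral_unique[OF 1 2] show ?thesis by simp
  qed
  have "K R = K 0"
  proof (rule has_derivative_zero_unique_strong_interval[OF _ contK refl])
    show "finite {0 :: real}" by simp
    show "R \<in> {0..R}" using R by simp
    fix \<rho> assume \<rho>: "\<rho> \<in> {0..R} - {0}"
    have "((\<lambda>r. (1 / r) *\<^sub>R I r) has_vector_derivative (1 / \<rho>) *\<^sub>R K \<rho> + (- 1 / \<rho>\<^sup>2) *\<^sub>R I \<rho>) (at \<rho> within {0..R})"
      using \<rho> by (intro has_vector_derivative_scaleR derI)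
        (auto intro!: derivative_eq_intros simp: power2_eq_square field_simps)
    moreover have "(1 / \<rho>) *\<^sub>R K \<rho> + (- 1 / \<rho>\<^sup>2) *\<^sub>R I \<rho> = 0"
      using \<rho> IK[of \<rho>] by (simp add: power2_eq_square)
    ultimately have "((\<lambda>r. (1 / r) *\<^sub>R I r) has_derivative (\<lambda>h. 0)) (at \<rho> within {0..R})"
      by (simp add: has_vector_derivative_def)
    then show "(K has_derivative (\<lambda>h. 0)) (at \<rho> within {0..R})"
    proof (rule has_derivative_transform_within[where d = \<rho>])
      fix r assume "r \<in> {0..R}" "dist r \<rho> < \<rho>"
      then show "(1 / r) *\<^sub>R I r = K r"
        using IK[of r] by (auto simp: dist_real_def)
    qed (use \<rho> in auto)
  qed
  also have "K 0 = (2 * pi) *\<^sub>R f' z0"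
    by (simp add: K_def)
  finally have "(R * (2 * pi)) *\<^sub>R f' z0 = I R"
    using IK[of R] R by simp
  moreover have "norm (I R) \<le> (2 * B) * (2 * pi - 0)"
    unfolding I_def
  proof (rule integral_bound)
    fix t
    have "norm (cscale (cis (-t)) (f (?z R t))) \<le> 2 * cmod (cis (-t)) * norm (f (?z R t))"
      by (rule norm_cscale_le)
    also have "\<dots> \<le> 2 * B"
      using bound[OF z[of R t]] R by simp
    finally show "norm (cscale (cis (-t)) (f (?z R t))) \<le> 2 * B" .
  qed (use R z in \<open>auto intro!: cscale.continuous_on continuous_intros continuous_on_compose2[OF contf]\<close>)
  ultimately have "R * (2 * pi) * norm (f' z0) \<le> 2 * B * (2 * pi)"
    using R by (metis abs_of_pos diff_zero mult_pos_pos norm_scaleR pi_gt_zero zero_less_numeral)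
  then show ?thesis
    using R by (simp add: field_simps)
qed

section \<open>Analytic semigroups\<close>

lemma of_real_mem_sector: "0 < t \<Longrightarrow> 0 < \<phi> \<Longrightarrow> of_real t \<in> sector \<phi>"
  by (simp add: sector_def Arg_of_real)

lemma scale_mem_sector: "z \<in> sector \<phi> \<Longrightarrow> 0 < r \<Longrightarrow> of_real r * z \<in> sector \<phi>"
  by (simp add: sector_def Arg_times_of_real)

lemma disc_in_sector:
  assumes "0 < \<phi>"
  obtains r where "0 < r" "r < 1"
    "\<And>t z. 0 < t \<Longrightarrow> z \<in> cball (of_real t) (r * t) \<Longrightarrow> z \<in> sector \<phi>"
proof -
  have "isCont Arg 1"
    by (rule continuous_at_Arg) simp
  then obtain d where d: "0 < d" "\<And>w. dist w 1 < d \<Longrightarrow> dist (Arg w) (Arg 1) < \<phi>"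
    using assms unfolding continuous_at_eps_delta by blast
  define r where "r = min (1 / 2) (d / 2)"
  have r: "0 < r" "r < 1" "r < d" using d by (auto simp: r_def)
  show ?thesis
  proof (rule that[OF r(1,2)])
    fix t :: real and z :: complex
    assume t: "0 < t" and z: "z \<in> cball (of_real t) (r * t)"
    define w where "w = z / of_real t"
    have "w - 1 = (z - of_real t) / of_real t"
      using t by (simp add: w_def diff_divide_distrib)
    then have "norm (w - 1) \<le> r"
      using t z by (simp add: norm_divide dist_norm norm_minus_commute pos_divide_le_eq del: of_real_add)
    then have "dist w 1 < d" "w \<noteq> 0"
      using r by (auto simp: dist_norm)
    then have "w \<in> sector \<phi>"
      using d(2)[of w] by (simp add: sector_def dist_real_def)
    from scale_mem_sector[OF this t] show "z \<in> sector \<phi>"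
      using t by (simp add: w_def)
  qed
qed

text \<open>
  Near the origin the extension to the sector is bounded by the uniform boundedness principle, and
  the law \<open>H (z + w) = H z H w\<close> carries the bound to every bounded part of the sector.
\<close>

lemma bounded_on_sector:
  fixes H :: "complex \<Rightarrow> 'v::banach \<Rightarrow>\<^sub>L 'v"
  assumes mult: "\<And>z w. z \<in> sector \<phi> \<Longrightarrow> w \<in> sector \<phi> \<Longrightarrow> H (z + w) = H z o\<^sub>L H w"
    and lim: "\<And>p. ((\<lambda>z. blinfun_apply (H z) p) \<longlongrightarrow> p) (at 0 within sector \<phi>)"
  obtains M where "0 \<le> M" "\<And>z p. z \<in> sector \<phi> \<Longrightarrow> norm z \<le> R \<Longrightarrow> norm (H z p) \<le> M * norm p"
proof -
  have "\<exists>n. \<forall>z\<in>sector \<phi>. norm z < 1 / real (Suc n) \<longrightarrow> (\<forall>p. norm (H z p) \<le> real n * norm p)"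
  proof (rule ccontr)
    assume "\<not> ?thesis"
    then have "\<forall>n. \<exists>z p. z \<in> sector \<phi> \<and> norm z < 1 / real (Suc n) \<and> real n * norm p < norm (H z p)"
      by (simp add: not_le Bex_def)
    then obtain Z P where Z: "\<And>n. Z n \<in> sector \<phi>" "\<And>n. norm (Z n) < 1 / real (Suc n)"
      "\<And>n. real n * norm (P n) < norm (H (Z n) (P n))"
      by metis
    have "Z \<longlonglongrightarrow> 0"
      by (rule tendsto_norm_zero_cancel, rule tendsto_sandwich[OF _ _ tendsto_const[of 0] LIMSEQ_inverse_real_of_nat])
         (use Z(2) in \<open>auto intro!: always_eventually less_imp_le simp: inverse_eq_divide\<close>)
    then have Z0: "filterlim Z (at 0 within sector \<phi>) sequentially"
      using Z(1) by (auto simp: filterlim_at sector_def)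
    obtain C where C: "\<And>n x. norm (H (Z n) x) \<le> C * norm x"
    proof (rule uniform_boundedness[of "\<lambda>n. blinfun_apply (H (Z n))"])
      show "bounded (range (\<lambda>n. blinfun_apply (H (Z n)) x))" for x
        using filterlim_compose[OF lim Z0] by (intro convergent_imp_bounded)
    qed (auto simp: blinfun.bounded_linear_right)
    obtain n where "C \<le> real n" using real_arch_simple by blast
    then have "C * norm (P n) \<le> real n * norm (P n)"
      by (intro mult_right_mono) auto
    with C[of n "P n"] Z(3)[of n] show False by linarith
  qed
  then obtain n where n: "\<And>z p. z \<in> sector \<phi> \<Longrightarrow> norm z < 1 / real (Suc n) \<Longrightarrow> norm (H z p) \<le> real n * norm p"
    by blast
  obtain k where k: "R * real (Suc n) < real k" using reals_Archimedean2 by blast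
  have pow: "norm (H (of_nat (Suc j) * w) p) \<le> real n ^ Suc j * norm p"
    if w: "w \<in> sector \<phi>" "norm w < 1 / real (Suc n)" for j w p
  proof (induction j)
    case 0
    then show ?case using n[OF w] by simp
  next
    case (Suc j)
    have "of_nat (Suc j) * w \<in> sector \<phi>"
      using scale_mem_sector[OF w(1), of "real (Suc j)"] by simp
    then have "H (w + of_nat (Suc j) * w) = H w o\<^sub>L H (of_nat (Suc j) * w)"
      using w by (intro mult)
    then have "norm (H (of_nat (Suc (Suc j)) * w) p) = norm (H w (H (of_nat (Suc j) * w) p))"
      by (simp add: algebra_simps)
    also have "\<dots> \<le> real n * norm (H (of_nat (Suc j) * w) p)"
      using n[OF w] .
    also have "\<dots> \<le> real n * (real n ^ Suc j * norm p)"
      using Suc by (intro mult_left_mono) auto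
    finally show ?case by (simp add: mult.assoc)
  qed
  show ?thesis
  proof (rule that[of "real n ^ Suc k"])
    fix z p assume z: "z \<in> sector \<phi>" "norm z \<le> R"
    define w where "w = of_real (1 / real (Suc k)) * z"
    have "w \<in> sector \<phi>" unfolding w_def using z by (intro scale_mem_sector) auto
    moreover have "norm w < 1 / real (Suc n)"
    proof -
      have "norm z * real (Suc n) \<le> R * real (Suc n)"
        using z(2) by (rule mult_right_mono) simp
      with k have "norm z * real (Suc n) < real (Suc k)"
        by linarith
      moreover have "norm w = norm z / real (Suc k)"
        unfolding w_def norm_mult norm_of_real by simp
      ultimately show ?thesis
        by (simp add: pos_less_divide_eq pos_divide_less_eq del: of_nat_Suc)
    qed
    ultimately have "norm (H (of_nat (Suc k) * w) p) \<le> real n ^ Suc k * norm p"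
      by (rule pow)
    moreover have "of_nat (Suc k) * w = z"
    proof -
      have "of_nat (Suc k) * w = of_real (real (Suc k) * (1 / real (Suc k))) * z"
        unfolding w_def by (simp only: of_real_mult of_real_of_nat_eq mult.assoc)
      also have "real (Suc k) * (1 / real (Suc k)) = 1" by simp
      finally show ?thesis by simp
    qed
    ultimately show "norm (H z p) \<le> real n ^ Suc k * norm p" by simp
  qed simp
qed

text \<open>
  \<open>\<parallel>A e\<^sup>t\<^sup>A\<parallel> = O(1/t)\<close>: a disc around \<open>t\<close> of radius proportional to \<open>t\<close> lies in the sector, where
  the semigroup is bounded, so Cauchy's estimate applies.
\<close>

lemma analytic_semigroup_estimates:
  fixes S :: "real \<Rightarrow> 'a::banach \<Rightarrow> 'a"
  assumes S: "analytic_semigroup scl S"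
  obtains M where "1 \<le> M" "\<And>t x. t \<in> {0..R} \<Longrightarrow> norm (S t x) \<le> M * norm x"
    "\<And>t x. t \<in> {0<..R} \<Longrightarrow> \<exists>y. ((\<lambda>s. S s x) has_vector_derivative y) (at t) \<and> norm y \<le> M / t * norm x"
proof -
  have S0: "S 0 = (\<lambda>x. x)"
    using conjunct1[OF S[unfolded analytic_semigroup_def]] by (simp add: c0_semigroup_def)
  obtain \<phi> H where \<phi>: "0 < \<phi>"
    and ext': "\<forall>t>0. \<forall>x y. blinfun_apply (H (complex_of_real t)) (x, y) = (S t x, S t y)"
    and ex: "\<forall>z\<in>sector \<phi>. \<exists>D. (H has_derivative D) (at z) \<and>
             (\<forall>h p. blinfun_apply (D h) p = cscale h (blinfun_apply (D 1) p))"
    and mult': "\<forall>z\<in>sector \<phi>. \<forall>w\<in>sector \<phi>. H (z + w) = H z o\<^sub>L H w"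
    and lim': "\<forall>p. ((\<lambda>z. blinfun_apply (H z) p) \<longlongrightarrow> p) (at 0 within sector \<phi>)"
    using S unfolding analytic_semigroup_def
    apply (elim conjE exE)
    subgoal premises p for \<phi> H
      by (rule p(1)[of \<phi> H, OF p(3,5,7,8,9)])
    done
  note ext = ext'[rule_format] and mult = mult'[rule_format] and lim = lim'[rule_format]
  from bchoice[OF ex] obtain D where D0: "\<forall>z\<in>sector \<phi>. (H has_derivative D z) (at z) \<and>
      (\<forall>h p. blinfun_apply (D z h) p = cscale h (blinfun_apply (D z 1) p))" ..
  have der: "(H has_derivative D z) (at z)" if "z \<in> sector \<phi>" for z
    using bspec[OF D0 that] by (rule conjunct1)
  have D: "blinfun_apply (D z h) p = cscale h (blinfun_apply (D z 1) p)" if "z \<in> sector \<phi>" for z h p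
    using conjunct2[OF bspec[OF D0 that]] by (rule spec2)
  define G where "G z p = blinfun_apply (D z 1) p" for z p
  have derp: "((\<lambda>z. blinfun_apply (H z) p) has_derivative (\<lambda>h. cscale h (G z p))) (at z)"
    if "z \<in> sector \<phi>" for z p
  proof -
    have "(\<lambda>h. blinfun_apply (D z h) p) = (\<lambda>h. cscale h (G z p))"
      unfolding G_def by (rule HOL.ext) (rule D[OF that])
    with bounded_linear.has_derivative[OF blinfun.bounded_linear_left der[OF that], of p]
    show ?thesis by simp
  qed
  obtain r where r: "0 < r" "r < 1"
    and disc: "\<And>t z. 0 < t \<Longrightarrow> z \<in> cball (of_real t) (r * t) \<Longrightarrow> z \<in> sector \<phi>"
    using disc_in_sector[OF \<phi>] by metis
  obtain M where M: "0 \<le> M" "\<And>z p. z \<in> sector \<phi> \<Longrightarrow> norm z \<le> 2 * R \<Longrightarrow> norm (H z p) \<le> M * norm p"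
    using bounded_on_sector[OF mult lim, of "2 * R"] by metis
  have G: "norm (G (of_real t) p) \<le> 4 * M / (r * t) * norm p" if t: "0 < t" "t \<le> R" for t p
  proof -
    have half: "z - of_real (t / 2) \<in> sector \<phi>" if z: "z \<in> cball (of_real t) (r * t / 2)" for z
    proof (rule disc[of "t / 2"])
      have "of_real (t / 2) - (z - of_real (t / 2)) = of_real t - z"
        by simp
      then show "z - of_real (t / 2) \<in> cball (of_real (t / 2)) (r * (t / 2))"
        using z by (simp only: mem_cball dist_norm)
    qed (use t in simp)
    have sub: "z \<in> sector \<phi>" if "z \<in> cball (of_real t) (r * t / 2)" for z
    proof (rule disc[OF t(1)])
      have "0 < r * t" using r t by simp
      then show "z \<in> cball (of_real t) (r * t)" using that by (simp add: field_simps)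
    qed
    have t2: "of_real (t / 2) \<in> sector \<phi>"
      using of_real_mem_sector[OF _ \<phi>, of "t / 2"] t by simp
    \<comment> \<open>The derivative factors through the fixed point \<open>t/2\<close>, which makes it continuous.\<close>
    have GH: "G z p = G (of_real (t / 2)) (H (z - of_real (t / 2)) p)"
      if z: "z \<in> cball (of_real t) (r * t / 2)" for z
    proof -
      define \<zeta> where "\<zeta> = z - of_real (t / 2)"
      have \<zeta>: "\<zeta> \<in> sector \<phi>" unfolding \<zeta>_def by (rule half[OF z])
      have zz: "of_real (t / 2) + \<zeta> = z" by (simp add: \<zeta>_def)
      have 1: "((\<lambda>w. blinfun_apply (H w) (H \<zeta> p)) has_derivative
          (\<lambda>h. cscale h (G (of_real (t / 2)) (H \<zeta> p)))) (at (of_real (t / 2)))"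
        by (rule derp[OF t2])
      have "((\<lambda>w. w + \<zeta>) has_derivative (\<lambda>h. h)) (at (of_real (t / 2)))"
        by (auto intro!: derivative_eq_intros)
      from has_derivative_compose[OF this, of "\<lambda>z. blinfun_apply (H z) p" "\<lambda>h. cscale h (G z p)"]
      have 2: "((\<lambda>w. blinfun_apply (H (w + \<zeta>)) p) has_derivative (\<lambda>h. cscale h (G z p))) (at (of_real (t / 2)))"
        using derp[OF sub[OF z]] zz by simp
      have "((\<lambda>w. blinfun_apply (H w) (H \<zeta> p)) has_derivative (\<lambda>h. cscale h (G z p))) (at (of_real (t / 2)))"
      proof (rule has_derivative_transform_within_open[OF 2])
        show "open (ball (of_real (t / 2) :: complex) (r * (t / 2)))" by simp
        show "of_real (t / 2) \<in> ball (of_real (t / 2) :: complex) (r * (t / 2))"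
          using r t by simp
        fix w assume "w \<in> ball (of_real (t / 2) :: complex) (r * (t / 2))"
        then have "w \<in> sector \<phi>"
          using disc[of "t / 2" w] t by simp
        then show "blinfun_apply (H (w + \<zeta>)) p = blinfun_apply (H w) (H \<zeta> p)"
          using mult[OF _ \<zeta>] by simp
      qed
      from has_derivative_unique[OF this 1] have "cscale 1 (G z p) = cscale 1 (G (of_real (t / 2)) (H \<zeta> p))"
        by meson
      then show ?thesis by (simp add: cscale_simps \<zeta>_def)
    qed
    have "norm (G (of_real t) p) \<le> 2 * (M * norm p) / (r * t / 2)"
    proof (rule cauchy_estimate)
      show "0 < r * t / 2" using r t by simp
      fix z assume z: "z \<in> cball (complex_of_real t) (r * t / 2)"
      show "((\<lambda>z. blinfun_apply (H z) p) has_derivative (\<lambda>h. cscale h (G z p))) (at z)"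
        by (rule derp[OF sub[OF z]])
      have "norm z \<le> norm (complex_of_real t) + norm (complex_of_real t - z)"
        by (metis add.commute norm_minus_commute norm_triangle_sub)
      also have "\<dots> \<le> t + r * t / 2" using z t by (simp add: dist_norm)
      also have "r * t / 2 \<le> t" using r t by (simp add: field_simps) 
      finally show "norm (H z p) \<le> M * norm p"
        using t by (intro M(2) sub z) auto
    next
      have "continuous_on (cball (complex_of_real t) (r * t / 2)) (\<lambda>z. G (of_real (t / 2)) (H (z - of_real (t / 2)) p))"
        unfolding G_def
      proof (intro blinfun.continuous_on continuous_on_const)
        have "continuous_on (sector \<phi>) H"
          by (meson der has_derivative_at_withinI has_derivative_continuous_on)
        then show "continuous_on (cball (complex_of_real t) (r * t / 2)) (\<lambda>z. H (z - of_real (t / 2)))"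
          by (rule continuous_on_compose2) (use half in \<open>auto intro!: continuous_intros\<close>)
      qed
      then show "continuous_on (cball (complex_of_real t) (r * t / 2)) (\<lambda>z. G z p)"
        by (rule continuous_on_eq) (use GH in auto)
    qed
    then show ?thesis by (simp add: field_simps)
  qed
  define M' where "M' = max 1 (max M (4 * M / r))"
  have M': "1 \<le> M'" "M \<le> M'" "4 * M / r \<le> M'" by (auto simp: M'_def)
  show ?thesis
  proof (rule that[OF M'(1)])
    fix t x assume t: "t \<in> {0..R}"
    show "norm (S t x) \<le> M' * norm x"
    proof (cases "t = 0")
      case True
      then show ?thesis using mult_right_mono[OF M'(1), of "norm x"] by (simp add: S0)
    next
      case False
      then have t0: "0 < t" "t \<le> R" using t by auto
      have "norm (S t x) \<le> norm (H (of_real t) (x, 0))"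
        using norm_fst_le[of "S t x" "S t 0"] by (simp add: ext t0)
      also have "\<dots> \<le> M * norm (x, 0 :: 'a)"
        using t0 by (intro M(2) of_real_mem_sector \<phi>) auto
      also have "\<dots> \<le> M' * norm x"
        using M'(2) by (simp add: mult_right_mono norm_Pair)
      finally show ?thesis .
    qed
  next
    fix t x assume "t \<in> {0<..R}"
    then have t: "0 < t" "t \<le> R" by auto
    have "((\<lambda>s. of_real s) has_vector_derivative 1) (at t)"
      by (auto intro!: derivative_eq_intros simp: has_vector_derivative_def scaleR_conv_of_real)
    from vector_derivative_diff_chain_within[OF this, of "\<lambda>z. blinfun_apply (H z) (x, 0)"
        "\<lambda>h. cscale h (G (of_real t) (x, 0))"]
    have "((\<lambda>s. blinfun_apply (H (of_real s)) (x, 0)) has_vector_derivative G (of_real t) (x, 0)) (at t)"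
      using derp[OF of_real_mem_sector[OF t(1) \<phi>], of "(x, 0)"]
      by (simp add: o_def cscale_simps has_derivative_at_withinI)
    then have "((\<lambda>s. fst (blinfun_apply (H (of_real s)) (x, 0))) has_vector_derivative fst (G (of_real t) (x, 0))) (at t)"
      by (rule bounded_linear.has_vector_derivative[OF bounded_linear_fst])
    then have "((\<lambda>s. S s x) has_vector_derivative fst (G (of_real t) (x, 0))) (at t)"
      by (rule has_vector_derivative_transform_within_open[where S = "{0<..}"]) (use t ext in auto)
    moreover have "norm (fst (G (of_real t) (x, 0))) \<le> M' / t * norm x"
    proof -
      have "norm (fst (G (of_real t) (x, 0))) \<le> norm (G (of_real t) (x, 0))"
        by (metis norm_fst_le prod.collapse)
      also have "\<dots> \<le> 4 * M / (r * t) * norm (x, 0 :: 'a)"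
        by (rule G[OF t])
      also have "\<dots> = 4 * M / r / t * norm x" by (simp add: norm_Pair)
      also have "\<dots> \<le> M' / t * norm x"
        using M'(3) t by (intro mult_right_mono divide_right_mono) auto
      finally show ?thesis .
    qed
    ultimately show "\<exists>y. ((\<lambda>s. S s x) has_vector_derivative y) (at t) \<and> norm y \<le> M' / t * norm x"
      by blast
  qed
qed

section \<open>Integrals with weak singularities\<close>

text \<open>
  A norm of a smaller space, composed with a smoothing operator, is a continuous seminorm on \<open>E\<^sub>0\<close>.
  The triangle inequality for integrals holds for such seminorms because Riemann sums obey it.
\<close>

lemma seminorm_integral_le:
  fixes f :: "real \<Rightarrow> 'a::real_normed_vector" and q :: "'a \<Rightarrow> real"
  assumes q_add: "\<And>x y. q (x + y) \<le> q x + q y"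
    and q_scale: "\<And>r x. q (r *\<^sub>R x) = \<bar>r\<bar> * q x"
    and q_le: "\<And>x. q x \<le> C * norm x"
    and f: "(f has_integral I) {a..b}" and g: "(g has_integral J) {a..b}"
    and le: "\<And>x. x \<in> {a<..<b} \<Longrightarrow> q (f x) \<le> g x"
  shows "q I \<le> J"
proof (rule field_le_epsilon)
  fix e :: real assume e: "0 < e"
  have q0: "q 0 = 0" using q_scale[of 0 0] by simp
  have q_sum: "q (sum h P) \<le> (\<Sum>i\<in>P. q (h i))" if "finite P" for h :: "real \<times> real set \<Rightarrow> 'a" and P
    using that by (induction P) (auto simp: q0 intro: order_trans[OF q_add])
  define F where "F x = (if x \<in> {a<..<b} then f x else 0)" for x
  define G where "G x = (if x \<in> {a<..<b} then g x else 0)" for x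
  have F: "(F has_integral I) (cbox a b)"
    using has_integral_spike_interior[of f I a b F] f by (auto simp: F_def)
  have G: "(G has_integral J) (cbox a b)"
    using has_integral_spike_interior[of g J a b G] g by (auto simp: G_def)
  define C' where "C' = max C 1"
  have C': "0 < C'" "q x \<le> C' * norm x" for x
    using q_le[of x] mult_right_mono[of C C' "norm x"] by (auto simp: C'_def)
  define d where "d = e / (2 * C')"
  have d: "0 < d" using e C' by (simp add: d_def)
  obtain \<gamma>1 where \<gamma>1: "gauge \<gamma>1" "\<And>D. D tagged_division_of cbox a b \<and> \<gamma>1 fine D \<Longrightarrow>
      norm ((\<Sum>(x,k)\<in>D. measure lborel k *\<^sub>R F x) - I) < d"
    using F d unfolding has_integral by meson
  obtain \<gamma>2 where \<gamma>2: "gauge \<gamma>2" "\<And>D. D tagged_division_of cbox a b \<and> \<gamma>2 fine D \<Longrightarrow>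
      norm ((\<Sum>(x,k)\<in>D. measure lborel k *\<^sub>R G x) - J) < e / 2"
    using G half_gt_zero[OF e] unfolding has_integral by meson
  obtain D where D: "D tagged_division_of cbox a b" "(\<lambda>x. \<gamma>1 x \<inter> \<gamma>2 x) fine D"
    using fine_division_exists[OF gauge_Int[OF \<gamma>1(1) \<gamma>2(1)]] by metis
  then have fine: "\<gamma>1 fine D" "\<gamma>2 fine D" by (auto simp: fine_Int)
  let ?f = "\<Sum>(x,k)\<in>D. measure lborel k *\<^sub>R F x" and ?g = "\<Sum>(x,k)\<in>D. measure lborel k *\<^sub>R G x"
  have "q ?f \<le> (\<Sum>(x,k)\<in>D. q (measure lborel k *\<^sub>R F x))"
    using q_sum[of D "\<lambda>(x,k). measure lborel k *\<^sub>R F x"] D(1) by (simp add: split_def tagged_division_of_finite)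
  also have "\<dots> \<le> ?g"
  proof (rule sum_mono)
    fix i assume "i \<in> D"
    have "q (F x) \<le> G x" for x
      using le q0 by (auto simp: F_def G_def)
    then show "(case i of (x, k) \<Rightarrow> q (measure lborel k *\<^sub>R F x)) \<le> (case i of (x, k) \<Rightarrow> measure lborel k *\<^sub>R G x)"
      by (auto simp: q_scale split_def intro!: mult_left_mono)
  qed
  also have "?g \<le> J + e / 2"
  proof -
    have "norm (?g - J) < e / 2"
      using \<gamma>2(2)[of D] D fine by simp
    then show ?thesis
      unfolding real_norm_def by linarith
  qed
  finally have "q ?f \<le> J + e / 2" .
  moreover have "q I \<le> q ?f + q (I - ?f)"
    using q_add[of ?f "I - ?f"] by simp
  moreover have "q (I - ?f) \<le> C' * d"
  proof -
    have "norm (I - ?f) \<le> d"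
      using \<gamma>1(2)[of D] D fine by (simp add: norm_minus_commute)
    then show ?thesis
      using C'(2)[of "I - ?f"] C'(1) by (meson mult_left_mono less_imp_le order_trans)
  qed
  moreover have "C' * d = e / 2"
    using C'(1) by (simp add: d_def)
  ultimately show "q I \<le> J + e" by simp
qed

lemma has_integral_powr_neg:
  fixes \<nu> a b :: real
  assumes "\<nu> < 1" "0 \<le> a" "a \<le> b"
  shows "((\<lambda>s. s powr - \<nu>) has_integral (b powr (1 - \<nu>) - a powr (1 - \<nu>)) / (1 - \<nu>)) {a..b}"
proof -
  have "((\<lambda>s. s powr - \<nu>) has_integral b powr (1 - \<nu>) / (1 - \<nu>) - a powr (1 - \<nu>) / (1 - \<nu>)) {a..b}"
  proof (rule fundamental_theorem_of_calculus_interior[OF assms(3)])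
    show "continuous_on {a..b} (\<lambda>s. s powr (1 - \<nu>) / (1 - \<nu>))"
      using assms by (intro continuous_on_divide continuous_on_powr' continuous_intros) auto
    fix s assume s: "s \<in> {a<..<b}"
    then have "((\<lambda>s. s powr (1 - \<nu>) / (1 - \<nu>)) has_real_derivative s powr - \<nu>) (at s)"
      using assms by (auto intro!: derivative_eq_intros)
    then show "((\<lambda>s. s powr (1 - \<nu>) / (1 - \<nu>)) has_vector_derivative s powr - \<nu>) (at s)"
      by (simp add: has_real_derivative_iff_has_vector_derivative)
  qed
  then show ?thesis by (simp add: diff_divide_distrib)
qed

lemma has_integral_powr_neg_reflected:
  fixes \<alpha> c t :: real
  assumes "\<alpha> < 1" "c \<le> t"
  shows "((\<lambda>s. (t - s) powr - \<alpha>) has_integral (t - c) powr (1 - \<alpha>) / (1 - \<alpha>)) {c..t}"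
proof -
  have "((\<lambda>s. s powr - \<alpha>) has_integral (t - c) powr (1 - \<alpha>) / (1 - \<alpha>)) {0..t - c}"
    using has_integral_powr_neg[of \<alpha> 0 "t - c"] assms by simp
  then have "((\<lambda>s. (- s) powr - \<alpha>) has_integral (t - c) powr (1 - \<alpha>) / (1 - \<alpha>)) {c - t..0}"
    using has_integral_reflect_real[of "\<lambda>s. s powr - \<alpha>" _ "t - c" 0] by simp
  from has_integral_shift_real_ivl[OF this, of "- t"]
  show ?thesis by simp
qed

lemma has_integral_beta_kernel:
  fixes \<alpha> \<nu> t :: real
  assumes "\<alpha> < 1" "\<nu> < 1" "0 < t"
  shows "((\<lambda>s. (t - s) powr - \<alpha> * s powr - \<nu>) has_integral
    t powr (1 - \<alpha> - \<nu>) * Beta (1 - \<nu>) (1 - \<alpha>)) {0..t}"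
proof -
  have "((\<lambda>x. x powr - \<nu> * (1 - x) powr - \<alpha>) has_integral Beta (1 - \<nu>) (1 - \<alpha>)) {0..1}"
    using has_integral_Beta_real[of "1 - \<nu>" "1 - \<alpha>"] assms by simp
  from has_integral_stretch_real[OF this, of "1 / t"]
  have "((\<lambda>s. (s / t) powr - \<nu> * (1 - s / t) powr - \<alpha>) has_integral t * Beta (1 - \<nu>) (1 - \<alpha>)) {0..t}"
    using image_divide_atLeastAtMost[of "1 / t" 0 1] assms by simp
  from has_integral_mult_right[OF this, of "t powr (- \<alpha> - \<nu>)"]
  have "((\<lambda>s. t powr (- \<alpha> - \<nu>) * ((s / t) powr - \<nu> * (1 - s / t) powr - \<alpha>)) has_integral
      t powr (- \<alpha> - \<nu>) * (t * Beta (1 - \<nu>) (1 - \<alpha>))) {0..t}" .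
  moreover have "t powr (- \<alpha> - \<nu>) * (t * Beta (1 - \<nu>) (1 - \<alpha>)) = t powr (1 - \<alpha> - \<nu>) * Beta (1 - \<nu>) (1 - \<alpha>)"
  proof -
    have "t powr (1 - \<alpha> - \<nu>) = t powr (1 + (- \<alpha> - \<nu>))" by (simp add: algebra_simps)
    also have "\<dots> = t * t powr (- \<alpha> - \<nu>)" using assms by (simp add: powr_add)
    finally show ?thesis by simp
  qed
  moreover have "t powr (- \<alpha> - \<nu>) * ((s / t) powr - \<nu> * (1 - s / t) powr - \<alpha>) = (t - s) powr - \<alpha> * s powr - \<nu>"
    if s: "s \<in> {0..t}" for s
  proof -
    have "(s / t) powr - \<nu> = s powr - \<nu> / t powr - \<nu>"
      by (rule powr_divide)
    moreover have "(1 - s / t) powr - \<alpha> = (t - s) powr - \<alpha> / t powr - \<alpha>"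
    proof -
      have "1 - s / t = (t - s) / t" using assms by (simp add: diff_divide_distrib)
      then show ?thesis by (simp add: powr_divide)
    qed
    moreover have "t powr (- \<alpha> - \<nu>) = t powr - \<alpha> * t powr - \<nu>"
      by (simp flip: powr_add)
    ultimately show ?thesis using assms by simp
  qed
  ultimately show ?thesis
    by (metis (no_types, lifting) has_integral_cong)
qed

text \<open>
  Integrability at the singular endpoint follows from the fundamental theorem of calculus: the
  integrals from \<open>x\<close> to \<open>t\<close> converge as \<open>x \<rightarrow> 0\<close>, so they extend to a continuous primitive.
\<close>

lemma integrable_weakly_singular:
  fixes \<phi> :: "real \<Rightarrow> 'a::banach" and \<nu> :: real
  assumes cont: "continuous_on {0<..t} \<phi>" and \<nu>: "\<nu> < 1"
    and bound: "\<And>s. s \<in> {0<..t} \<Longrightarrow> norm (\<phi> s) \<le> C * s powr - \<nu>"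
  shows "\<phi> integrable_on {0..t}"
proof (cases "0 < t")
  case t: True
  have "0 \<le> C * t powr - \<nu>"
    using bound[of t] t order_trans[OF norm_ge_zero[of "\<phi> t"]] by simp
  then have C: "0 \<le> C"
    using mult_neg_pos[of C "t powr - \<nu>"] t by force
  define P where "P x = integral {x..t} \<phi>" for x
  have int: "\<phi> integrable_on {x..y}" if "0 < x" "y \<le> t" for x y
    using that by (intro integrable_continuous_real continuous_on_subset[OF cont]) auto
  define c where "c = C / (1 - \<nu>)"
  have c: "0 \<le> c" using C \<nu> by (simp add: c_def)
  have diff: "norm (P x - P y) \<le> c * y powr (1 - \<nu>)" if xy: "0 < x" "x \<le> y" "y \<le> t" for x y
  proof -
    have "P x = integral {x..y} \<phi> + P y"
      unfolding P_def using xy by (intro Henstock_Kurzweil_Integration.integral_combine[symmetric] int) auto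
    then have "norm (P x - P y) = norm (integral {x..y} \<phi>)" by simp
    also have "\<dots> \<le> integral {x..y} (\<lambda>s. C * s powr - \<nu>)"
      using xy has_integral_powr_neg[OF \<nu>, of x y]
      by (intro integral_norm_bound_integral int integrable_on_mult_right) (auto intro!: bound)
    also have "\<dots> = C * ((y powr (1 - \<nu>) - x powr (1 - \<nu>)) / (1 - \<nu>))"
      using xy has_integral_powr_neg[OF \<nu>, of x y] by (simp add: integral_unique)
    also have "\<dots> \<le> c * y powr (1 - \<nu>)"
      using \<nu> C by (simp add: c_def divide_right_mono mult_left_mono algebra_simps)
    finally show ?thesis .
  qed
  have lim0: "((\<lambda>x. c * x powr (1 - \<nu>)) \<longlongrightarrow> 0) (at_right 0)"
    using \<nu> by (auto intro!: tendsto_eq_intros simp: eventually_at_filter)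
  define X where "X n = t / real (Suc n)" for n
  have X: "0 < X n" "X n \<le> t" "antimono X" for n
    using t by (auto simp: X_def field_simps monotone_def intro!: divide_left_mono)
  have X0: "X \<longlonglongrightarrow> 0"
    unfolding X_def using tendsto_mult_right_zero[OF LIMSEQ_inverse_real_of_nat, of t]
    by (simp add: divide_inverse)
  then have X0': "filterlim X (at_right 0) sequentially"
    using X by (auto simp: filterlim_at intro!: always_eventually less_imp_neq[THEN not_sym])
  have "Cauchy (\<lambda>n. P (X n))"
    unfolding Cauchy_iff
  proof (intro allI impI)
    fix e :: real assume "0 < e"
    then obtain N where N: "c * X N powr (1 - \<nu>) < e"
      using order_tendstoD(2)[OF filterlim_compose[OF lim0 X0'], of e]
      by (auto simp: eventually_sequentially)
    have *: "norm (P (X m) - P (X n)) < e" if mn: "N \<le> n" "n \<le> m" for m n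
    proof -
      have "norm (P (X m) - P (X n)) \<le> c * X n powr (1 - \<nu>)"
        using X mn by (intro diff) (auto simp: antimono_def)
      also have "\<dots> \<le> c * X N powr (1 - \<nu>)"
        using X mn c \<nu> less_imp_le[OF X(1)[of n]] by (intro mult_left_mono powr_mono2) (auto simp: antimono_def)
      finally show ?thesis using N by simp
    qed
    have "norm (P (X m) - P (X n)) < e" if "N \<le> m" "N \<le> n" for m n
      using *[of m n] *[of n m] that by (cases "n \<le> m") (auto simp: norm_minus_commute)
    then show "\<exists>M. \<forall>m\<ge>M. \<forall>n\<ge>M. norm (P (X m) - P (X n)) < e" by blast
  qed
  then obtain L where L: "(\<lambda>n. P (X n)) \<longlonglongrightarrow> L"
    using Cauchy_convergent_iff convergent_def by blast
  have PL: "norm (P x - L) \<le> c * x powr (1 - \<nu>)" if x: "0 < x" "x \<le> t" for x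
  proof (rule tendsto_upperbound)
    show "(\<lambda>n. norm (P x - P (X n))) \<longlonglongrightarrow> norm (P x - L)"
      by (intro tendsto_intros L)
    have "\<forall>\<^sub>F n in sequentially. X n < x"
      using order_tendstoD(2)[OF X0 x(1)] .
    then show "\<forall>\<^sub>F n in sequentially. norm (P x - P (X n)) \<le> c * x powr (1 - \<nu>)"
    proof eventually_elim
      case (elim n)
      then show ?case
        using diff[of "X n" x] X x by (simp add: norm_minus_commute)
    qed
  qed simp
  define F where "F x = (if x \<le> 0 then - L else - P x)" for x
  have "continuous_on {0..t} F"
    unfolding continuous_on_eq_continuous_within
  proof
    fix x assume x: "x \<in> {0..t}"
    show "continuous (at x within {0..t}) F"
    proof (cases "x = 0")
      case True
      have "(F \<longlongrightarrow> F 0) (at_right 0)"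
      proof (rule LIM_zero_cancel, rule Lim_null_comparison[OF _ lim0])
        have "\<forall>\<^sub>F x in at_right 0. x \<in> {0<..<t}"
          using t by (rule eventually_at_right_real)
        then show "\<forall>\<^sub>F x in at_right 0. norm (F x - F 0) \<le> c * x powr (1 - \<nu>)"
        proof eventually_elim
          case (elim x)
          then have "norm (P x - L) \<le> c * x powr (1 - \<nu>)" by (intro PL) auto
          then show ?case using elim by (simp add: F_def norm_minus_commute)
        qed
      qed
      then show ?thesis
        using True t by (simp add: continuous_within at_within_Icc_at_right)
    next
      case False
      with x have x0: "0 < x" by simp
      have "continuous_on {x / 2..t} P"
        unfolding P_def using x0 by (intro indefinite_integral_continuous_1' int) auto
      then have "continuous_on {x / 2..t} (\<lambda>x. - P x)"
        by (rule continuous_on_minus)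
      then have "continuous_on {x / 2..t} F"
        by (rule continuous_on_eq) (use x0 in \<open>auto simp: F_def\<close>)
      then have "continuous (at x within {x / 2..t}) F"
        using x x0 by (auto simp: continuous_on_eq_continuous_within)
      moreover have "at x within {x / 2..t} = at x within {0..t}"
        by (rule at_within_nhd[of _ "{x / 2<..}"]) (use x0 in auto)
      ultimately show ?thesis by (simp add: continuous_within)
    qed
  qed
  moreover have "(F has_vector_derivative \<phi> x) (at x)" if x: "x \<in> {0<..<t}" for x
  proof -
    have "((\<lambda>u. integral {u..t} \<phi>) has_vector_derivative - \<phi> x) (at x within {x / 2..t})"
      using x by (intro integral_has_vector_derivative' continuous_on_subset[OF cont]) auto
    moreover have "at x within {x / 2..t} = at x"
      using x by (intro at_within_interior) auto
    ultimately have "(P has_vector_derivative - \<phi> x) (at x)"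
      unfolding P_def by simp
    from has_vector_derivative_minus[OF this]
    have "((\<lambda>u. - P u) has_vector_derivative \<phi> x) (at x)"
      by simp
    then show ?thesis
      by (rule has_vector_derivative_transform_within_open[where S = "{0<..<t}"])
        (use x in \<open>auto simp: F_def\<close>)
  qed
  ultimately have "(\<phi> has_integral F t - F 0) {0..t}"
    using t by (intro fundamental_theorem_of_calculus_interior) auto
  then show ?thesis by blast
next
  case False
  then have "t < 0 \<or> t = 0" by auto
  then show ?thesis using integrable_on_refl[of \<phi> 0] by auto
qed

section \<open>Smoothing properties of the semigroup\<close>

lemma right_difference_quotient:
  fixes f :: "real \<Rightarrow> 'a::real_normed_vector"
  assumes "(f has_vector_derivative D) (at_right t)"
  shows "((\<lambda>h. (f (h + t) - f t) /\<^sub>R h) \<longlongrightarrow> D) (at_right 0)"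
proof -
  have "((\<lambda>s. ((f s - f t) - (s - t) *\<^sub>R D) /\<^sub>R norm (s - t)) \<longlongrightarrow> 0) (at_right t)"
    using assms by (simp add: has_vector_derivative_def has_derivative_within diff_diff_eq inverse_eq_divide)
  then have lim: "((\<lambda>h. ((f (h + t) - f t) - h *\<^sub>R D) /\<^sub>R norm h) \<longlongrightarrow> 0) (at_right 0)"
    by (subst (asm) at_right_to_0) (simp add: filterlim_filtermap)
  have ev: "\<forall>\<^sub>F h in at_right 0. ((f (h + t) - f t) - h *\<^sub>R D) /\<^sub>R norm h = (f (h + t) - f t) /\<^sub>R h - D"
    using eventually_at_right_less[of "0::real"] by eventually_elim (simp add: scaleR_diff_right)
  show ?thesis
    by (rule LIM_zero_cancel) (use lim tendsto_cong[OF ev] in simp)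
qed

text \<open>
  The complex extension of the semigroup enters the remaining arguments only through these bounds for
  real times in \<open>[0, T]\<close>.
\<close>

locale smoothing_semigroup =
  fixes S :: "real \<Rightarrow> 'a::banach \<Rightarrow> 'a" and A :: "'a \<Rightarrow> 'a" and E\<^sub>1 :: "'a nspace" and T M :: real
  assumes T: "0 < T" and M: "1 \<le> M"
    and lin: "0 \<le> t \<Longrightarrow> bounded_linear (S t)"
    and S_0: "S 0 = (\<lambda>x. x)"
    and S_add: "0 \<le> s \<Longrightarrow> 0 \<le> t \<Longrightarrow> S (s + t) x = S s (S t x)"
    and S_lim0: "((\<lambda>t. S t x) \<longlongrightarrow> x) (at_right 0)"
    and S_bound: "t \<in> {0..T} \<Longrightarrow> norm (S t x) \<le> M * norm x"
    and S_der: "t \<in> {0<..T} \<Longrightarrow>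
      \<exists>y. ((\<lambda>s. S s x) has_vector_derivative y) (at t) \<and> norm y \<le> M / t * norm x"
    and gen: "generator S (carr E\<^sub>1) A"
    and E\<^sub>1: "banach_subspace E\<^sub>1"
    and emb: "\<exists>c. \<forall>x\<in>carr E\<^sub>1. norm x \<le> c * nrm E\<^sub>1 x"
begin

sublocale E\<^sub>1: banach_subspace E\<^sub>1
  by (rule E\<^sub>1)

lemma S_diff: "0 \<le> t \<Longrightarrow> S t (x - y) = S t x - S t y"
  by (rule linear_diff[OF bounded_linear.linear[OF lin]])

lemma S_plus: "0 \<le> t \<Longrightarrow> S t (x + y) = S t x + S t y"
  by (rule linear_add[OF bounded_linear.linear[OF lin]])

lemma S_scale: "0 \<le> t \<Longrightarrow> S t (r *\<^sub>R x) = r *\<^sub>R S t x"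
  by (rule linear_cmul[OF bounded_linear.linear[OF lin]])

lemma continuous_on_orbit: "continuous_on {0..T} (\<lambda>t. S t x)"
  unfolding continuous_on_eq_continuous_within
proof
  fix t assume t: "t \<in> {0..T}"
  show "continuous (at t within {0..T}) (\<lambda>t. S t x)"
  proof (cases "t = 0")
    case True
    then show ?thesis
      using S_lim0[of x] T by (simp add: continuous_within at_within_Icc_at_right S_0)
  next
    case False
    then obtain y where "((\<lambda>s. S s x) has_vector_derivative y) (at t)"
      using S_der[of t x] t by auto
    then have "isCont (\<lambda>s. S s x) t"
      by (rule has_vector_derivative_continuous)
    then show ?thesis
      by (rule continuous_at_imp_continuous_at_within)
  qed
qed

lemma continuous_on_S:
  fixes \<tau> :: "'b::topological_space \<Rightarrow> real"
  assumes \<tau>: "continuous_on U \<tau>" "\<And>u. u \<in> U \<Longrightarrow> \<tau> u \<in> {0..T}" and g: "continuous_on U g"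
  shows "continuous_on U (\<lambda>u. S (\<tau> u) (g u))"
  unfolding continuous_on_def
proof
  fix a assume a: "a \<in> U"
  have orb: "continuous_on U (\<lambda>u. S (\<tau> u) (g a))"
    by (rule continuous_on_compose2[OF continuous_on_orbit \<tau>(1)]) (use \<tau>(2) in auto)
  have "((\<lambda>u. M * norm (g u - g a) + norm (S (\<tau> u) (g a) - S (\<tau> a) (g a))) \<longlongrightarrow>
      M * norm (g a - g a) + norm (S (\<tau> a) (g a) - S (\<tau> a) (g a))) (at a within U)"
    using orb g a unfolding continuous_on_def by (intro tendsto_intros) auto
  then have lim: "((\<lambda>u. M * norm (g u - g a) + norm (S (\<tau> u) (g a) - S (\<tau> a) (g a))) \<longlongrightarrow> 0) (at a within U)"
    by simp
  show "((\<lambda>u. S (\<tau> u) (g u)) \<longlongrightarrow> S (\<tau> a) (g a)) (at a within U)"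
  proof (rule LIM_zero_cancel, rule Lim_null_comparison[OF _ lim])
    have "\<forall>\<^sub>F u in at a within U. u \<in> U"
      by (simp add: eventually_at_filter)
    then show "\<forall>\<^sub>F u in at a within U. norm (S (\<tau> u) (g u) - S (\<tau> a) (g a))
        \<le> M * norm (g u - g a) + norm (S (\<tau> u) (g a) - S (\<tau> a) (g a))"
    proof eventually_elim
      case (elim u)
      then have "\<tau> u \<in> {0..T}" by (rule \<tau>(2))
      then have "S (\<tau> u) (g u) - S (\<tau> a) (g a) = S (\<tau> u) (g u - g a) + (S (\<tau> u) (g a) - S (\<tau> a) (g a))"
        by (simp add: S_diff)
      then have "norm (S (\<tau> u) (g u) - S (\<tau> a) (g a))
          \<le> norm (S (\<tau> u) (g u - g a)) + norm (S (\<tau> u) (g a) - S (\<tau> a) (g a))"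
        by (metis norm_triangle_ineq)
      with S_bound[OF \<open>\<tau> u \<in> {0..T}\<close>, of "g u - g a"] show ?case by linarith
    qed
  qed
qed

lemma generator_iff:
  "((\<lambda>h. (S h x - x) /\<^sub>R h) \<longlongrightarrow> y) (at_right 0) \<longleftrightarrow> x \<in> carr E\<^sub>1 \<and> y = A x"
  using gen unfolding generator_def by blast

lemma generator_lim: "x \<in> carr E\<^sub>1 \<Longrightarrow> ((\<lambda>h. (S h x - x) /\<^sub>R h) \<longlongrightarrow> A x) (at_right 0)"
  by (simp add: generator_iff)

lemma A_add:
  assumes "x \<in> carr E\<^sub>1" "y \<in> carr E\<^sub>1"
  shows "A (x + y) = A x + A y"
proof -
  have "((\<lambda>h. (S h x - x) /\<^sub>R h + (S h y - y) /\<^sub>R h) \<longlongrightarrow> A x + A y) (at_right 0)"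
    by (intro tendsto_add generator_lim assms)
  moreover have "\<forall>\<^sub>F h in at_right 0. (S h x - x) /\<^sub>R h + (S h y - y) /\<^sub>R h = (S h (x + y) - (x + y)) /\<^sub>R h"
    using eventually_at_right_less[of "0::real"]
    by eventually_elim (simp add: S_plus algebra_simps)
  ultimately have "((\<lambda>h. (S h (x + y) - (x + y)) /\<^sub>R h) \<longlongrightarrow> A x + A y) (at_right 0)"
    using tendsto_cong by fast
  then show ?thesis by (simp add: generator_iff)
qed

lemma A_scale:
  assumes "x \<in> carr E\<^sub>1"
  shows "A (r *\<^sub>R x) = r *\<^sub>R A x"
proof -
  have "((\<lambda>h. r *\<^sub>R ((S h x - x) /\<^sub>R h)) \<longlongrightarrow> r *\<^sub>R A x) (at_right 0)"
    by (intro tendsto_intros generator_lim assms)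
  moreover have "\<forall>\<^sub>F h in at_right 0. r *\<^sub>R ((S h x - x) /\<^sub>R h) = (S h (r *\<^sub>R x) - r *\<^sub>R x) /\<^sub>R h"
    using eventually_at_right_less[of "0::real"]
    by eventually_elim (simp add: S_scale algebra_simps)
  ultimately have "((\<lambda>h. (S h (r *\<^sub>R x) - r *\<^sub>R x) /\<^sub>R h) \<longlongrightarrow> r *\<^sub>R A x) (at_right 0)"
    using tendsto_cong by fast
  then show ?thesis by (simp add: generator_iff)
qed

lemma A_diff:
  assumes "x \<in> carr E\<^sub>1" "y \<in> carr E\<^sub>1"
  shows "A (x - y) = A x - A y"
  using A_add[OF assms(1) E\<^sub>1.minus_mem[OF assms(2)]] A_scale[OF assms(2), of "-1"] by simp

lemma S_generator:
  assumes "x \<in> carr E\<^sub>1" "0 \<le> t"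
  shows "S t x \<in> carr E\<^sub>1 \<and> A (S t x) = S t (A x)"
proof -
  have "((\<lambda>h. S t ((S h x - x) /\<^sub>R h)) \<longlongrightarrow> S t (A x)) (at_right 0)"
    by (rule bounded_linear.tendsto[OF lin[OF assms(2)] generator_lim[OF assms(1)]])
  moreover have "\<forall>\<^sub>F h in at_right 0. S t ((S h x - x) /\<^sub>R h) = (S h (S t x) - S t x) /\<^sub>R h"
    using eventually_at_right_less[of "0::real"]
  proof eventually_elim
    case (elim h)
    then show ?case
      using assms(2) S_add[of t h x] S_add[of h t x] by (simp add: S_scale S_diff add.commute)
  qed
  ultimately have "((\<lambda>h. (S h (S t x) - S t x) /\<^sub>R h) \<longlongrightarrow> S t (A x)) (at_right 0)"
    using tendsto_cong by fast
  then show ?thesis by (simp add: generator_iff)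
qed

lemma S_smooth:
  assumes t: "t \<in> {0<..T}"
  shows "S t x \<in> carr E\<^sub>1 \<and> ((\<lambda>s. S s x) has_vector_derivative A (S t x)) (at t)
    \<and> norm (A (S t x)) \<le> M / t * norm x"
proof -
  obtain y where y: "((\<lambda>s. S s x) has_vector_derivative y) (at t)" "norm y \<le> M / t * norm x"
    using S_der[OF t] by blast
  have "((\<lambda>s. S s x) has_vector_derivative y) (at_right t)"
    using y(1) by (rule has_vector_derivative_at_within)
  then have "((\<lambda>h. (S (h + t) x - S t x) /\<^sub>R h) \<longlongrightarrow> y) (at_right 0)"
    by (rule right_difference_quotient)
  moreover have "\<forall>\<^sub>F h in at_right 0. (S (h + t) x - S t x) /\<^sub>R h = (S h (S t x) - S t x) /\<^sub>R h"
    using eventually_at_right_less[of "0::real"]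
    by eventually_elim (use t in \<open>simp add: S_add\<close>)
  ultimately have "((\<lambda>h. (S h (S t x) - S t x) /\<^sub>R h) \<longlongrightarrow> y) (at_right 0)"
    using tendsto_cong by fast
  then have "S t x \<in> carr E\<^sub>1" "y = A (S t x)"
    by (simp_all add: generator_iff)
  with y show ?thesis by simp
qed

lemma S_minus_id:
  assumes x: "x \<in> carr E\<^sub>1" and h: "h \<in> {0..T}"
  shows "((\<lambda>s. S s (A x)) has_integral S h x - x) {0..h}"
proof -
  have "((\<lambda>s. S s (A x)) has_integral S h x - S 0 x) {0..h}"
  proof (rule fundamental_theorem_of_calculus_interior)
    show "continuous_on {0..h} (\<lambda>s. S s x)"
      by (rule continuous_on_subset[OF continuous_on_orbit]) (use h in auto)
    fix s assume "s \<in> {0<..<h}"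
    then show "((\<lambda>s. S s x) has_vector_derivative S s (A x)) (at s)"
      using S_smooth[of s x] S_generator[OF x, of s] h by auto
  qed (use h in auto)
  then show ?thesis by (simp add: S_0)
qed

text \<open>
  The identity \<open>e\<^bsup>hA\<^esup> x - x = \<integral>\<^sub>0\<^sup>h e\<^bsup>sA\<^esup> A x ds\<close> passes to the limit along a sequence, with \<open>y\<close> in place
  of \<open>A x\<close>; dividing by \<open>h\<close> shows that \<open>y\<close> is the derivative of the orbit at 0.
\<close>

lemma generator_closed:
  assumes mem: "\<And>n. \<sigma> n \<in> carr E\<^sub>1" and \<sigma>: "\<sigma> \<longlonglongrightarrow> x" and A\<sigma>: "(\<lambda>n. A (\<sigma> n)) \<longlonglongrightarrow> y"
  shows "x \<in> carr E\<^sub>1 \<and> y = A x"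
proof -
  have orb: "continuous_on {0..h} (\<lambda>s. S s z)" if "h \<le> T" for h z
    by (rule continuous_on_subset[OF continuous_on_orbit]) (use that in auto)
  have int: "integral {0..h} (\<lambda>s. S s y) = S h x - x" if h: "0 < h" "h \<le> T" for h
  proof -
    have "(\<lambda>n. h * (M * norm (A (\<sigma> n) - y))) \<longlonglongrightarrow> h * (M * norm (y - y))"
      by (intro tendsto_intros A\<sigma>)
    then have 0: "(\<lambda>n. h * (M * norm (A (\<sigma> n) - y))) \<longlonglongrightarrow> 0" by simp
    have "(\<lambda>n. (S h (\<sigma> n) - \<sigma> n) - integral {0..h} (\<lambda>s. S s y)) \<longlonglongrightarrow> 0"
    proof (rule Lim_null_comparison[OF always_eventually 0], rule allI)
      fix n
      have "(S h (\<sigma> n) - \<sigma> n) - integral {0..h} (\<lambda>s. S s y) = integral {0..h} (\<lambda>s. S s (A (\<sigma> n)) - S s y)"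
        using integral_unique[OF S_minus_id[OF mem, of h n]] orb[OF h(2)] h
        by (subst Henstock_Kurzweil_Integration.integral_diff) (auto intro!: integrable_continuous_real)
      also have "norm \<dots> \<le> (M * norm (A (\<sigma> n) - y)) * (h - 0)"
      proof (rule integral_bound)
        fix s assume "s \<in> {0..h}"
        then show "norm (S s (A (\<sigma> n)) - S s y) \<le> M * norm (A (\<sigma> n) - y)"
          using S_bound[of s "A (\<sigma> n) - y"] h by (simp add: S_diff)
      qed (use h orb in \<open>auto intro!: continuous_intros\<close>)
      finally show "norm (S h (\<sigma> n) - \<sigma> n - integral {0..h} (\<lambda>s. S s y)) \<le> h * (M * norm (A (\<sigma> n) - y))"
        by (simp add: mult.commute)
    qed
    moreover have "(\<lambda>n. (S h (\<sigma> n) - \<sigma> n) - integral {0..h} (\<lambda>s. S s y)) \<longlonglongrightarrow> (S h x - x) - integral {0..h} (\<lambda>s. S s y)"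
      using h by (intro tendsto_intros \<sigma> bounded_linear.tendsto[OF lin]) auto
    ultimately have "(S h x - x) - integral {0..h} (\<lambda>s. S s y) = 0"
      using LIMSEQ_unique by blast
    then show ?thesis by simp
  qed
  have "((\<lambda>h. integral {0..h} (\<lambda>s. S s y)) has_vector_derivative S 0 y) (at 0 within {0..T})"
    by (rule integral_has_vector_derivative[OF continuous_on_orbit]) (use T in auto)
  then have "((\<lambda>h. integral {0..h} (\<lambda>s. S s y) /\<^sub>R h) \<longlongrightarrow> y) (at_right 0)"
    using T right_difference_quotient[of "\<lambda>h. integral {0..h} (\<lambda>s. S s y)" y 0]
    by (simp add: S_0 at_within_Icc_at_right)
  moreover have "\<forall>\<^sub>F h in at_right 0. integral {0..h} (\<lambda>s. S s y) /\<^sub>R h = (S h x - x) /\<^sub>R h"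
    using eventually_at_right_real[OF T] by eventually_elim (simp add: int)
  ultimately have "((\<lambda>h. (S h x - x) /\<^sub>R h) \<longlongrightarrow> y) (at_right 0)"
    using tendsto_cong by fast
  then show ?thesis by (simp add: generator_iff)
qed

text \<open>
  The norm of \<open>E\<^sub>1\<close> is equivalent to the graph norm of \<open>A\<close>, since both are complete and dominate the
  norm of \<open>E\<^sub>0\<close>.
\<close>

lemma graph_norm:
  obtains K where "1 \<le> K" "\<And>x. x \<in> carr E\<^sub>1 \<Longrightarrow> nrm E\<^sub>1 x \<le> K * (norm x + norm (A x))"
    "\<And>x. x \<in> carr E\<^sub>1 \<Longrightarrow> norm x + norm (A x) \<le> K * nrm E\<^sub>1 x"
proof -
  let ?G = "\<lparr>carr = carr E\<^sub>1, nrm = (\<lambda>x. norm x + norm (A x))\<rparr>"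
  have A0: "A 0 = 0" using A_scale[OF E\<^sub>1.zero_mem, of 0] by simp
  interpret G: normed_subspace ?G
  proof (unfold_locales, simp_all add: E\<^sub>1.add_mem E\<^sub>1.scale_mem A_scale algebra_simps)
    fix x y assume "x \<in> carr E\<^sub>1" "y \<in> carr E\<^sub>1"
    then show "norm (x + y) + norm (A (x + y)) \<le> norm x + (norm y + (norm (A x) + norm (A y)))"
      using norm_triangle_ineq[of x y] norm_triangle_ineq[of "A x" "A y"] by (simp add: A_add)
  next
    fix x
    show "(norm x + norm (A x) = 0) = (x = 0)"
      using A0 norm_ge_zero[of "A x"] norm_ge_zero[of x] by (auto simp: add_nonneg_eq_0_iff)
  qed
  have G: "banach_subspace ?G"
  proof (rule G.banach_subspaceI)
    fix \<sigma> :: "nat \<Rightarrow> 'a"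
    assume mem: "\<And>n. \<sigma> n \<in> carr ?G"
      and c: "\<And>e. 0 < e \<Longrightarrow> \<exists>N. \<forall>m\<ge>N. \<forall>n\<ge>N. nrm ?G (\<sigma> m - \<sigma> n) < e"
    have c': "\<exists>N. \<forall>m\<ge>N. \<forall>n\<ge>N. norm (\<sigma> m - \<sigma> n) + norm (A (\<sigma> m) - A (\<sigma> n)) < e" if "0 < e" for e
      using c[OF that] mem by (simp add: A_diff)
    have "Cauchy \<sigma>"
      unfolding Cauchy_iff
    proof (intro allI impI)
      fix e :: real assume "0 < e"
      from c'[OF this] obtain N where "\<forall>m\<ge>N. \<forall>n\<ge>N. norm (\<sigma> m - \<sigma> n) + norm (A (\<sigma> m) - A (\<sigma> n)) < e" ..
      then show "\<exists>N. \<forall>m\<ge>N. \<forall>n\<ge>N. norm (\<sigma> m - \<sigma> n) < e"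
        by (intro exI[of _ N]) (smt (verit) norm_ge_zero)
    qed
    moreover have "Cauchy (\<lambda>n. A (\<sigma> n))"
      unfolding Cauchy_iff
    proof (intro allI impI)
      fix e :: real assume "0 < e"
      from c'[OF this] obtain N where "\<forall>m\<ge>N. \<forall>n\<ge>N. norm (\<sigma> m - \<sigma> n) + norm (A (\<sigma> m) - A (\<sigma> n)) < e" ..
      then show "\<exists>N. \<forall>m\<ge>N. \<forall>n\<ge>N. norm (A (\<sigma> m) - A (\<sigma> n)) < e"
        by (intro exI[of _ N]) (smt (verit) norm_ge_zero)
    qed
    ultimately obtain x y where x: "\<sigma> \<longlonglongrightarrow> x" and y: "(\<lambda>n. A (\<sigma> n)) \<longlonglongrightarrow> y"
      using Cauchy_convergent_iff convergent_def by metis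
    have xA: "x \<in> carr E\<^sub>1" "y = A x"
      using generator_closed[OF _ x y] mem by auto
    have "(\<lambda>n. norm (\<sigma> n - x) + norm (A (\<sigma> n) - y)) \<longlonglongrightarrow> norm (x - x) + norm (y - y)"
      by (intro tendsto_intros x y)
    then have "(\<lambda>n. nrm ?G (\<sigma> n - x)) \<longlonglongrightarrow> 0"
      using mem xA by (simp add: A_diff)
    then show "\<exists>x\<in>carr ?G. (\<lambda>n. nrm ?G (\<sigma> n - x)) \<longlonglongrightarrow> 0"
      using xA by auto
  qed
  obtain c where c: "\<And>x. x \<in> carr E\<^sub>1 \<Longrightarrow> norm x \<le> c * nrm E\<^sub>1 x"
    using emb by blast
  have lim1: "\<sigma> \<longlonglongrightarrow> x" if "\<And>n. \<sigma> n \<in> carr E\<^sub>1" "x \<in> carr E\<^sub>1" "(\<lambda>n. nrm E\<^sub>1 (\<sigma> n - x)) \<longlonglongrightarrow> 0" for \<sigma> x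
    using that c E\<^sub>1.diff_mem
    by (intro LIM_zero_cancel[OF Lim_null_comparison[OF always_eventually tendsto_mult_right_zero[OF that(3), of c]]]) auto
  have limG: "\<sigma> \<longlonglongrightarrow> x" if "(\<lambda>n. nrm ?G (\<sigma> n - x)) \<longlonglongrightarrow> 0" for \<sigma> x
    by (intro LIM_zero_cancel[OF Lim_null_comparison[OF always_eventually that]]) auto
  obtain K1 where K1: "0 \<le> K1" "\<And>x. x \<in> carr E\<^sub>1 \<Longrightarrow> norm x + norm (A x) \<le> K1 * nrm E\<^sub>1 x"
  proof (rule comparable_norms[OF E\<^sub>1 G])
    fix \<sigma> x y
    assume *: "\<And>n. \<sigma> n \<in> carr E\<^sub>1" "x \<in> carr E\<^sub>1" "(\<lambda>n. nrm E\<^sub>1 (\<sigma> n - x)) \<longlonglongrightarrow> 0"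
      "(\<lambda>n. nrm ?G (\<sigma> n - y)) \<longlonglongrightarrow> 0"
    show "x = y" by (rule LIMSEQ_unique[OF lim1[OF *(1-3)] limG[OF *(4)]])
  qed (use that in auto)
  obtain K2 where K2: "0 \<le> K2" "\<And>x. x \<in> carr E\<^sub>1 \<Longrightarrow> nrm E\<^sub>1 x \<le> K2 * (norm x + norm (A x))"
  proof (rule comparable_norms[OF G E\<^sub>1])
    fix \<sigma> x y
    assume *: "\<And>n. \<sigma> n \<in> carr ?G" "y \<in> carr E\<^sub>1" "(\<lambda>n. nrm E\<^sub>1 (\<sigma> n - y)) \<longlonglongrightarrow> 0"
      "(\<lambda>n. nrm ?G (\<sigma> n - x)) \<longlonglongrightarrow> 0"
    show "x = y"
      using *(1) by (intro LIMSEQ_unique[OF limG[OF *(4)] lim1[OF _ *(2,3)]]) simp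
  qed (use that in auto)
  show ?thesis
  proof (rule that[of "max 1 (max K1 K2)"])
    fix x assume x: "x \<in> carr E\<^sub>1"
    have "K1 * nrm E\<^sub>1 x \<le> max 1 (max K1 K2) * nrm E\<^sub>1 x"
      by (intro mult_right_mono E\<^sub>1.nrm_ge0 x) auto
    then show "norm x + norm (A x) \<le> max 1 (max K1 K2) * nrm E\<^sub>1 x"
      using K1(2)[OF x] by linarith
    have "K2 * (norm x + norm (A x)) \<le> max 1 (max K1 K2) * (norm x + norm (A x))"
      by (intro mult_right_mono) auto
    then show "nrm E\<^sub>1 x \<le> max 1 (max K1 K2) * (norm x + norm (A x))"
      using K2(2)[OF x] by linarith
  qed simp
qed

lemma smoothing_E1:
  obtains K where "1 \<le> K" "\<And>t x. t \<in> {0<..T} \<Longrightarrow> nrm E\<^sub>1 (S t x) \<le> K / t * norm x"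
    "\<And>t x. t \<in> {0..T} \<Longrightarrow> x \<in> carr E\<^sub>1 \<Longrightarrow> nrm E\<^sub>1 (S t x) \<le> K * nrm E\<^sub>1 x"
proof -
  obtain K where K: "1 \<le> K" "\<And>x. x \<in> carr E\<^sub>1 \<Longrightarrow> nrm E\<^sub>1 x \<le> K * (norm x + norm (A x))"
    "\<And>x. x \<in> carr E\<^sub>1 \<Longrightarrow> norm x + norm (A x) \<le> K * nrm E\<^sub>1 x"
    using graph_norm by metis
  define K' where "K' = max (K * M * (T + 1)) (K * M * K)"
  have "1 * 1 * 1 \<le> K * M * K" using K M by (intro mult_mono) auto
  then have K': "1 \<le> K'" by (simp add: K'_def)
  show ?thesis
  proof (rule that[OF K'])
    fix t and x :: 'a assume t: "t \<in> {0<..T}"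
    have "M * norm x \<le> M * T / t * norm x"
      using t M by (intro mult_right_mono) (auto simp: field_simps)
    then have "norm (S t x) + norm (A (S t x)) \<le> M * T / t * norm x + M / t * norm x"
      using S_bound[of t x] S_smooth[OF t, of x] t by auto
    also have "\<dots> = M * (T + 1) / t * norm x"
      using t by (simp add: field_simps)
    finally have "K * (norm (S t x) + norm (A (S t x))) \<le> K * (M * (T + 1) / t * norm x)"
      using K by (intro mult_left_mono) auto
    also have "\<dots> \<le> K' / t * norm x"
    proof -
      have "K * M * (T + 1) / t * norm x \<le> K' / t * norm x"
        using t by (intro mult_right_mono divide_right_mono) (auto simp: K'_def)
      then show ?thesis by (simp add: mult.assoc)
    qed
    finally show "nrm E\<^sub>1 (S t x) \<le> K' / t * norm x"
      using K(2)[of "S t x"] S_smooth[OF t, of x] by linarith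
  next
    fix t x assume t: "t \<in> {0..T}" and x: "x \<in> carr E\<^sub>1"
    have Sx: "S t x \<in> carr E\<^sub>1" "A (S t x) = S t (A x)"
      using S_generator[OF x, of t] t by auto
    have "nrm E\<^sub>1 (S t x) \<le> K * (norm (S t x) + norm (A (S t x)))"
      by (rule K(2)[OF Sx(1)])
    also have "\<dots> \<le> K * (M * (norm x + norm (A x)))"
      using S_bound[OF t, of x] S_bound[OF t, of "A x"] K Sx by (intro mult_left_mono) (auto simp: algebra_simps)
    also have "\<dots> \<le> K * (M * (K * nrm E\<^sub>1 x))"
      using K M K(3)[OF x] by (intro mult_left_mono) auto
    also have "\<dots> \<le> K' * nrm E\<^sub>1 x"
    proof -
      have "K * M * K * nrm E\<^sub>1 x \<le> K' * nrm E\<^sub>1 x"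
        by (intro mult_right_mono E\<^sub>1.nrm_ge0 x) (auto simp: K'_def)
      then show ?thesis by (simp add: mult.assoc)
    qed
    finally show "nrm E\<^sub>1 (S t x) \<le> K' * nrm E\<^sub>1 x" .
  qed
qed

lemma A_bounded:
  obtains K where "\<And>x. x \<in> carr E\<^sub>1 \<Longrightarrow> norm (A x) \<le> K * nrm E\<^sub>1 x"
  using graph_norm by (smt (verit) norm_ge_zero)

end

section \<open>The variation of constants formula\<close>

text \<open>\<open>w\<close> is the mild solution of \<open>w' = A w + g\<close>, \<open>w(0) = 0\<close>, for a forcing term that is singular at 0.\<close>

locale forced_semigroup = smoothing_semigroup S A E\<^sub>1 T M
  for S :: "real \<Rightarrow> 'a::banach \<Rightarrow> 'a" and A E\<^sub>1 T M +
  fixes g :: "real \<Rightarrow> 'a" and \<nu> G :: real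
  assumes \<nu>: "\<nu> < 1" and G: "0 \<le> G"
    and g_cont: "continuous_on {0<..T} g"
    and g_bound: "s \<in> {0<..T} \<Longrightarrow> norm (g s) \<le> G * s powr - \<nu>"
begin

definition w :: "real \<Rightarrow> 'a" where
  "w t = integral {0..t} (\<lambda>s. S (t - s) (g s))"

lemma integrand_cont: "t \<le> T \<Longrightarrow> continuous_on {0<..t} (\<lambda>s. S (t - s) (g s))"
  by (intro continuous_on_S continuous_intros continuous_on_subset[OF g_cont]) auto

lemma integrand_bound:
  assumes "s \<in> {0<..t}" "t \<le> T"
  shows "norm (S (t - s) (g s)) \<le> M * G * s powr - \<nu>"
proof -
  have "norm (S (t - s) (g s)) \<le> M * norm (g s)"
    using assms by (intro S_bound) auto
  also have "\<dots> \<le> M * (G * s powr - \<nu>)"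
    using assms M by (intro mult_left_mono g_bound) auto
  finally show ?thesis by (simp add: mult.assoc)
qed

lemma integrable:
  assumes "0 \<le> a" "b \<le> t" "t \<le> T"
  shows "(\<lambda>s. S (t - s) (g s)) integrable_on {a..b}"
proof (rule integrable_on_subinterval)
  show "(\<lambda>s. S (t - s) (g s)) integrable_on {0..t}"
    by (rule integrable_weakly_singular[OF integrand_cont \<nu> integrand_bound]) (use assms in auto)
qed (use assms in auto)

definition c\<^sub>0 :: real where "c\<^sub>0 = M * G / (1 - \<nu>)"

lemma c0_nonneg: "0 \<le> c\<^sub>0"
  using M G \<nu> by (simp add: c\<^sub>0_def)

lemma norm_tail_le:
  assumes "0 \<le> a" "a \<le> t" "t \<le> T"
  shows "norm (integral {a..t} (\<lambda>s. S (t - s) (g s))) \<le> c\<^sub>0 * (t powr (1 - \<nu>) - a powr (1 - \<nu>))"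
proof -
  have 1: "((\<lambda>s. M * G * s powr - \<nu>) has_integral M * G * ((t powr (1 - \<nu>) - a powr (1 - \<nu>)) / (1 - \<nu>))) {a..t}"
    by (intro has_integral_mult_right has_integral_powr_neg \<nu> assms)
  have "norm (integral {a..t} (\<lambda>s. S (t - s) (g s))) \<le> M * G * ((t powr (1 - \<nu>) - a powr (1 - \<nu>)) / (1 - \<nu>))"
  proof (rule seminorm_integral_le[where C = 1, OF _ _ _ integrable_integral 1])
    show "(\<lambda>s. S (t - s) (g s)) integrable_on {a..t}"
      by (rule integrable) (use assms in auto)
    show "norm (S (t - s) (g s)) \<le> M * G * s powr - \<nu>" if "s \<in> {a<..<t}" for s
      using that assms by (intro integrand_bound) auto
  qed (auto intro: norm_triangle_ineq)
  then show ?thesis by (simp add: c\<^sub>0_def)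
qed



lemma norm_w_le: "t \<in> {0..T} \<Longrightarrow> norm (w t) \<le> c\<^sub>0 * t powr (1 - \<nu>)"
  using norm_tail_le[of 0 t] by (simp add: w_def)

lemma S_integral:
  assumes "0 \<le> a" "a \<le> b" "b \<le> t" "t \<le> T"
  shows "S (t - b) (integral {a..b} (\<lambda>s. S (b - s) (g s))) = integral {a..b} (\<lambda>s. S (t - s) (g s))"
proof -
  have "S (t - b) (integral {a..b} (\<lambda>s. S (b - s) (g s))) = integral {a..b} (S (t - b) \<circ> (\<lambda>s. S (b - s) (g s)))"
    using assms by (intro integral_linear[symmetric] lin integrable) auto
  also have "\<dots> = integral {a..b} (\<lambda>s. S (t - s) (g s))"
  proof (rule integral_cong)
    fix s assume "s \<in> {a..b}"
    then show "(S (t - b) \<circ> (\<lambda>s. S (b - s) (g s))) s = S (t - s) (g s)"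
      using S_add[of "t - b" "b - s" "g s"] assms by simp
  qed
  finally show ?thesis .
qed

lemma w_split:
  assumes "0 \<le> a" "a \<le> t" "t \<le> T"
  shows "w t = S (t - a) (w a) + integral {a..t} (\<lambda>s. S (t - s) (g s))"
proof -
  have "w t = integral {0..a} (\<lambda>s. S (t - s) (g s)) + integral {a..t} (\<lambda>s. S (t - s) (g s))"
    unfolding w_def using assms
    by (intro Henstock_Kurzweil_Integration.integral_combine[symmetric] integrable) auto
  then show ?thesis
    using S_integral[of 0 a t] assms by (simp add: w_def)
qed

text \<open>Near \<open>t\<close> the function \<open>w\<close> is uniformly close to the orbit of \<open>w(a)\<close> for \<open>a\<close> slightly smaller than \<open>t\<close>.\<close>

lemma w_continuous: "continuous_on {0..T} w"
proof -
  interpret W: banach_subspace "whole_space :: 'a nspace" by (rule banach_subspace_whole)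
  have "continuous_map (top_of_set {0..T}) (ntop whole_space) w"
  proof (rule W.continuous_map_ntop_approx)
    fix t e :: real assume t: "t \<in> {0..T}" and e: "0 < e"
    define h where "h s = c\<^sub>0 * s powr (1 - \<nu>)" for s
    have "continuous_on {0..T} h"
      unfolding h_def using \<nu> by (intro continuous_on_mult_left continuous_on_powr' continuous_intros) auto
    then obtain \<delta> where \<delta>: "0 < \<delta>" "\<And>s. s \<in> {0..T} \<Longrightarrow> dist s t < \<delta> \<Longrightarrow> dist (h s) (h t) < e / 2"
      using t half_gt_zero[OF e] unfolding continuous_on_iff by meson
    define a where "a = max 0 (t - \<delta> / 2)"
    have a: "a \<in> {0..T}" "dist a t < \<delta>" using t \<delta>(1) by (auto simp: a_def dist_real_def)
    define d where "d = (if t = 0 then \<delta> / 2 else t - a)"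
    have d: "0 < d" "d \<le> \<delta>" using t \<delta>(1) by (auto simp: d_def a_def)
    let ?v = "\<lambda>s. S (max 0 (s - a)) (w a)"
    show "\<exists>d>0. \<exists>v. (\<forall>s\<in>{0..T}. dist s t < d \<longrightarrow> v s \<in> carr whole_space \<and> nrm whole_space (w s - v s) \<le> e) \<and>
        ((\<lambda>s. nrm whole_space (v s - v t)) \<longlongrightarrow> 0) (at t within {0..T})"
    proof (intro exI[of _ d] exI[of _ ?v] conjI ballI impI d)
      fix s assume s: "s \<in> {0..T}" "dist s t < d"
      then have as: "a \<le> s"
        using t by (auto simp: d_def dist_real_def a_def split: if_splits)
      have "w s - ?v s = integral {a..s} (\<lambda>r. S (s - r) (g r))"
        using w_split[of a s] a s as by simp
      then have "norm (w s - ?v s) \<le> h s - h a"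
        using norm_tail_le[of a s] a s as by (simp add: h_def right_diff_distrib)
      also have "\<dots> \<le> e"
      proof -
        have "dist (h s) (h t) < e / 2" "dist (h a) (h t) < e / 2"
          using \<delta>(2)[of s] \<delta>(2)[of a] a s d by auto
        then show ?thesis unfolding dist_real_def by linarith
      qed
      finally show "nrm whole_space (w s - ?v s) \<le> e" by simp
    next
      have "continuous_on {0..T} ?v"
        by (intro continuous_on_S continuous_intros) (use a in auto)
      then have "(?v \<longlongrightarrow> ?v t) (at t within {0..T})"
        using t unfolding continuous_on_def by blast
      then show "((\<lambda>s. nrm whole_space (?v s - ?v t)) \<longlongrightarrow> 0) (at t within {0..T})"
        by (simp add: tendsto_norm_zero_iff LIM_zero_iff)
    qed simp
  qed simp
  then show ?thesis
    unfolding W.continuous_map_ntop continuous_on_def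
    by (simp add: tendsto_norm_zero_iff LIM_zero_iff)
qed

end

text \<open>\<open>Y\<close> stands for \<open>E\<^sub>\<theta>\<close> or \<open>E\<^sub>1\<close>.\<close>

locale smoothing_target = smoothing_semigroup S A E\<^sub>1 T M
  for S :: "real \<Rightarrow> 'a::banach \<Rightarrow> 'a" and A E\<^sub>1 T M +
  fixes Y :: "'a nspace"
  assumes Y: "banach_subspace Y"
    and Y_emb: "\<exists>c. \<forall>x\<in>carr Y. norm x \<le> c * nrm Y x"
    and Y_smooth: "r \<in> {0<..T} \<Longrightarrow> \<exists>C. \<forall>x. S r x \<in> carr Y \<and> nrm Y (S r x) \<le> C * norm x"
begin

sublocale Y: banach_subspace Y
  by (rule Y)

lemma S_mem_Y: "r \<in> {0<..T} \<Longrightarrow> S r x \<in> carr Y"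
  using Y_smooth by blast

lemma tendsto_Y_imp_tendsto:
  assumes "\<And>n. \<sigma> n \<in> carr Y" "y \<in> carr Y" "(\<lambda>n. nrm Y (\<sigma> n - y)) \<longlonglongrightarrow> 0"
  shows "\<sigma> \<longlonglongrightarrow> y"
proof -
  obtain c where c: "\<And>x. x \<in> carr Y \<Longrightarrow> norm x \<le> c * nrm Y x"
    using Y_emb by blast
  have "(\<lambda>n. \<sigma> n - y) \<longlonglongrightarrow> 0"
    by (rule Lim_null_comparison[OF always_eventually tendsto_mult_right_zero[OF assms(3), of c]])
      (use c assms Y.diff_mem in auto)
  then show ?thesis by (rule LIM_zero_cancel)
qed

lemma tendsto_S_Y:
  assumes r: "r \<in> {0<..T}" and f: "(f \<longlongrightarrow> x) F"
  shows "((\<lambda>s. nrm Y (S r (f s) - S r x)) \<longlongrightarrow> 0) F"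
proof -
  obtain C where C: "\<And>x. S r x \<in> carr Y \<and> nrm Y (S r x) \<le> C * norm x"
    using Y_smooth[OF r] by blast
  have "((\<lambda>s. C * norm (f s - x)) \<longlongrightarrow> C * norm (x - x)) F"
    by (intro tendsto_intros f)
  then have lim: "((\<lambda>s. C * norm (f s - x)) \<longlongrightarrow> 0) F" by simp
  show ?thesis
  proof (rule Lim_null_comparison[OF always_eventually lim], rule allI)
    fix s
    have "S r (f s) - S r x = S r (f s - x)"
      using r by (simp add: S_diff)
    then show "norm (nrm Y (S r (f s) - S r x)) \<le> C * norm (f s - x)"
      using C[of "f s - x"] Y.nrm_ge0[of "S r (f s - x)"] by simp
  qed
qed

lemma orbit_continuous_Y: "continuous_map (top_of_set {0<..T}) (ntop Y) (\<lambda>t. S t x)"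
  unfolding Y.continuous_map_ntop
proof (intro ballI conjI S_mem_Y)
  fix t assume t: "t \<in> {0<..T}"
  define r where "r = t / 2"
  have r: "r \<in> {0<..T}" "0 < r" "r < t" using t by (auto simp: r_def)
  have "continuous_on {0<..T} (\<lambda>s. S (max 0 (s - r)) x)"
    by (intro continuous_on_S continuous_intros) (use r in auto)
  then have "((\<lambda>s. S (max 0 (s - r)) x) \<longlongrightarrow> S (max 0 (t - r)) x) (at t within {0<..T})"
    using t unfolding continuous_on_def by blast
  from tendsto_S_Y[OF r(1) this]
  have lim: "((\<lambda>s. nrm Y (S r (S (max 0 (s - r)) x) - S r (S (max 0 (t - r)) x))) \<longlongrightarrow> 0) (at t within {0<..T})" .
  have eq: "S r (S (max 0 (s - r)) x) = S s x" if "r < s" for s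
    using S_add[of r "s - r" x] r that by simp
  have "\<forall>\<^sub>F s in at t within {0<..T}. r < s"
    using order_tendstoD(1)[OF tendsto_ident_at r(3)] .
  then have "\<forall>\<^sub>F s in at t within {0<..T}. nrm Y (S r (S (max 0 (s - r)) x) - S r (S (max 0 (t - r)) x)) = nrm Y (S s x - S t x)"
    by eventually_elim (use eq r in auto)
  from tendsto_cong[OF this] lim
  show "((\<lambda>s. nrm Y (S s x - S t x)) \<longlongrightarrow> 0) (at t within {0<..T})" by blast
qed

end

locale forced_target = forced_semigroup S A E\<^sub>1 T M g \<nu> G + smoothing_target S A E\<^sub>1 T M Y
  for S :: "real \<Rightarrow> 'a::banach \<Rightarrow> 'a" and A E\<^sub>1 T M g \<nu> G Y +
  fixes \<alpha> K :: real
  assumes \<alpha>: "\<alpha> < 1" and K: "0 \<le> K"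
    and kernel: "r \<in> {0<..T} \<Longrightarrow> s \<in> {0<..T} \<Longrightarrow> nrm Y (S r (g s)) \<le> K * (r powr - \<alpha> * s powr - \<nu>)"
begin

abbreviation k :: "real \<Rightarrow> real \<Rightarrow> real" where
  "k t s \<equiv> (t - s) powr - \<alpha> * s powr - \<nu>"

lemma kernel_integrable: "0 \<le> a \<Longrightarrow> b \<le> t \<Longrightarrow> 0 < t \<Longrightarrow> k t integrable_on {a..b}"
  by (rule integrable_on_subinterval[OF has_integral_integrable[OF has_integral_beta_kernel[OF \<alpha> \<nu>]]]) auto

text \<open>
  Stopping at \<open>b < t\<close> lets the factor \<open>e\<^bsup>(t-b)A\<^esup>\<close> be pulled out of the integral; it maps \<open>E\<^sub>0\<close> to \<open>Y\<close>
  continuously.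
\<close>

lemma truncated_integral_Y:
  assumes ab: "0 \<le> a" "a \<le> b" "b < t" "t \<le> T"
  shows "integral {a..b} (\<lambda>s. S (t - s) (g s)) \<in> carr Y \<and>
    nrm Y (integral {a..b} (\<lambda>s. S (t - s) (g s))) \<le> K * integral {a..b} (k t)"
proof -
  define r where "r = t - b"
  have r: "r \<in> {0<..T}" using ab by (simp add: r_def)
  obtain C where C: "\<And>x. S r x \<in> carr Y \<and> nrm Y (S r x) \<le> C * norm x"
    using Y_smooth[OF r] by blast
  let ?I = "integral {a..b} (\<lambda>s. S (b - s) (g s))"
  have "nrm Y (S r ?I) \<le> integral {a..b} (\<lambda>s. K * k t s)"
  proof (rule seminorm_integral_le[where q = "\<lambda>x. nrm Y (S r x)" and C = C, OF _ _ _ integrable_integral integrable_integral])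
    show "nrm Y (S r (x + y)) \<le> nrm Y (S r x) + nrm Y (S r y)" for x y
      using r C Y.nrm_add[of "S r x" "S r y"] by (simp add: S_plus)
    show "nrm Y (S r (c *\<^sub>R x)) = \<bar>c\<bar> * nrm Y (S r x)" for c x
      using r C by (simp add: S_scale Y.nrm_scale)
    show "nrm Y (S r x) \<le> C * norm x" for x using C by blast
    show "(\<lambda>s. S (b - s) (g s)) integrable_on {a..b}"
      by (rule integrable) (use ab in auto)
    show "(\<lambda>s. K * k t s) integrable_on {a..b}"
      by (intro integrable_on_mult_right kernel_integrable) (use ab in auto)
    fix s assume s: "s \<in> {a<..<b}"
    have "S r (S (b - s) (g s)) = S (t - s) (g s)"
      using S_add[of r "b - s" "g s"] s r by (simp add: r_def)
    then show "nrm Y (S r (S (b - s) (g s))) \<le> K * k t s"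
      using kernel[of "t - s" s] s ab by simp
  qed
  then show ?thesis
    using S_integral[of a b t] C[of ?I] ab by (simp add: r_def)
qed

text \<open>
  As \<open>b \<rightarrow> t\<close> the truncated integrals form a Cauchy sequence in \<open>Y\<close>, since the kernel is integrable.  The
  limit in \<open>Y\<close> is the integral because \<open>Y\<close> is continuously embedded in \<open>E\<^sub>0\<close>.
\<close>

lemma tail_integral_Y:
  assumes at: "0 \<le> a" "a < t" "t \<le> T"
  shows "integral {a..t} (\<lambda>s. S (t - s) (g s)) \<in> carr Y \<and>
    nrm Y (integral {a..t} (\<lambda>s. S (t - s) (g s))) \<le> K * integral {a..t} (k t)"
proof -
  define J where "J b = integral {a..b} (\<lambda>s. S (t - s) (g s))" for b
  define \<Phi> where "\<Phi> b = integral {a..b} (k t)" for b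
  define b where "b n = t - (t - a) / real (Suc n)" for n
  have b: "a \<le> b n" "b n < t" for n
  proof -
    have "(t - a) / real (Suc n) \<le> (t - a) / 1"
      by (rule divide_left_mono) (use at in simp_all)
    then have 1: "(t - a) / real (Suc n) \<le> t - a"
      by (simp only: div_by_1)
    have "0 < t - a" using at by simp
    then have 2: "0 < (t - a) / real (Suc n)"
      by (rule divide_pos_pos) simp
    show "a \<le> b n" "b n < t"
      unfolding b_def using 1 2 by linarith+
  qed
  have b_le: "b n \<le> b m" if "n \<le> m" for n m
  proof -
    have "(t - a) / real (Suc m) \<le> (t - a) / real (Suc n)"
      using at that by (intro divide_left_mono[of "real (Suc n)" "real (Suc m)" "t - a"]) auto
    then show ?thesis by (simp add: b_def)
  qed
  have "(\<lambda>n. t - (t - a) * inverse (real (Suc n))) \<longlonglongrightarrow> t - (t - a) * 0"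
    by (intro tendsto_intros LIMSEQ_inverse_real_of_nat)
  then have b_lim: "b \<longlonglongrightarrow> t" by (simp add: b_def[abs_def] divide_inverse)
  have along: "(\<lambda>n. f (b n)) \<longlonglongrightarrow> f t" if "continuous_on {a..t} f" for f :: "real \<Rightarrow> 'b::topological_space"
  proof (rule continuous_on_tendsto_compose[OF that b_lim])
    show "\<forall>\<^sub>F n in sequentially. b n \<in> {a..t}"
      using b less_imp_le by (intro always_eventually) auto
  qed (use at in simp)
  have J_lim: "(\<lambda>n. J (b n)) \<longlonglongrightarrow> J t"
    unfolding J_def using at by (intro along indefinite_integral_continuous_1 integrable) auto
  have \<Phi>_lim: "(\<lambda>n. \<Phi> (b n)) \<longlonglongrightarrow> \<Phi> t"
    unfolding \<Phi>_def using at by (intro along indefinite_integral_continuous_1 kernel_integrable) auto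
  have J_mem: "J (b n) \<in> carr Y" and J_le: "nrm Y (J (b n)) \<le> K * \<Phi> (b n)" for n
    unfolding J_def \<Phi>_def using truncated_integral_Y[of a "b n" t] at b[of n] by auto
  have J_diff: "nrm Y (J (b m) - J (b n)) \<le> K * (\<Phi> (b m) - \<Phi> (b n))" if nm: "n \<le> m" for m n
  proof -
    have 1: "J (b n) + integral {b n..b m} (\<lambda>s. S (t - s) (g s)) = J (b m)"
      unfolding J_def using at b[of n] b[of m] b_le[OF nm]
      by (intro Henstock_Kurzweil_Integration.integral_combine integrable) auto
    have 2: "\<Phi> (b n) + integral {b n..b m} (k t) = \<Phi> (b m)"
      unfolding \<Phi>_def using at b[of n] b[of m] b_le[OF nm]
      by (intro Henstock_Kurzweil_Integration.integral_combine kernel_integrable) auto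
    have "J (b m) - J (b n) = integral {b n..b m} (\<lambda>s. S (t - s) (g s))"
      "\<Phi> (b m) - \<Phi> (b n) = integral {b n..b m} (k t)"
      unfolding 1[symmetric] 2[symmetric] by simp_all
    then show ?thesis
      using truncated_integral_Y[of "b n" "b m" t] at b[of n] b[of m] b_le[OF nm] by auto
  qed
  have cau: "\<exists>N. \<forall>m\<ge>N. \<forall>n\<ge>N. nrm Y (J (b m) - J (b n)) < e" if e: "0 < e" for e
  proof -
    have "Cauchy (\<lambda>n. K * \<Phi> (b n))"
      by (rule LIMSEQ_imp_Cauchy[OF tendsto_mult_left[OF \<Phi>_lim]])
    then obtain N where N: "\<And>m n. m \<ge> N \<Longrightarrow> n \<ge> N \<Longrightarrow> norm (K * \<Phi> (b m) - K * \<Phi> (b n)) < e"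
      using e unfolding Cauchy_iff by blast
    have *: "nrm Y (J (b m) - J (b n)) < e" if mn: "N \<le> n" "n \<le> m" for m n
    proof -
      have "nrm Y (J (b m) - J (b n)) \<le> K * \<Phi> (b m) - K * \<Phi> (b n)"
        using J_diff[OF mn(2)] by (simp add: right_diff_distrib)
      also have "\<dots> < e"
        using N[of m n] mn by (simp add: abs_less_iff)
      finally show ?thesis .
    qed
    have "nrm Y (J (b m) - J (b n)) < e" if "N \<le> m" "N \<le> n" for m n
      using *[of m n] *[of n m] that Y.nrm_commute[OF J_mem[of m] J_mem[of n]] by (cases "n \<le> m") auto
    then show ?thesis by blast
  qed
  obtain y where y: "y \<in> carr Y" "(\<lambda>n. nrm Y (J (b n) - y)) \<longlonglongrightarrow> 0"
    using Y.Cauchy_convergent[OF J_mem cau] .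
  have "(\<lambda>n. J (b n)) \<longlonglongrightarrow> y"
    by (rule tendsto_Y_imp_tendsto[OF J_mem y])
  then have yJ: "y = J t" using J_lim LIMSEQ_unique by blast
  have "nrm Y (J t) \<le> K * \<Phi> t + 0"
  proof (rule tendsto_lowerbound)
    show "(\<lambda>n. K * \<Phi> (b n) + nrm Y (J (b n) - y)) \<longlonglongrightarrow> K * \<Phi> t + 0"
      by (intro tendsto_intros \<Phi>_lim y)
    have "nrm Y (J t) \<le> K * \<Phi> (b n) + nrm Y (J (b n) - y)" for n
      using Y.nrm_le_add_diff[of y "J (b n)"] Y.nrm_commute[of y "J (b n)"] J_mem[of n] J_le[of n] y yJ by simp
    then show "\<forall>\<^sub>F n in sequentially. nrm Y (J t) \<le> K * \<Phi> (b n) + nrm Y (J (b n) - y)"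
      by simp
  qed simp
  then show ?thesis using y yJ by (simp add: J_def \<Phi>_def)
qed

lemma w_mem_Y: "t \<in> {0<..T} \<Longrightarrow> w t \<in> carr Y"
  using tail_integral_Y[of 0 t] by (simp add: w_def)

lemma nrm_w_le:
  assumes t: "t \<in> {0<..T}"
  shows "nrm Y (w t) \<le> K * Beta (1 - \<nu>) (1 - \<alpha>) * t powr (1 - \<alpha> - \<nu>)"
proof -
  have "integral {0..t} (k t) = t powr (1 - \<alpha> - \<nu>) * Beta (1 - \<nu>) (1 - \<alpha>)"
    using t by (intro integral_unique has_integral_beta_kernel \<alpha> \<nu>) auto
  then show ?thesis
    using tail_integral_Y[of 0 t] t by (simp add: w_def mult_ac)
qed

lemma tail_le:
  assumes "0 < \<tau>" "\<tau> \<le> a" "a < t" "t \<le> T" "0 \<le> \<nu>"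
  shows "nrm Y (integral {a..t} (\<lambda>s. S (t - s) (g s))) \<le> K * (\<tau> powr - \<nu> * ((t - a) powr (1 - \<alpha>) / (1 - \<alpha>)))"
proof -
  have 1: "((\<lambda>s. \<tau> powr - \<nu> * (t - s) powr - \<alpha>) has_integral \<tau> powr - \<nu> * ((t - a) powr (1 - \<alpha>) / (1 - \<alpha>))) {a..t}"
    using assms by (intro has_integral_mult_right has_integral_powr_neg_reflected \<alpha>) auto
  have "integral {a..t} (k t) \<le> \<tau> powr - \<nu> * ((t - a) powr (1 - \<alpha>) / (1 - \<alpha>))"
  proof (rule has_integral_le[OF integrable_integral 1])
    show "k t integrable_on {a..t}"
      by (rule kernel_integrable) (use assms in auto)
    fix s assume "s \<in> {a..t}"
    then have "s powr - \<nu> \<le> \<tau> powr - \<nu>"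
      using assms by (intro powr_mono2') auto
    then have "(t - s) powr - \<alpha> * s powr - \<nu> \<le> (t - s) powr - \<alpha> * \<tau> powr - \<nu>"
      by (rule mult_left_mono) simp
    then show "k t s \<le> \<tau> powr - \<nu> * (t - s) powr - \<alpha>" by (simp add: mult.commute)
  qed
  then have "K * integral {a..t} (k t) \<le> K * (\<tau> powr - \<nu> * ((t - a) powr (1 - \<alpha>) / (1 - \<alpha>)))"
    by (rule mult_left_mono[OF _ K])
  then show ?thesis
    using tail_integral_Y[of a t] assms by linarith
qed

text \<open>
  \<open>w(t)\<close> differs from \<open>e\<^bsup>\<epsilon>A\<^esup> w(t - \<epsilon>)\<close>, which is continuous into \<open>Y\<close>, by an integral over \<open>[t - \<epsilon>, t]\<close> that
  is small in \<open>Y\<close>, uniformly for \<open>t\<close> away from 0.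
\<close>

lemma w_continuous_Y:
  assumes \<nu>0: "0 \<le> \<nu>"
  shows "continuous_map (top_of_set {0<..T}) (ntop Y) w"
proof (rule Y.continuous_map_ntop_approx[OF w_mem_Y])
  fix t e :: real assume t: "t \<in> {0<..T}" and e: "0 < e"
  define h where "h \<epsilon> = K * ((t / 4) powr - \<nu> * (\<epsilon> powr (1 - \<alpha>) / (1 - \<alpha>)))" for \<epsilon>
  have "(h \<longlongrightarrow> 0) (at_right 0)"
    unfolding h_def using \<alpha> by (auto intro!: tendsto_eq_intros simp: eventually_at_filter)
  then have "\<forall>\<^sub>F \<epsilon> in at_right 0. h \<epsilon> < e"
    using e by (rule order_tendstoD(2))
  moreover have "\<forall>\<^sub>F \<epsilon> in at_right 0. \<epsilon> \<in> {0<..<t / 2}"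
    using t by (intro eventually_at_right_real) auto
  ultimately have "\<forall>\<^sub>F \<epsilon> in at_right 0. h \<epsilon> < e \<and> \<epsilon> \<in> {0<..<t / 2}"
    by (rule eventually_conj)
  then obtain \<epsilon> where \<epsilon>: "h \<epsilon> < e" "0 < \<epsilon>" "\<epsilon> < t / 2"
    using eventually_happens[of _ "at_right (0::real)"] by (auto simp: trivial_limit_at_right_real)
  have \<epsilon>T: "\<epsilon> \<in> {0<..T}" using \<epsilon> t by auto
  let ?v = "\<lambda>s. S \<epsilon> (w (max 0 (s - \<epsilon>)))"
  show "\<exists>d>0. \<exists>v. (\<forall>s\<in>{0<..T}. dist s t < d \<longrightarrow> v s \<in> carr Y \<and> nrm Y (w s - v s) \<le> e) \<and>
      ((\<lambda>s. nrm Y (v s - v t)) \<longlongrightarrow> 0) (at t within {0<..T})"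
  proof (intro exI[of _ "t / 4"] exI[of _ ?v] conjI ballI impI S_mem_Y \<epsilon>T)
    show "0 < t / 4" using t by simp
    fix s assume s: "s \<in> {0<..T}" "dist s t < t / 4"
    then have st: "3 * t / 4 < s" unfolding dist_real_def by linarith
    have "w s - ?v s = integral {s - \<epsilon>..s} (\<lambda>r. S (s - r) (g r))"
      using w_split[of "s - \<epsilon>" s] s st \<epsilon> by simp
    then have "nrm Y (w s - ?v s) \<le> h \<epsilon>"
      using tail_le[of "t / 4" "s - \<epsilon>" s] s st \<epsilon> t \<nu>0 by (simp add: h_def)
    then show "nrm Y (w s - ?v s) \<le> e" using \<epsilon> by simp
  next
    have "continuous_on {0<..T} (\<lambda>s. w (max 0 (s - \<epsilon>)))"
      by (rule continuous_on_compose2[OF w_continuous]) (use \<epsilon> T in \<open>auto intro!: continuous_intros\<close>)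
    then have "((\<lambda>s. w (max 0 (s - \<epsilon>))) \<longlongrightarrow> w (max 0 (t - \<epsilon>))) (at t within {0<..T})"
      using t unfolding continuous_on_def by blast
    from tendsto_S_Y[OF \<epsilon>T this]
    show "((\<lambda>s. nrm Y (?v s - ?v t)) \<longlongrightarrow> 0) (at t within {0<..T})" .
  qed
qed

end

section \<open>Interpolation spaces\<close>

lemma banach_space_imp_subspace:
  assumes scl: "banach_scalars scl" and X: "banach_space scl X"
  shows "banach_subspace X"
proof -
  interpret vector_space scl
    using scl by (simp add: banach_scalars_def)
  have real: "scl (of_real r) x = r *\<^sub>R x" for r x
    using scl by (simp add: banach_scalars_def)
  have sub: "subspace (carr X)"
    using X by (simp add: banach_space_def)
  show ?thesis
  proof
    fix x y r assume x: "x \<in> carr X"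
    show "r *\<^sub>R x \<in> carr X"
      using subspace_scale[OF sub x, of "of_real r"] by (simp add: real)
    have "nrm X (scl (of_real r) x) = norm (of_real r :: 'a) * nrm X x"
      using X x by (auto simp: banach_space_def)
    then show "nrm X (r *\<^sub>R x) = \<bar>r\<bar> * nrm X x"
      by (simp add: real)
  qed (use X sub in \<open>auto simp: banach_space_def subspace_0 subspace_add\<close>)
qed

lemma bounded_bilinear_scalars:
  assumes "banach_scalars scl"
  shows "bounded_bilinear scl"
proof -
  interpret vector_space scl
    using assms by (simp add: banach_scalars_def)
  have real: "scl (of_real r) x = r *\<^sub>R x" for r x
    using assms by (simp add: banach_scalars_def)
  show ?thesis
  proof
    fix r c x
    show "scl (r *\<^sub>R c) x = r *\<^sub>R scl c x"
      by (metis real scale_scale scaleR_conv_of_real)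
    show "scl c (r *\<^sub>R x) = r *\<^sub>R scl c x"
      by (metis real scale_scale mult.commute)
    show "\<exists>K. \<forall>c x. norm (scl c x) \<le> norm c * norm x * K"
      using assms by (intro exI[of _ 1]) (simp add: banach_scalars_def)
  qed (simp_all add: scale_left_distrib scale_right_distrib)
qed

lemma banach_space_whole:
  assumes "banach_scalars scl"
  shows "banach_space scl whole_space"
proof -
  interpret vector_space scl
    using assms by (simp add: banach_scalars_def)
  show ?thesis
    using assms banach_subspace.mcomplete[OF banach_subspace_whole]
    by (auto simp: banach_space_def banach_scalars_def subspace_UNIV norm_triangle_ineq)
qed

text \<open>The ambient Hausdorff space of the couple can be \<open>E\<^sub>0\<close> itself.\<close>

lemma banach_coupleI:
  assumes scl: "banach_scalars scl"
    and X: "banach_space scl X" "cont_embedded X whole_space"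
    and Y: "banach_space scl Y" "cont_embedded Y whole_space"
  shows "banach_couple scl X Y"
proof -
  interpret scl: bounded_bilinear scl
    by (rule bounded_bilinear_scalars[OF scl])
  have top: "hausdorff_tvs scl euclidean"
    unfolding hausdorff_tvs_def euclidean_product_topology case_prod_unfold
    by (auto simp: continuous_map_iff_continuous2 Hausdorff_space_euclidean
        intro!: continuous_intros scl.continuous_on)
  have cont: "continuous_map (ntop Z) euclidean (\<lambda>x. x)"
    if Z: "banach_space scl Z" "cont_embedded Z whole_space" for Z
  proof -
    interpret Z: banach_subspace Z by (rule banach_space_imp_subspace[OF scl Z(1)])
    obtain C where C: "\<And>x. x \<in> carr Z \<Longrightarrow> norm x \<le> C * nrm Z x"
      using Z(2) by (auto simp: cont_embedded_def bounded_by_def)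
    have id: "limitin (ntop Z) (\<lambda>x. x) z (atin (ntop Z) z)" if "z \<in> carr Z" for z
      using continuous_map_id[of "ntop Z"] that
      unfolding continuous_map_atin by (auto simp: ntop_def id_def)
    show ?thesis
      unfolding continuous_map_atin limitin_canonical_iff
    proof
      fix z assume "z \<in> topspace (ntop Z)"
      then have z: "z \<in> carr Z" by (simp add: ntop_def)
      have ev: "\<forall>\<^sub>F x in atin (ntop Z) z. x \<in> carr Z" and lim: "((\<lambda>x. nrm Z (x - z)) \<longlongrightarrow> 0) (atin (ntop Z) z)"
        using id[OF z] unfolding Z.limitin_ntop by auto
      show "((\<lambda>x. x) \<longlongrightarrow> z) (atin (ntop Z) z)"
      proof (rule LIM_zero_cancel, rule Lim_null_comparison)
        show "\<forall>\<^sub>F x in atin (ntop Z) z. norm (x - z) \<le> C * nrm Z (x - z)"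
          using ev by eventually_elim (use C z Z.diff_mem in auto)
        show "((\<lambda>x. C * nrm Z (x - z)) \<longlongrightarrow> 0) (atin (ntop Z) z)"
          by (rule tendsto_mult_right_zero[OF lim])
      qed
    qed
  qed
  show ?thesis
    unfolding banach_couple_def using X Y top cont by blast
qed

text \<open>
  With \<open>p\<close> a multiple of the norm of a space into which \<open>X\<close> and \<open>Y\<close> embed, this says that the sum
  space embeds into it.
\<close>

lemma sum_space_norm_ge:
  fixes X Y :: "'a::real_vector nspace"
  assumes X: "banach_subspace X" and Y: "banach_subspace Y"
    and p: "\<And>a b. a \<in> carr X \<Longrightarrow> b \<in> carr Y \<Longrightarrow> p (a + b) \<le> nrm X a + nrm Y b"
    and x: "x \<in> carr (sum_space X Y)"
  shows "p x \<le> nrm (sum_space X Y) x"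
proof -
  have "{nrm X a + nrm Y b | a b. a \<in> carr X \<and> b \<in> carr Y \<and> x = a + b} \<noteq> {}"
    using x by (auto simp: sum_space_def)
  then have "p x \<le> Inf {nrm X a + nrm Y b | a b. a \<in> carr X \<and> b \<in> carr Y \<and> x = a + b}"
    by (rule cInf_greatest) (use p in auto)
  then show ?thesis by (simp add: sum_space_def)
qed

locale interpolation_scale = smoothing_semigroup S A E\<^sub>1 T M
  for S :: "real \<Rightarrow> 'a::banach \<Rightarrow> 'a" and A E\<^sub>1 T M +
  fixes scl :: "'k::{real_normed_field,banach} \<Rightarrow> 'a \<Rightarrow> 'a"
    and F :: "real \<Rightarrow> 'a nspace \<Rightarrow> 'a nspace \<Rightarrow> 'a nspace"
  assumes scl: "banach_scalars scl"
    and E\<^sub>1_space: "banach_space scl E\<^sub>1"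
    and functors: "\<eta> \<in> {0<..<1} \<Longrightarrow> interpolation_functor scl \<eta> (F \<eta>)"
    and S_linear: "0 \<le> t \<Longrightarrow> Vector_Spaces.linear scl scl (S t)"
begin

lemma E1_embedded: "cont_embedded E\<^sub>1 whole_space"
proof -
  obtain c where c: "\<And>x. x \<in> carr E\<^sub>1 \<Longrightarrow> norm x \<le> c * nrm E\<^sub>1 x"
    using emb by blast
  have "norm x \<le> max 0 c * nrm E\<^sub>1 x" if "x \<in> carr E\<^sub>1" for x
    using c[OF that] mult_right_mono[of c "max 0 c" "nrm E\<^sub>1 x"] E\<^sub>1.nrm_ge0[OF that] by linarith
  then show ?thesis
    unfolding cont_embedded_def bounded_by_def by (intro exI[of _ "max 0 c"]) auto
qed

lemma whole_embedded: "cont_embedded (whole_space :: 'a nspace) whole_space"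
  unfolding cont_embedded_def bounded_by_def by (intro exI[of _ 1]) auto

lemma couples:
  "banach_couple scl whole_space E\<^sub>1" "banach_couple scl whole_space whole_space"
  "banach_couple scl E\<^sub>1 E\<^sub>1"
  by (intro banach_coupleI scl E\<^sub>1_space banach_space_whole E1_embedded whole_embedded)+

lemma functor_space:
  assumes "\<eta> \<in> {0<..<1}" "banach_couple scl X\<^sub>0 X\<^sub>1"
  shows "banach_subspace (F \<eta> X\<^sub>0 X\<^sub>1)" "cont_embedded (int_space X\<^sub>0 X\<^sub>1) (F \<eta> X\<^sub>0 X\<^sub>1)"
    "cont_embedded (F \<eta> X\<^sub>0 X\<^sub>1) (sum_space X\<^sub>0 X\<^sub>1)"
  using functors[OF assms(1)] assms(2) banach_space_imp_subspace[OF scl]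
  by (auto simp: interpolation_functor_def)

lemma functor_map:
  assumes \<eta>: "\<eta> \<in> {0<..<1}"
  obtains c where "0 < c"
    "\<And>t X\<^sub>0 X\<^sub>1 Y\<^sub>0 Y\<^sub>1 M\<^sub>0 M\<^sub>1. 0 \<le> t \<Longrightarrow> banach_couple scl X\<^sub>0 X\<^sub>1 \<Longrightarrow> banach_couple scl Y\<^sub>0 Y\<^sub>1 \<Longrightarrow>
        bounded_by X\<^sub>0 Y\<^sub>0 (S t) M\<^sub>0 \<Longrightarrow> bounded_by X\<^sub>1 Y\<^sub>1 (S t) M\<^sub>1 \<Longrightarrow>
        bounded_by (F \<eta> X\<^sub>0 X\<^sub>1) (F \<eta> Y\<^sub>0 Y\<^sub>1) (S t) (c * M\<^sub>0 powr (1 - \<eta>) * M\<^sub>1 powr \<eta>)"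
proof -
  obtain c where c: "0 < c" "\<forall>X\<^sub>0 X\<^sub>1 Y\<^sub>0 Y\<^sub>1 B M\<^sub>0 M\<^sub>1.
        banach_couple scl X\<^sub>0 X\<^sub>1 \<longrightarrow> banach_couple scl Y\<^sub>0 Y\<^sub>1 \<longrightarrow>
        Vector_Spaces.linear scl scl B \<longrightarrow>
        bounded_by X\<^sub>0 Y\<^sub>0 B M\<^sub>0 \<longrightarrow> bounded_by X\<^sub>1 Y\<^sub>1 B M\<^sub>1 \<longrightarrow>
        bounded_by (F \<eta> X\<^sub>0 X\<^sub>1) (F \<eta> Y\<^sub>0 Y\<^sub>1) B (c * M\<^sub>0 powr (1 - \<eta>) * M\<^sub>1 powr \<eta>)"
    using functors[OF \<eta>] unfolding interpolation_functor_def by blast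
  show ?thesis
    by (rule that[OF c(1)]) (use c(2) S_linear in blast)
qed

lemma interp_cases:
  assumes "\<eta> \<in> {0..1}"
  obtains "\<eta> = 0" "interp F E\<^sub>1 \<eta> = whole_space" | "\<eta> = 1" "interp F E\<^sub>1 \<eta> = E\<^sub>1"
  | "\<eta> \<in> {0<..<1}" "interp F E\<^sub>1 \<eta> = F \<eta> whole_space E\<^sub>1"
  using assms by (cases "\<eta> = 0"; cases "\<eta> = 1") (auto simp: interp_def)

lemma interp_banach: "\<eta> \<in> {0..1} \<Longrightarrow> banach_subspace (interp F E\<^sub>1 \<eta>)"
  by (erule interp_cases) (auto intro: banach_subspace_whole E\<^sub>1 functor_space couples)

lemma interp_embedded:
  assumes "\<eta> \<in> {0..1}"
  shows "\<exists>c. \<forall>x\<in>carr (interp F E\<^sub>1 \<eta>). norm x \<le> c * nrm (interp F E\<^sub>1 \<eta>) x"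
  using assms
proof (cases rule: interp_cases)
  case 1
  then show ?thesis by (auto intro!: exI[of _ 1])
next
  case 2
  then show ?thesis using emb by simp
next
  case 3
  obtain c where c: "0 \<le> c" "\<And>x. x \<in> carr E\<^sub>1 \<Longrightarrow> norm x \<le> c * nrm E\<^sub>1 x"
    using E1_embedded by (auto simp: cont_embedded_def bounded_by_def)
  define d where "d = max 1 c"
  have d: "1 \<le> d" "c \<le> d" by (auto simp: d_def)
  obtain C where C: "0 \<le> C" "\<And>x. x \<in> carr (F \<eta> whole_space E\<^sub>1) \<Longrightarrow>
      x \<in> carr (sum_space whole_space E\<^sub>1) \<and> nrm (sum_space whole_space E\<^sub>1) x \<le> C * nrm (F \<eta> whole_space E\<^sub>1) x"
    using functor_space(3)[OF 3(1) couples(1)] by (auto simp: cont_embedded_def bounded_by_def)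
  have "norm x \<le> d * C * nrm (F \<eta> whole_space E\<^sub>1) x" if x: "x \<in> carr (F \<eta> whole_space E\<^sub>1)" for x
  proof -
    have "norm x / d \<le> nrm (sum_space whole_space E\<^sub>1) x"
    proof (rule sum_space_norm_ge[OF banach_subspace_whole E\<^sub>1])
      fix a b assume "b \<in> carr E\<^sub>1"
      then have "norm (a + b) \<le> norm a + c * nrm E\<^sub>1 b"
        using norm_triangle_ineq[of a b] c(2)[of b] by linarith
      also have "\<dots> \<le> d * norm a + d * nrm E\<^sub>1 b"
        using d E\<^sub>1.nrm_ge0[OF \<open>b \<in> carr E\<^sub>1\<close>] mult_right_mono[OF d(1), of "norm a"]
        by (intro add_mono mult_right_mono) auto
      finally show "norm (a + b) / d \<le> nrm whole_space a + nrm E\<^sub>1 b"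
        using d by (simp add: pos_divide_le_eq algebra_simps)
    qed (use C x in auto)
    also have "\<dots> \<le> C * nrm (F \<eta> whole_space E\<^sub>1) x"
      using C x by blast
    finally show ?thesis
      using d by (simp add: pos_divide_le_eq mult_ac)
  qed
  then show ?thesis using 3 by auto
qed

lemma interp_E1:
  assumes "\<eta> \<in> {0..1}"
  shows "\<exists>c. \<forall>x\<in>carr E\<^sub>1. x \<in> carr (interp F E\<^sub>1 \<eta>) \<and> nrm (interp F E\<^sub>1 \<eta>) x \<le> c * nrm E\<^sub>1 x"
  using assms
proof (cases rule: interp_cases)
  case 1
  then show ?thesis using emb by simp
next
  case 2
  then show ?thesis by (auto intro!: exI[of _ 1])
next
  case 3
  obtain c where c: "0 \<le> c" "\<And>x. x \<in> carr E\<^sub>1 \<Longrightarrow> norm x \<le> c * nrm E\<^sub>1 x"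
    using E1_embedded by (auto simp: cont_embedded_def bounded_by_def)
  obtain C where C: "0 \<le> C" "\<And>x. x \<in> carr (int_space whole_space E\<^sub>1) \<Longrightarrow>
      x \<in> carr (F \<eta> whole_space E\<^sub>1) \<and> nrm (F \<eta> whole_space E\<^sub>1) x \<le> C * nrm (int_space whole_space E\<^sub>1) x"
    using functor_space(2)[OF 3(1) couples(1)] by (auto simp: cont_embedded_def bounded_by_def)
  have "nrm (F \<eta> whole_space E\<^sub>1) x \<le> C * max c 1 * nrm E\<^sub>1 x" if x: "x \<in> carr E\<^sub>1" for x
  proof -
    have "c * nrm E\<^sub>1 x \<le> max c 1 * nrm E\<^sub>1 x" "1 * nrm E\<^sub>1 x \<le> max c 1 * nrm E\<^sub>1 x"
      by (intro mult_right_mono E\<^sub>1.nrm_ge0 x; simp)+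
    then have "nrm (int_space whole_space E\<^sub>1) x \<le> max c 1 * nrm E\<^sub>1 x"
      using c(2)[OF x] by (auto simp: int_space_def)
    then have "C * nrm (int_space whole_space E\<^sub>1) x \<le> C * (max c 1 * nrm E\<^sub>1 x)"
      using C(1) by (rule mult_left_mono)
    with C(2)[of x] x show ?thesis by (simp add: int_space_def mult.assoc)
  qed
  then show ?thesis using 3 C(2) by (auto simp: int_space_def)
qed

text \<open>
  \<open>e\<^sup>t\<^sup>A\<close> is bounded on \<open>E\<^sub>0\<close> and \<open>O(1/t)\<close> from \<open>E\<^sub>0\<close> to \<open>E\<^sub>1\<close>; interpolation between the couples
  \<open>(E\<^sub>0, E\<^sub>0)\<close> and \<open>(E\<^sub>0, E\<^sub>1)\<close> gives \<open>O(t\<^bsup>-\<eta>\<^esup>)\<close>.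
\<close>

lemma interp_smoothing:
  assumes "\<eta> \<in> {0..1}"
  shows "\<exists>K\<ge>0. \<forall>r\<in>{0<..T}. \<forall>x. S r x \<in> carr (interp F E\<^sub>1 \<eta>) \<and>
    nrm (interp F E\<^sub>1 \<eta>) (S r x) \<le> K * (r powr - \<eta> * norm x)"
proof -
  obtain K where K: "1 \<le> K" "\<And>t x. t \<in> {0<..T} \<Longrightarrow> nrm E\<^sub>1 (S t x) \<le> K / t * norm x"
    using smoothing_E1 by metis
  show ?thesis
    using assms
  proof (cases rule: interp_cases)
    case 1
    then show ?thesis using S_bound M by (intro exI[of _ M]) auto
  next
    case 2
    then show ?thesis using S_smooth K
      by (intro exI[of _ K]) (auto simp: powr_minus_divide)
  next
    case 3
    obtain c where c: "0 < c"
      "\<And>t X\<^sub>0 X\<^sub>1 Y\<^sub>0 Y\<^sub>1 M\<^sub>0 M\<^sub>1. 0 \<le> t \<Longrightarrow> banach_couple scl X\<^sub>0 X\<^sub>1 \<Longrightarrow> banach_couple scl Y\<^sub>0 Y\<^sub>1 \<Longrightarrow>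
        bounded_by X\<^sub>0 Y\<^sub>0 (S t) M\<^sub>0 \<Longrightarrow> bounded_by X\<^sub>1 Y\<^sub>1 (S t) M\<^sub>1 \<Longrightarrow>
        bounded_by (F \<eta> X\<^sub>0 X\<^sub>1) (F \<eta> Y\<^sub>0 Y\<^sub>1) (S t) (c * M\<^sub>0 powr (1 - \<eta>) * M\<^sub>1 powr \<eta>)"
      using functor_map[OF 3(1)] by metis
    obtain C where C: "0 \<le> C" "\<And>x. x \<in> carr (F \<eta> whole_space whole_space) \<and>
        nrm (F \<eta> whole_space whole_space) x \<le> C * norm x"
      using functor_space(2)[OF 3(1) couples(2)] by (auto simp: cont_embedded_def bounded_by_def int_space_def)
    have "S r x \<in> carr (F \<eta> whole_space E\<^sub>1) \<and>
        nrm (F \<eta> whole_space E\<^sub>1) (S r x) \<le> c * M powr (1 - \<eta>) * K powr \<eta> * C * (r powr - \<eta> * norm x)"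
      if r: "r \<in> {0<..T}" for r x
    proof -
      have 1: "bounded_by whole_space whole_space (S r) M"
        using S_bound[of r] r M by (auto simp: bounded_by_def)
      have 2: "bounded_by whole_space E\<^sub>1 (S r) (K / r)"
        using K S_smooth[OF r] r by (auto simp: bounded_by_def)
      define P where "P = c * M powr (1 - \<eta>) * (K / r) powr \<eta>"
      have P: "bounded_by (F \<eta> whole_space whole_space) (F \<eta> whole_space E\<^sub>1) (S r) P"
        unfolding P_def using r by (intro c(2) couples 1 2) auto
      have "nrm (F \<eta> whole_space E\<^sub>1) (S r x) \<le> P * nrm (F \<eta> whole_space whole_space) x"
        using P C(2)[of x] by (auto simp: bounded_by_def)
      also have "\<dots> \<le> P * (C * norm x)"
        using P C(2)[of x] by (intro mult_left_mono) (auto simp: bounded_by_def)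
      also have "(K / r) powr \<eta> = K powr \<eta> * r powr - \<eta>"
        by (simp add: powr_divide powr_minus_divide)
      then have "P * (C * norm x) = c * M powr (1 - \<eta>) * K powr \<eta> * C * (r powr - \<eta> * norm x)"
        by (simp add: P_def mult_ac)
      finally show ?thesis
        using P C(2)[of x] by (auto simp: bounded_by_def)
    qed
    then show ?thesis
      using 3 c C by (intro exI[of _ "c * M powr (1 - \<eta>) * K powr \<eta> * C"]) auto
  qed
qed

text \<open>
  Interpolating \<open>E\<^sub>0 \<rightarrow> E\<^sub>1\<close> and \<open>E\<^sub>1 \<rightarrow> E\<^sub>1\<close> instead: starting in \<open>E\<^sub>\<gamma>\<close> improves the singularity to
  \<open>O(t\<^bsup>\<gamma>-1\<^esup>)\<close>, which is integrable if \<open>\<gamma> > 0\<close>.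
\<close>

lemma interp_to_E1:
  assumes "\<gamma> \<in> {0<..1}"
  shows "\<exists>K\<ge>0. \<forall>r\<in>{0<..T}. \<forall>x\<in>carr (interp F E\<^sub>1 \<gamma>).
    nrm E\<^sub>1 (S r x) \<le> K * (r powr - (1 - \<gamma>) * nrm (interp F E\<^sub>1 \<gamma>) x)"
proof -
  obtain K where K: "1 \<le> K" "\<And>t x. t \<in> {0<..T} \<Longrightarrow> nrm E\<^sub>1 (S t x) \<le> K / t * norm x"
    "\<And>t x. t \<in> {0..T} \<Longrightarrow> x \<in> carr E\<^sub>1 \<Longrightarrow> nrm E\<^sub>1 (S t x) \<le> K * nrm E\<^sub>1 x"
    using smoothing_E1 by metis
  have "\<gamma> \<in> {0..1}" using assms by auto
  then show ?thesis
  proof (cases rule: interp_cases)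
    case 1
    then show ?thesis using assms by simp
  next
    case 2
    then show ?thesis using K(1,3) by (intro exI[of _ K]) auto
  next
    case 3
    obtain c where c: "0 < c"
      "\<And>t X\<^sub>0 X\<^sub>1 Y\<^sub>0 Y\<^sub>1 M\<^sub>0 M\<^sub>1. 0 \<le> t \<Longrightarrow> banach_couple scl X\<^sub>0 X\<^sub>1 \<Longrightarrow> banach_couple scl Y\<^sub>0 Y\<^sub>1 \<Longrightarrow>
        bounded_by X\<^sub>0 Y\<^sub>0 (S t) M\<^sub>0 \<Longrightarrow> bounded_by X\<^sub>1 Y\<^sub>1 (S t) M\<^sub>1 \<Longrightarrow>
        bounded_by (F \<gamma> X\<^sub>0 X\<^sub>1) (F \<gamma> Y\<^sub>0 Y\<^sub>1) (S t) (c * M\<^sub>0 powr (1 - \<gamma>) * M\<^sub>1 powr \<gamma>)"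
      using functor_map[OF 3(1)] by metis
    obtain C where C: "0 \<le> C" "\<And>x. x \<in> carr (F \<gamma> E\<^sub>1 E\<^sub>1) \<Longrightarrow>
        x \<in> carr (sum_space E\<^sub>1 E\<^sub>1) \<and> nrm (sum_space E\<^sub>1 E\<^sub>1) x \<le> C * nrm (F \<gamma> E\<^sub>1 E\<^sub>1) x"
      using functor_space(3)[OF 3(1) couples(3)] by (auto simp: cont_embedded_def bounded_by_def)
    have "nrm E\<^sub>1 (S r x) \<le> C * c * K * (r powr - (1 - \<gamma>) * nrm (F \<gamma> whole_space E\<^sub>1) x)"
      if r: "r \<in> {0<..T}" and x: "x \<in> carr (F \<gamma> whole_space E\<^sub>1)" for r x
    proof -
      have 1: "bounded_by whole_space E\<^sub>1 (S r) (K / r)"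
        using K S_smooth[OF r] r by (auto simp: bounded_by_def)
      have 2: "bounded_by E\<^sub>1 E\<^sub>1 (S r) K"
        using K S_smooth[OF r] r by (auto simp: bounded_by_def)
      define P where "P = c * (K / r) powr (1 - \<gamma>) * K powr \<gamma>"
      have P: "bounded_by (F \<gamma> whole_space E\<^sub>1) (F \<gamma> E\<^sub>1 E\<^sub>1) (S r) P"
        unfolding P_def using r by (intro c(2) couples 1 2) auto
      have mem: "S r x \<in> carr (F \<gamma> E\<^sub>1 E\<^sub>1)" and le: "nrm (F \<gamma> E\<^sub>1 E\<^sub>1) (S r x) \<le> P * nrm (F \<gamma> whole_space E\<^sub>1) x"
        using P x by (auto simp: bounded_by_def)
      have "nrm E\<^sub>1 (S r x) \<le> nrm (sum_space E\<^sub>1 E\<^sub>1) (S r x)"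
        using C(2)[OF mem] by (intro sum_space_norm_ge E\<^sub>1 E\<^sub>1.nrm_add) auto
      also have "\<dots> \<le> C * nrm (F \<gamma> E\<^sub>1 E\<^sub>1) (S r x)"
        using C(2)[OF mem] by blast
      also have "\<dots> \<le> C * (P * nrm (F \<gamma> whole_space E\<^sub>1) x)"
        using le C(1) by (rule mult_left_mono)
      also have "P = c * K * r powr - (1 - \<gamma>)"
      proof -
        have "(K / r) powr (1 - \<gamma>) = K powr (1 - \<gamma>) * r powr - (1 - \<gamma>)"
          by (simp only: powr_divide powr_minus_divide) simp
        moreover have "K powr (1 - \<gamma>) * K powr \<gamma> = K"
          using K(1) by (simp flip: powr_add)
        ultimately show ?thesis by (simp add: P_def mult_ac)
      qed
      finally show ?thesis by (simp only: mult_ac)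
    qed
    then show ?thesis
      using 3 c C K by (intro exI[of _ "C * c * K"]) auto
  qed
qed

end

section \<open>Weighted function spaces\<close>

context normed_subspace
begin

lemma cw_mem: "u \<in> cw_space T \<mu> X \<Longrightarrow> t \<in> {0<..T} \<Longrightarrow> u t \<in> carr X"
  by (simp add: cw_space_def continuous_map_ntop)

lemma cw_bdd_above:
  assumes u: "u \<in> cw_space T \<mu> X"
  shows "bdd_above ((\<lambda>t. t powr \<mu> * nrm X (u t)) ` {0<..T})"
proof -
  let ?h = "\<lambda>t. t powr \<mu> * nrm X (u t)"
  have cont: "continuous_on {0<..T} ?h"
    using u by (intro continuous_intros continuous_on_nrm) (auto simp: cw_space_def)
  have "\<forall>\<^sub>F t in at_right 0. ?h t < 1"
    using u order_tendstoD(2)[of ?h 0 "at_right 0" 1] by (simp add: cw_space_def)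
  then obtain d where d: "0 < d" "\<And>t. 0 < t \<Longrightarrow> t < d \<Longrightarrow> ?h t < 1"
    unfolding eventually_at_right_field by auto
  have "compact (?h ` {d..T})"
    by (intro compact_continuous_image continuous_on_subset[OF cont]) (use d in auto)
  then have "bdd_above (?h ` {d..T})"
    by (intro bounded_imp_bdd_above compact_imp_bounded)
  then obtain B where B: "\<And>t. t \<in> {d..T} \<Longrightarrow> ?h t \<le> B"
    unfolding bdd_above_def by blast
  show ?thesis
  proof (rule bdd_aboveI2)
    fix t assume t: "t \<in> {0<..T}"
    show "?h t \<le> max 1 B"
    proof (cases "t < d")
      case True
      then have "?h t < 1" using d t by auto
      then show ?thesis by linarith
    next
      case False
      then have "?h t \<le> B" using B t by auto
      then show ?thesis by linarith
    qed
  qed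
qed

lemma cw_le: "u \<in> cw_space T \<mu> X \<Longrightarrow> t \<in> {0<..T} \<Longrightarrow> t powr \<mu> * nrm X (u t) \<le> cw_norm T \<mu> X u"
  unfolding cw_norm_def by (rule cSUP_upper[OF _ cw_bdd_above])

lemma cw_le':
  assumes "u \<in> cw_space T \<mu> X" "t \<in> {0<..T}"
  shows "nrm X (u t) \<le> cw_norm T \<mu> X u * t powr - \<mu>"
proof -
  have "t powr - \<mu> * (t powr \<mu> * nrm X (u t)) \<le> t powr - \<mu> * cw_norm T \<mu> X u"
    using cw_le[OF assms] by (rule mult_left_mono) simp
  moreover have "t powr - \<mu> * (t powr \<mu> * nrm X (u t)) = nrm X (u t)"
    using assms(2) by (simp add: powr_minus)
  ultimately show ?thesis by (simp add: mult.commute)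
qed

lemma cw_zero: "(\<lambda>_. 0) \<in> cw_space T \<mu> X"
  by (simp add: cw_space_def continuous_map_ntop)

lemma continuous_map_add:
  fixes u v :: "'b::metric_space \<Rightarrow> 'a"
  assumes u: "continuous_map (top_of_set I) (ntop X) u" and v: "continuous_map (top_of_set I) (ntop X) v"
  shows "continuous_map (top_of_set I) (ntop X) (\<lambda>t. u t + v t)"
proof -
  have mem: "u t \<in> carr X" "v t \<in> carr X" if "t \<in> I" for t
    using u v that by (auto simp: continuous_map_ntop)
  show ?thesis
    unfolding continuous_map_ntop
  proof (intro ballI conjI add_mem mem)
    fix t assume t: "t \<in> I"
    have "((\<lambda>s. nrm X (u s - u t)) \<longlongrightarrow> 0) (at t within I)" "((\<lambda>s. nrm X (v s - v t)) \<longlongrightarrow> 0) (at t within I)"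
      using u v t by (auto simp: continuous_map_ntop)
    from tendsto_add[OF this]
    have lim: "((\<lambda>s. nrm X (u s - u t) + nrm X (v s - v t)) \<longlongrightarrow> 0) (at t within I)" by simp
    show "((\<lambda>s. nrm X (u s + v s - (u t + v t))) \<longlongrightarrow> 0) (at t within I)"
    proof (rule Lim_null_comparison[OF _ lim])
      have "\<forall>\<^sub>F s in at t within I. s \<in> I"
        by (simp add: eventually_at_filter)
      then show "\<forall>\<^sub>F s in at t within I. norm (nrm X (u s + v s - (u t + v t))) \<le> nrm X (u s - u t) + nrm X (v s - v t)"
      proof eventually_elim
        case (elim s)
        have "u s - u t \<in> carr X" "v s - v t \<in> carr X"
          using mem[OF t] mem[OF elim] by (auto intro: diff_mem)
        then show ?case
          using nrm_add[of "u s - u t" "v s - v t"] nrm_ge0[of "(u s - u t) + (v s - v t)"] add_mem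
          by (simp add: add_diff_add)
      qed
    qed
  qed
qed

lemma continuous_map_uminus:
  fixes u :: "'b::metric_space \<Rightarrow> 'a"
  assumes "continuous_map (top_of_set I) (ntop X) u"
  shows "continuous_map (top_of_set I) (ntop X) (\<lambda>t. - u t)"
  unfolding continuous_map_ntop
proof (intro ballI conjI)
  have u: "u t \<in> carr X" "((\<lambda>s. nrm X (u s - u t)) \<longlongrightarrow> 0) (at t within I)" if "t \<in> I" for t
    using assms that by (auto simp: continuous_map_ntop)
  fix t assume t: "t \<in> I"
  show "- u t \<in> carr X" using u(1)[OF t] by (rule minus_mem)
  have "\<forall>\<^sub>F s in at t within I. s \<in> I"
    by (simp add: eventually_at_filter)
  then have "\<forall>\<^sub>F s in at t within I. nrm X (- u s - - u t) = nrm X (u s - u t)"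
  proof eventually_elim
    case (elim s)
    then show ?case using nrm_commute[OF u(1)[OF elim] u(1)[OF t]] by simp
  qed
  from tendsto_cong[OF this] u(2)[OF t] show "((\<lambda>s. nrm X (- u s - - u t)) \<longlongrightarrow> 0) (at t within I)"
    by blast
qed

lemma cw_diff:
  assumes T: "0 < T" and u: "u \<in> cw_space T \<mu> X" and v: "v \<in> cw_space T \<mu> X"
  shows "(\<lambda>t. u t - v t) \<in> cw_space T \<mu> X"
proof -
  have "continuous_map (top_of_set {0<..T}) (ntop X) (\<lambda>t. u t + - v t)"
    using u v by (intro continuous_map_add continuous_map_uminus) (auto simp: cw_space_def)
  moreover have "((\<lambda>t. t powr \<mu> * nrm X (u t - v t)) \<longlongrightarrow> 0) (at_right 0)"
  proof (rule Lim_null_comparison)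
    show "((\<lambda>t. t powr \<mu> * nrm X (u t) + t powr \<mu> * nrm X (v t)) \<longlongrightarrow> 0) (at_right 0)"
      by (intro tendsto_add_zero) (use u v in \<open>simp_all add: cw_space_def\<close>)
    have "\<forall>\<^sub>F t in at_right 0. t \<in> {0<..<T}"
      using T by (rule eventually_at_right_real)
    then show "\<forall>\<^sub>F t in at_right 0. norm (t powr \<mu> * nrm X (u t - v t)) \<le> t powr \<mu> * nrm X (u t) + t powr \<mu> * nrm X (v t)"
    proof eventually_elim
      case (elim t)
      then have m: "u t \<in> carr X" "v t \<in> carr X" using cw_mem[OF u, of t] cw_mem[OF v, of t] by auto
      have "t powr \<mu> * nrm X (u t - v t) \<le> t powr \<mu> * (nrm X (u t) + nrm X (v t))"
        by (intro mult_left_mono nrm_diff m) simp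
      then show ?case
        using nrm_ge0[OF diff_mem[OF m]] by (simp add: distrib_left)
    qed
  qed
  ultimately show ?thesis by (simp add: cw_space_def)
qed

lemma cw_cong:
  assumes T: "0 < T" and eq: "\<And>t. t \<in> {0<..T} \<Longrightarrow> u t = v t"
  shows "u \<in> cw_space T \<mu> X \<longleftrightarrow> v \<in> cw_space T \<mu> X" "cw_norm T \<mu> X u = cw_norm T \<mu> X v"
proof -
  have "continuous_map (top_of_set {0<..T}) (ntop X) u \<longleftrightarrow> continuous_map (top_of_set {0<..T}) (ntop X) v"
    using continuous_map_eq[of "top_of_set {0<..T}" "ntop X" u v]
      continuous_map_eq[of "top_of_set {0<..T}" "ntop X" v u] eq by auto
  moreover have "\<forall>\<^sub>F t in at_right 0. t powr \<mu> * nrm X (u t) = t powr \<mu> * nrm X (v t)"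
    using eventually_at_right_real[OF T] by eventually_elim (use eq in auto)
  ultimately show "u \<in> cw_space T \<mu> X \<longleftrightarrow> v \<in> cw_space T \<mu> X"
    unfolding cw_space_def by (auto simp only: tendsto_cong mem_Collect_eq)
  show "cw_norm T \<mu> X u = cw_norm T \<mu> X v"
    unfolding cw_norm_def by (rule SUP_cong) (use eq in auto)
qed

lemma cw_norm_le:
  assumes "0 < T" "\<And>t. t \<in> {0<..T} \<Longrightarrow> t powr \<mu> * nrm X (u t) \<le> B"
  shows "cw_norm T \<mu> X u \<le> B"
  unfolding cw_norm_def using assms by (intro cSUP_least) auto

lemma cw_norm_ge0:
  assumes T: "0 < T" and u: "u \<in> cw_space T \<mu> X"
  shows "0 \<le> cw_norm T \<mu> X u"
proof -
  have "0 \<le> T powr \<mu> * nrm X (u T)"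
    using nrm_ge0[OF cw_mem[OF u, of T]] T by simp
  also have "\<dots> \<le> cw_norm T \<mu> X u"
    using T by (intro cw_le u) auto
  finally show ?thesis .
qed

lemma cw_norm_commute:
  assumes "0 < T" "u \<in> cw_space T \<mu> X" "v \<in> cw_space T \<mu> X"
  shows "cw_norm T \<mu> X (\<lambda>t. u t - v t) = cw_norm T \<mu> X (\<lambda>t. v t - u t)"
proof -
  have "nrm X (u t - v t) = nrm X (v t - u t)" if "t \<in> {0<..T}" for t
    using cw_mem[OF assms(2) that] cw_mem[OF assms(3) that] by (rule nrm_commute)
  then show ?thesis unfolding cw_norm_def by (intro SUP_cong) auto
qed

lemma cw_norm_triangle:
  assumes T: "0 < T" and u: "u \<in> cw_space T \<mu> X" and v: "v \<in> cw_space T \<mu> X" and w: "w \<in> cw_space T \<mu> X"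
  shows "cw_norm T \<mu> X (\<lambda>t. u t - w t) \<le> cw_norm T \<mu> X (\<lambda>t. u t - v t) + cw_norm T \<mu> X (\<lambda>t. v t - w t)"
proof (rule cw_norm_le[OF T])
  fix t assume t: "t \<in> {0<..T}"
  have "t powr \<mu> * nrm X (u t - w t) \<le> t powr \<mu> * (nrm X (u t - v t) + nrm X (v t - w t))"
    using cw_mem[OF _ t] u v w by (intro mult_left_mono nrm_triangle) auto
  then show "t powr \<mu> * nrm X (u t - w t) \<le> cw_norm T \<mu> X (\<lambda>t. u t - v t) + cw_norm T \<mu> X (\<lambda>t. v t - w t)"
    using cw_le[OF cw_diff[OF T u v] t] cw_le[OF cw_diff[OF T v w] t] by (simp add: distrib_left)
qed

lemma cw_limit:
  assumes T: "0 < T" and mem: "\<And>t. t \<in> {0<..T} \<Longrightarrow> u t \<in> carr X"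
    and approx: "\<And>e. 0 < e \<Longrightarrow> \<exists>v\<in>cw_space T \<mu> X. \<forall>t\<in>{0<..T}. t powr \<mu> * nrm X (u t - v t) \<le> e"
  shows "u \<in> cw_space T \<mu> X"
proof -
  have "continuous_map (top_of_set {0<..T}) (ntop X) u"
  proof (rule continuous_map_ntop_approx[OF mem])
    fix t e :: real assume t: "t \<in> {0<..T}" and e: "0 < e"
    define c where "c = min ((t / 2) powr \<mu>) ((2 * t) powr \<mu>)"
    have c: "0 < c" using t by (simp add: c_def)
    obtain v where v: "v \<in> cw_space T \<mu> X" "\<And>s. s \<in> {0<..T} \<Longrightarrow> s powr \<mu> * nrm X (u s - v s) \<le> c * e"
      using approx[of "c * e"] c e by auto
    show "\<exists>d>0. \<exists>v. (\<forall>s\<in>{0<..T}. dist s t < d \<longrightarrow> v s \<in> carr X \<and> nrm X (u s - v s) \<le> e) \<and>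
        ((\<lambda>s. nrm X (v s - v t)) \<longlongrightarrow> 0) (at t within {0<..T})"
    proof (intro exI[of _ "t / 2"] exI[of _ v] conjI ballI impI)
      show "0 < t / 2" using t by simp
      show "((\<lambda>s. nrm X (v s - v t)) \<longlongrightarrow> 0) (at t within {0<..T})"
        using v t by (simp add: cw_space_def continuous_map_ntop)
      fix s assume s: "s \<in> {0<..T}" "dist s t < t / 2"
      show "v s \<in> carr X" by (rule cw_mem[OF v(1) s(1)])
      have b: "t / 2 \<le> s" "s \<le> 2 * t" using s(2) t unfolding dist_real_def abs_less_iff by auto
      have "c \<le> s powr \<mu>"
      proof (cases "0 \<le> \<mu>")
        case True
        then have "(t / 2) powr \<mu> \<le> s powr \<mu>" using b t by (intro powr_mono2) auto
        then show ?thesis by (simp add: c_def)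
      next
        case False
        then have "(2 * t) powr \<mu> \<le> s powr \<mu>" using b t s by (intro powr_mono2') auto
        then show ?thesis by (simp add: c_def)
      qed
      then have "c * nrm X (u s - v s) \<le> s powr \<mu> * nrm X (u s - v s)"
        by (intro mult_right_mono nrm_ge0 diff_mem mem cw_mem[OF v(1)] s) auto
      also have "\<dots> \<le> c * e" by (rule v(2)[OF s(1)])
      finally show "nrm X (u s - v s) \<le> e" using c by simp
    qed
  qed
  moreover have "((\<lambda>t. t powr \<mu> * nrm X (u t)) \<longlongrightarrow> 0) (at_right 0)"
    unfolding tendsto_iff
  proof (intro allI impI)
    fix e :: real assume e: "0 < e"
    obtain v where v: "v \<in> cw_space T \<mu> X" "\<And>s. s \<in> {0<..T} \<Longrightarrow> s powr \<mu> * nrm X (u s - v s) \<le> e / 2"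
      using approx[of "e / 2"] e by auto
    have "((\<lambda>t. t powr \<mu> * nrm X (v t)) \<longlongrightarrow> 0) (at_right 0)"
      using v by (simp add: cw_space_def)
    then have "\<forall>\<^sub>F t in at_right 0. t powr \<mu> * nrm X (v t) < e / 2"
      using e by (intro order_tendstoD(2)) auto
    moreover have "\<forall>\<^sub>F t in at_right 0. t \<in> {0<..<T}"
      using T by (rule eventually_at_right_real)
    ultimately show "\<forall>\<^sub>F t in at_right 0. dist (t powr \<mu> * nrm X (u t)) 0 < e"
    proof eventually_elim
      case (elim t)
      then have t: "t \<in> {0<..T}" by simp
      have m: "u t \<in> carr X" "v t \<in> carr X" using mem[OF t] cw_mem[OF v(1) t] .
      have "t powr \<mu> * nrm X (u t) \<le> t powr \<mu> * (nrm X (v t) + nrm X (u t - v t))"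
        by (intro mult_left_mono nrm_le_add_diff m) simp
      then have "t powr \<mu> * nrm X (u t) < e"
        using v(2)[OF t] elim by (simp add: distrib_left)
      then show ?case using nrm_ge0[OF m(1)] by simp
    qed
  qed
  ultimately show ?thesis by (simp add: cw_space_def)
qed

end

section \<open>Mild solutions\<close>

text \<open>
  \<open>Y\<close> and \<open>X\<close> play the roles of \<open>E\<^sub>\<theta>\<close> and \<open>E\<^sub>\<gamma>\<close>.  The exponent \<open>\<alpha>\<close> of \<open>e\<^bsup>rA\<^esup> : X \<rightarrow> Y\<close> is kept free, so that
  it can be taken to be \<open>\<theta>\<close> or \<open>1 - \<gamma>\<close>.  The regularity argument uses the same locale once more, with
  \<open>Y = E\<^sub>1\<close> and \<open>\<theta> = 1\<close>.
\<close>

locale mild_problem = smoothing_target S A E\<^sub>1 T M Y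
  for S :: "real \<Rightarrow> 'a::banach \<Rightarrow> 'a" and A E\<^sub>1 T M Y +
  fixes X :: "'a nspace" and \<theta> \<nu> \<alpha> K c :: real
  assumes \<theta>: "0 < \<theta>" and \<nu>: "0 \<le> \<nu>" "\<nu> < 1" and \<alpha>: "\<alpha> \<le> \<theta>" "\<alpha> < 1" and K: "0 \<le> K" and c: "0 \<le> c"
    and X: "banach_subspace X"
    and X_emb: "x \<in> carr X \<Longrightarrow> norm x \<le> c * nrm X x"
    and S_Y: "r \<in> {0<..T} \<Longrightarrow> nrm Y (S r x) \<le> K * (r powr - \<theta> * norm x)"
    and S_XY: "r \<in> {0<..T} \<Longrightarrow> x \<in> carr X \<Longrightarrow> nrm Y (S r x) \<le> K * (r powr - \<alpha> * nrm X x)"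
    and E\<^sub>1_Y: "\<exists>d. \<forall>x\<in>carr E\<^sub>1. x \<in> carr Y \<and> nrm Y x \<le> d * nrm E\<^sub>1 x"
begin

sublocale X: banach_subspace X
  by (rule X)

lemma continuous_on_of_ntop:
  fixes h :: "'b::metric_space \<Rightarrow> 'a"
  assumes "continuous_map (top_of_set I) (ntop X) h"
  shows "continuous_on I h"
  unfolding continuous_on_def
proof
  fix t assume t: "t \<in> I"
  have lim: "((\<lambda>s. c * nrm X (h s - h t)) \<longlongrightarrow> 0) (at t within I)"
    using assms t by (intro tendsto_mult_right_zero) (simp add: X.continuous_map_ntop)
  show "(h \<longlongrightarrow> h t) (at t within I)"
  proof (rule LIM_zero_cancel, rule Lim_null_comparison[OF _ lim])
    show "\<forall>\<^sub>F s in at t within I. norm (h s - h t) \<le> c * nrm X (h s - h t)"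
      using assms t unfolding eventually_at_filter X.continuous_map_ntop
      by (auto intro!: always_eventually X_emb X.diff_mem)
  qed
qed

lemma forced:
  assumes h: "h \<in> cw_space T \<nu> X"
  shows "forced_semigroup S A E\<^sub>1 T M h \<nu> (c * cw_norm T \<nu> X h)"
proof
  show "0 \<le> c * cw_norm T \<nu> X h"
    using c X.cw_norm_ge0[OF T h] by simp
  show "continuous_on {0<..T} h"
    using h by (intro continuous_on_of_ntop) (simp add: cw_space_def)
  fix s assume s: "s \<in> {0<..T}"
  have "norm (h s) \<le> c * nrm X (h s)"
    by (rule X_emb[OF X.cw_mem[OF h s]])
  also have "\<dots> \<le> c * (cw_norm T \<nu> X h * s powr - \<nu>)"
    by (rule mult_left_mono[OF X.cw_le'[OF h s] c])
  finally show "norm (h s) \<le> c * cw_norm T \<nu> X h * s powr - \<nu>" by (simp only: mult.assoc)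
qed (rule \<nu>(2))

lemma forced_into_Y:
  assumes h: "h \<in> cw_space T \<nu> X"
  shows "forced_target S A E\<^sub>1 T M h \<nu> (c * cw_norm T \<nu> X h) Y \<alpha> (K * cw_norm T \<nu> X h)"
proof -
  interpret forced_semigroup S A E\<^sub>1 T M h \<nu> "c * cw_norm T \<nu> X h"
    by (rule forced[OF h])
  show ?thesis
  proof
    show "0 \<le> K * cw_norm T \<nu> X h"
      using K X.cw_norm_ge0[OF T h] by simp
    fix r s assume r: "r \<in> {0<..T}" and s: "s \<in> {0<..T}"
    have "nrm Y (S r (h s)) \<le> K * (r powr - \<alpha> * nrm X (h s))"
      by (rule S_XY[OF r X.cw_mem[OF h s]])
    also have "\<dots> \<le> K * (r powr - \<alpha> * (cw_norm T \<nu> X h * s powr - \<nu>))"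
      using X.cw_le'[OF h s] K by (intro mult_left_mono) auto
    finally show "nrm Y (S r (h s)) \<le> K * cw_norm T \<nu> X h * (r powr - \<alpha> * s powr - \<nu>)"
      by (simp only: mult_ac)
  qed (rule \<alpha>(2))
qed

definition mild :: "'a \<Rightarrow> (real \<Rightarrow> 'a) \<Rightarrow> real \<Rightarrow> 'a" where
  "mild x h t = S t x + integral {0..t} (\<lambda>s. S (t - s) (h s))"

lemma mild_integrable:
  assumes "h \<in> cw_space T \<nu> X" "t \<in> {0..T}"
  shows "(\<lambda>s. S (t - s) (h s)) integrable_on {0..t}"
  by (rule forced_semigroup.integrable[OF forced[OF assms(1)]]) (use assms in auto)

lemma mild_diff:
  assumes "h \<in> cw_space T \<nu> X" "k \<in> cw_space T \<nu> X" "t \<in> {0..T}"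
  shows "mild x h t - mild y k t = mild (x - y) (\<lambda>s. h s - k s) t"
proof -
  have "integral {0..t} (\<lambda>s. S (t - s) (h s - k s)) = integral {0..t} (\<lambda>s. S (t - s) (h s) - S (t - s) (k s))"
    by (rule integral_cong) (simp add: S_diff)
  also have "\<dots> = integral {0..t} (\<lambda>s. S (t - s) (h s)) - integral {0..t} (\<lambda>s. S (t - s) (k s))"
    by (intro Henstock_Kurzweil_Integration.integral_diff mild_integrable assms)
  finally show ?thesis
    using assms by (simp add: mild_def S_diff)
qed

lemma mild_continuous:
  assumes h: "h \<in> cw_space T \<nu> X"
  shows "continuous_on {0..T} (mild x h)"
proof -
  interpret forced_semigroup S A E\<^sub>1 T M h \<nu> "c * cw_norm T \<nu> X h"
    by (rule forced[OF h])
  have "continuous_on {0..T} (\<lambda>t. S t x + w t)"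
    by (intro continuous_intros continuous_on_orbit w_continuous)
  then show ?thesis by (simp add: mild_def[abs_def] w_def)
qed

text \<open>
  \<open>\<parallel>e\<^bsup>tA\<^esup> x\<parallel>\<^sub>Y\<close> is bounded as \<open>t \<rightarrow> 0\<close> for \<open>x \<in> E\<^sub>1\<close>, hence \<open>o(t\<^bsup>-\<theta>\<^esup>)\<close>, and by the uniform bound
  \<open>O(t\<^bsup>-\<theta>\<^esup>) \<parallel>x\<parallel>\<close> the same follows for all \<open>x\<close>, because
  \<open>E\<^sub>1\<close> is dense.
\<close>

lemma orbit_cw: "(\<lambda>t. S t x) \<in> cw_space T \<theta> Y"
proof -
  obtain d where d: "\<And>x. x \<in> carr E\<^sub>1 \<Longrightarrow> x \<in> carr Y \<and> nrm Y x \<le> d * nrm E\<^sub>1 x"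
    using E\<^sub>1_Y by blast
  obtain K1 where K1: "\<And>t x. t \<in> {0..T} \<Longrightarrow> x \<in> carr E\<^sub>1 \<Longrightarrow> nrm E\<^sub>1 (S t x) \<le> K1 * nrm E\<^sub>1 x"
    using smoothing_E1 by metis
  have "((\<lambda>t. t powr \<theta> * nrm Y (S t x)) \<longlongrightarrow> 0) (at_right 0)"
    unfolding tendsto_iff
  proof (intro allI impI)
    fix e :: real assume e: "0 < e"
    \<comment> \<open>\<open>x\<close> is approximated by \<open>y = e\<^bsup>\<epsilon>A\<^esup> x \<in> E\<^sub>1\<close>.\<close>
    have "((\<lambda>\<epsilon>. K * norm (x - S \<epsilon> x)) \<longlongrightarrow> K * norm (x - x)) (at_right 0)"
      by (intro tendsto_intros S_lim0)
    then have "\<forall>\<^sub>F \<epsilon> in at_right 0. K * norm (x - S \<epsilon> x) < e / 2"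
      using e by (intro order_tendstoD(2)) auto
    then have "\<forall>\<^sub>F \<epsilon> in at_right 0. K * norm (x - S \<epsilon> x) < e / 2 \<and> \<epsilon> \<in> {0<..<T}"
      using eventually_at_right_real[OF T] by (rule eventually_conj)
    then obtain \<epsilon> where \<epsilon>: "K * norm (x - S \<epsilon> x) < e / 2" "\<epsilon> \<in> {0<..<T}"
      using eventually_happens[of _ "at_right (0::real)"] by (auto simp: trivial_limit_at_right_real)
    define y where "y = S \<epsilon> x"
    have y: "y \<in> carr E\<^sub>1" using S_smooth[of \<epsilon> x] \<epsilon> by (simp add: y_def)
    define B where "B = max 0 d * (K1 * nrm E\<^sub>1 y)"
    have "((\<lambda>t. t powr \<theta> * B) \<longlongrightarrow> 0) (at_right 0)"
      using \<theta> by (auto intro!: tendsto_eq_intros simp: eventually_at_filter)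
    then have "\<forall>\<^sub>F t in at_right 0. t powr \<theta> * B < e / 2"
      using e by (intro order_tendstoD(2)) auto
    then show "\<forall>\<^sub>F t in at_right 0. dist (t powr \<theta> * nrm Y (S t x)) 0 < e"
      using eventually_at_right_real[OF T]
    proof eventually_elim
      case (elim t)
      then have t: "t \<in> {0<..T}" by simp
      have Sy: "S t y \<in> carr E\<^sub>1" using S_smooth[OF t] by blast
      have "nrm Y (S t y) \<le> d * nrm E\<^sub>1 (S t y)" using d[OF Sy] by blast
      also have "\<dots> \<le> max 0 d * nrm E\<^sub>1 (S t y)"
        by (intro mult_right_mono E\<^sub>1.nrm_ge0 Sy) auto
      also have "\<dots> \<le> B"
        unfolding B_def using K1[OF _ y, of t] t by (intro mult_left_mono) auto
      finally have 1: "nrm Y (S t y) \<le> B" .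
      have 2: "nrm Y (S t (x - y)) \<le> K * (t powr - \<theta> * norm (x - y))"
        by (rule S_Y[OF t])
      have "S t x = S t y + S t (x - y)" using t by (simp add: S_diff)
      then have "nrm Y (S t x) \<le> nrm Y (S t y) + nrm Y (S t (x - y))"
        using Y.nrm_add[OF S_mem_Y[OF t] S_mem_Y[OF t], of y "x - y"] by simp
      then have "t powr \<theta> * nrm Y (S t x) \<le> t powr \<theta> * (B + K * (t powr - \<theta> * norm (x - y)))"
        using 1 2 by (intro mult_left_mono) auto
      also have "\<dots> = t powr \<theta> * B + K * norm (x - y)"
        using t by (simp add: distrib_left powr_minus)
      also have "\<dots> < e" using elim \<epsilon> by (simp add: y_def)
      finally show ?case using Y.nrm_ge0[OF S_mem_Y[OF t]] by simp
    qed
  qed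
  then show ?thesis using orbit_continuous_Y by (simp add: cw_space_def)
qed

text \<open>
  \<open>c\<^sub>Y\<close> bounds \<open>h \<mapsto> \<integral>\<^sub>0\<^sup>t e\<^bsup>(t-s)A\<^esup> h(s) ds\<close> in the weighted norm of \<open>Y\<close>: the Beta function is the integral
  of the kernel over \<open>[0, 1]\<close>, and the power of \<open>T\<close> is what scaling to \<open>[0, t]\<close> and the weight \<open>t\<^sup>\<theta>\<close> leave.
  \<open>C\<close> bounds \<open>(x, h) \<mapsto> mild x h\<close> in that norm and in the supremum norm of \<open>E\<^sub>0\<close>.
\<close>

definition c\<^sub>Y :: real where
  "c\<^sub>Y = K * Beta (1 - \<nu>) (1 - \<alpha>) * T powr (\<theta> - \<alpha> + (1 - \<nu>))"

definition C :: real where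
  "C = max (M + K) (max c\<^sub>Y (c * M / (1 - \<nu>) * T powr (1 - \<nu>)))"

lemma C_ge: "1 \<le> C" "M + K \<le> C" "c\<^sub>Y \<le> C" "c * M / (1 - \<nu>) * T powr (1 - \<nu>) \<le> C"
  using M K by (auto simp: C_def)

lemma mild_cw:
  assumes h: "h \<in> cw_space T \<nu> X"
  shows "mild x h \<in> cw_space T \<theta> Y"
    "cw_norm T \<theta> Y (mild x h) \<le> C * (norm x + cw_norm T \<nu> X h)"
proof -
  define N where "N = cw_norm T \<nu> X h"
  have N: "0 \<le> N" unfolding N_def by (rule X.cw_norm_ge0[OF T h])
  have \<nu>0: "0 \<le> \<nu>" by (rule \<nu>(1))
  define b where "b = K * N * Beta (1 - \<nu>) (1 - \<alpha>)"
  define p where "p = \<theta> - \<alpha> + (1 - \<nu>)"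
  have p: "0 < p" using \<alpha> \<nu> by (simp add: p_def)
  have Beta: "0 \<le> Beta (1 - \<nu>) (1 - \<alpha>)"
    unfolding Beta_def using \<nu> \<alpha>
    by (intro divide_nonneg_nonneg mult_nonneg_nonneg less_imp_le Gamma_real_pos) auto
  have b0: "0 \<le> b" using K N Beta by (simp add: b_def)
  interpret forced_target S A E\<^sub>1 T M h \<nu> "c * cw_norm T \<nu> X h" Y \<alpha> "K * cw_norm T \<nu> X h"
    by (rule forced_into_Y[OF h])
  have mild: "mild x h t = S t x + w t" for t
    by (simp add: mild_def w_def)
  have w_le: "t powr \<theta> * nrm Y (w t) \<le> b * t powr p" if t: "t \<in> {0<..T}" for t
  proof -
    have "t powr \<theta> * nrm Y (w t) \<le> t powr \<theta> * (b * t powr (1 - \<alpha> - \<nu>))"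
      using nrm_w_le[OF t] by (intro mult_left_mono) (auto simp: b_def N_def)
    also have "\<dots> = b * (t powr \<theta> * t powr (1 - \<alpha> - \<nu>))" by (simp only: mult_ac)
    also have "t powr \<theta> * t powr (1 - \<alpha> - \<nu>) = t powr p"
      by (simp add: p_def algebra_simps flip: powr_add)
    finally show ?thesis .
  qed
  have w_lim: "((\<lambda>t. t powr \<theta> * nrm Y (w t)) \<longlongrightarrow> 0) (at_right 0)"
  proof (rule Lim_null_comparison)
    show "((\<lambda>t. b * t powr p) \<longlongrightarrow> 0) (at_right 0)"
      using p by (auto intro!: tendsto_eq_intros simp: eventually_at_filter)
    show "\<forall>\<^sub>F t in at_right 0. norm (t powr \<theta> * nrm Y (w t)) \<le> b * t powr p"
      using eventually_at_right_real[OF T]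
    proof eventually_elim
      case (elim t)
      then have t: "t \<in> {0<..T}" by simp
      show ?case using w_le[OF t] Y.nrm_ge0[OF w_mem_Y[OF t]] by simp
    qed
  qed
  have w_cw: "w \<in> cw_space T \<theta> Y"
    using w_lim w_continuous_Y[OF \<nu>0] by (simp add: cw_space_def)
  have neg: "(\<lambda>t. 0 - w t) \<in> cw_space T \<theta> Y"
    by (rule Y.cw_diff[OF T Y.cw_zero w_cw])
  show "mild x h \<in> cw_space T \<theta> Y"
    using Y.cw_diff[OF T orbit_cw neg, of x] by (simp add: mild[abs_def])
  show "cw_norm T \<theta> Y (mild x h) \<le> C * (norm x + cw_norm T \<nu> X h)"
  proof (rule Y.cw_norm_le[OF T])
    fix t assume t: "t \<in> {0<..T}"
    have "t powr \<theta> * nrm Y (S t x) \<le> t powr \<theta> * (K * (t powr - \<theta> * norm x))"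
      by (intro mult_left_mono S_Y t) simp
    also have "\<dots> = K * norm x" using t by (simp add: powr_minus)
    also have "\<dots> \<le> C * norm x" using C_ge(2) M by (intro mult_right_mono) auto
    finally have 1: "t powr \<theta> * nrm Y (S t x) \<le> C * norm x" .
    have "t powr \<theta> * nrm Y (w t) \<le> b * t powr p" by (rule w_le[OF t])
    also have "\<dots> \<le> b * T powr p" using t p b0 by (intro mult_left_mono powr_mono2) auto
    also have "\<dots> = c\<^sub>Y * N" by (simp add: b_def c\<^sub>Y_def p_def mult_ac)
    also have "\<dots> \<le> C * N" using C_ge(3) N by (rule mult_right_mono)
    finally have 2: "t powr \<theta> * nrm Y (w t) \<le> C * N" .
    have "t powr \<theta> * nrm Y (mild x h t) \<le> t powr \<theta> * (nrm Y (S t x) + nrm Y (w t))"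
      unfolding mild by (intro mult_left_mono Y.nrm_add S_mem_Y w_mem_Y t) simp
    with 1 2 show "t powr \<theta> * nrm Y (mild x h t) \<le> C * (norm x + cw_norm T \<nu> X h)"
      by (simp add: distrib_left N_def)
  qed
qed

lemma norm_mild_le:
  assumes h: "h \<in> cw_space T \<nu> X" and t: "t \<in> {0..T}"
  shows "norm (mild x h t) \<le> C * (norm x + cw_norm T \<nu> X h)"
proof -
  define N where "N = cw_norm T \<nu> X h"
  have N: "0 \<le> N" unfolding N_def by (rule X.cw_norm_ge0[OF T h])
  interpret forced_semigroup S A E\<^sub>1 T M h \<nu> "c * cw_norm T \<nu> X h"
    by (rule forced[OF h])
  have "norm (S t x) \<le> M * norm x" by (rule S_bound[OF t])
  also have "\<dots> \<le> C * norm x" using C_ge(2) K by (intro mult_right_mono) auto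
  finally have 1: "norm (S t x) \<le> C * norm x" .
  have "norm (w t) \<le> c\<^sub>0 * t powr (1 - \<nu>)" by (rule norm_w_le[OF t])
  also have "\<dots> \<le> c\<^sub>0 * T powr (1 - \<nu>)" using t \<nu> c0_nonneg by (intro mult_left_mono powr_mono2) auto
  also have "\<dots> = c * M / (1 - \<nu>) * T powr (1 - \<nu>) * N" by (simp add: c\<^sub>0_def N_def mult_ac)
  also have "\<dots> \<le> C * N" using C_ge(4) N by (rule mult_right_mono)
  finally have 2: "norm (w t) \<le> C * N" .
  have "norm (mild x h t) \<le> norm (S t x) + norm (w t)"
    by (simp add: mild_def w_def norm_triangle_ineq)
  with 1 2 show ?thesis by (simp add: distrib_left N_def)
qed

end

section \<open>The fixed point argument\<close>

context mild_problem
begin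

definition sup_norm :: "(real \<Rightarrow> 'a) \<Rightarrow> real" where
  "sup_norm u = (SUP t\<in>{0..T}. norm (u t))"

lemma norm_le_sup_norm:
  assumes "continuous_on {0..T} u" "t \<in> {0..T}"
  shows "norm (u t) \<le> sup_norm u"
  unfolding sup_norm_def
proof (rule cSUP_upper[OF assms(2)])
  have "compact ((\<lambda>t. norm (u t)) ` {0..T})"
    by (intro compact_continuous_image continuous_on_norm assms) auto
  then show "bdd_above ((\<lambda>t. norm (u t)) ` {0..T})"
    by (intro bounded_imp_bdd_above compact_imp_bounded)
qed

lemma sup_norm_le: "(\<And>t. t \<in> {0..T} \<Longrightarrow> norm (u t) \<le> b) \<Longrightarrow> sup_norm u \<le> b"
  unfolding sup_norm_def using T by (intro cSUP_least) auto

text \<open>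
  The functions are normalised to vanish outside \<open>[0, T]\<close>, so that the distance separates them.  The
  supremum norm is part of the distance because the weighted norm does not control \<open>E\<^sub>0\<close> uniformly near
  \<open>t = 0\<close>.
\<close>

definition solution_ball :: "real \<Rightarrow> (real \<Rightarrow> 'a) set" where
  "solution_ball r = {u. (\<forall>t. t \<notin> {0..T} \<longrightarrow> u t = 0) \<and> continuous_on {0..T} u \<and>
     u \<in> cw_space T \<theta> Y \<and> cw_norm T \<theta> Y u \<le> r \<and> (\<forall>t\<in>{0..T}. norm (u t) \<le> r)}"

definition solution_dist :: "real \<Rightarrow> (real \<Rightarrow> 'a) \<Rightarrow> (real \<Rightarrow> 'a) \<Rightarrow> real" where
  "solution_dist r u v = (if u \<in> solution_ball r \<and> v \<in> solution_ball r
     then cw_norm T \<theta> Y (\<lambda>t. u t - v t) + sup_norm (\<lambda>t. u t - v t) else 0)"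

lemma solution_ballD:
  assumes "u \<in> solution_ball r"
  shows "continuous_on {0..T} u" "u \<in> cw_space T \<theta> Y" "cw_norm T \<theta> Y u \<le> r"
    "\<And>t. t \<in> {0..T} \<Longrightarrow> norm (u t) \<le> r" "\<And>t. t \<notin> {0..T} \<Longrightarrow> u t = 0"
  using assms by (auto simp: solution_ball_def)

lemma solution_dist_ge:
  assumes u: "u \<in> solution_ball r" and v: "v \<in> solution_ball r"
  shows "0 \<le> cw_norm T \<theta> Y (\<lambda>t. u t - v t)" "cw_norm T \<theta> Y (\<lambda>t. u t - v t) \<le> solution_dist r u v"
    "t \<in> {0..T} \<Longrightarrow> norm (u t - v t) \<le> solution_dist r u v"
proof -
  have cont: "continuous_on {0..T} (\<lambda>t. u t - v t)"
    by (intro continuous_intros solution_ballD(1)[OF u] solution_ballD(1)[OF v])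
  have "norm (u 0 - v 0) \<le> sup_norm (\<lambda>t. u t - v t)"
    using norm_le_sup_norm[OF cont, of 0] T by simp
  then have s: "0 \<le> sup_norm (\<lambda>t. u t - v t)"
    using norm_ge_zero[of "u 0 - v 0"] by linarith
  show n: "0 \<le> cw_norm T \<theta> Y (\<lambda>t. u t - v t)"
    by (intro Y.cw_norm_ge0 T Y.cw_diff solution_ballD(2)[OF u] solution_ballD(2)[OF v])
  show "cw_norm T \<theta> Y (\<lambda>t. u t - v t) \<le> solution_dist r u v"
    using s u v by (simp add: solution_dist_def)
  show "norm (u t - v t) \<le> solution_dist r u v" if "t \<in> {0..T}"
    using norm_le_sup_norm[OF cont that] n u v by (simp add: solution_dist_def)
qed

lemma solution_metric: "Metric_space (solution_ball r) (solution_dist r)"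
proof
  fix u v w
  show "0 \<le> solution_dist r u v"
    using solution_dist_ge(1,2)[of u r v] by (cases "u \<in> solution_ball r \<and> v \<in> solution_ball r") (auto simp: solution_dist_def)
  show "solution_dist r u v = solution_dist r v u"
    using Y.cw_norm_commute[OF T solution_ballD(2)[of u r] solution_ballD(2)[of v r]]
    by (auto simp: solution_dist_def sup_norm_def norm_minus_commute)
  assume u: "u \<in> solution_ball r" and v: "v \<in> solution_ball r"
  show "(solution_dist r u v = 0) = (u = v)"
  proof
    assume d: "solution_dist r u v = 0"
    show "u = v"
    proof
      fix t
      show "u t = v t"
        using solution_dist_ge(3)[OF u v, of t] d solution_ballD(5)[OF u, of t] solution_ballD(5)[OF v, of t]
        by (cases "t \<in> {0..T}") auto
    qed
  next
    assume "u = v"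
    moreover have "cw_norm T \<theta> Y (\<lambda>t. 0) \<le> 0" "sup_norm (\<lambda>t. 0) \<le> 0"
      by (auto intro!: Y.cw_norm_le T sup_norm_le)
    ultimately show "solution_dist r u v = 0"
      using solution_dist_ge(1,2)[OF u v] u v by (auto simp: solution_dist_def)
  qed
  assume w: "w \<in> solution_ball r"
  have "sup_norm (\<lambda>t. u t - w t) \<le> sup_norm (\<lambda>t. u t - v t) + sup_norm (\<lambda>t. v t - w t)"
  proof (rule sup_norm_le)
    fix t assume t: "t \<in> {0..T}"
    have "norm (u t - v t) \<le> sup_norm (\<lambda>t. u t - v t)" "norm (v t - w t) \<le> sup_norm (\<lambda>t. v t - w t)"
      using solution_ballD(1)[OF u] solution_ballD(1)[OF v] solution_ballD(1)[OF w] t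
      by (auto intro!: norm_le_sup_norm[where u = "\<lambda>t. u t - v t"] norm_le_sup_norm[where u = "\<lambda>t. v t - w t"]
          continuous_on_diff)
    then show "norm (u t - w t) \<le> sup_norm (\<lambda>t. u t - v t) + sup_norm (\<lambda>t. v t - w t)"
      using norm_triangle_ineq[of "u t - v t" "v t - w t"] by simp
  qed
  then show "solution_dist r u w \<le> solution_dist r u v + solution_dist r v w"
    using Y.cw_norm_triangle[OF T solution_ballD(2)[OF u] solution_ballD(2)[OF v] solution_ballD(2)[OF w]] u v w
    by (simp add: solution_dist_def)
qed

text \<open>
  A Cauchy sequence converges at each \<open>t\<close> both in \<open>E\<^sub>0\<close> and, if \<open>t > 0\<close>, in \<open>Y\<close>; the limits agree by the
  embedding, and the convergence is uniform in both norms.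
\<close>

lemma solution_mcomplete: "Metric_space.mcomplete (solution_ball r) (solution_dist r)"
proof -
  interpret B: Metric_space "solution_ball r" "solution_dist r" by (rule solution_metric)
  show ?thesis
    unfolding B.mcomplete_def
  proof (intro allI impI)
    fix \<sigma> assume c: "B.MCauchy \<sigma>"
    have \<sigma>: "\<sigma> n \<in> solution_ball r" for n
      using conjunct1[OF c[unfolded B.MCauchy_def]] by (rule subsetD) (rule rangeI)
    have cau: "\<exists>N. \<forall>m\<ge>N. \<forall>n\<ge>N. solution_dist r (\<sigma> m) (\<sigma> n) < e" if e: "0 < e" for e
    proof -
      obtain N where "\<forall>m n. N \<le> m \<longrightarrow> N \<le> n \<longrightarrow> solution_dist r (\<sigma> m) (\<sigma> n) < e"
        using conjunct2[OF c[unfolded B.MCauchy_def]] e by blast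
      then show ?thesis by (intro exI[of _ N]) simp
    qed
    have "convergent (\<lambda>n. \<sigma> n t)" if t: "t \<in> {0..T}" for t
      unfolding Cauchy_convergent_iff[symmetric] Cauchy_iff
    proof (intro allI impI)
      fix e :: real assume "0 < e"
      from cau[OF this] obtain N where N: "\<And>m n. N \<le> m \<Longrightarrow> N \<le> n \<Longrightarrow> solution_dist r (\<sigma> m) (\<sigma> n) < e"
        by blast
      have "norm (\<sigma> m t - \<sigma> n t) < e" if "N \<le> m" "N \<le> n" for m n
        using solution_dist_ge(3)[OF \<sigma>[of m] \<sigma>[of n] t] N[OF that] by linarith
      then show "\<exists>N. \<forall>m\<ge>N. \<forall>n\<ge>N. norm (\<sigma> m t - \<sigma> n t) < e"
        by blast
    qed
    then have lim: "(\<lambda>n. \<sigma> n t) \<longlonglongrightarrow> lim (\<lambda>n. \<sigma> n t)" if "t \<in> {0..T}" for t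
      using that by (simp add: convergent_LIMSEQ_iff)
    define u where "u t = (if t \<in> {0..T} then lim (\<lambda>n. \<sigma> n t) else 0)" for t
    have u: "(\<lambda>n. \<sigma> n t) \<longlonglongrightarrow> u t" if "t \<in> {0..T}" for t
      using lim[OF that] that by (simp add: u_def)
    have uY: "u t \<in> carr Y \<and> (\<lambda>n. nrm Y (\<sigma> n t - u t)) \<longlonglongrightarrow> 0" if t: "t \<in> {0<..T}" for t
    proof -
      have mem: "\<sigma> n t \<in> carr Y" for n
        by (rule Y.cw_mem[OF solution_ballD(2)[OF \<sigma>] t])
      have cauY: "\<exists>N. \<forall>m\<ge>N. \<forall>n\<ge>N. nrm Y (\<sigma> m t - \<sigma> n t) < e" if e: "0 < e" for e
      proof -
        have te: "0 < t powr \<theta> * e" using t e by simp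
        obtain N where N: "\<And>m n. N \<le> m \<Longrightarrow> N \<le> n \<Longrightarrow> solution_dist r (\<sigma> m) (\<sigma> n) < t powr \<theta> * e"
          using cau[OF te] by blast
        have "nrm Y (\<sigma> m t - \<sigma> n t) < e" if "N \<le> m" "N \<le> n" for m n
        proof -
          have "t powr \<theta> * nrm Y (\<sigma> m t - \<sigma> n t) \<le> cw_norm T \<theta> Y (\<lambda>t. \<sigma> m t - \<sigma> n t)"
            by (rule Y.cw_le[OF Y.cw_diff[OF T solution_ballD(2)[OF \<sigma>] solution_ballD(2)[OF \<sigma>]] t])
          also have "\<dots> < t powr \<theta> * e"
            using solution_dist_ge(2)[OF \<sigma>[of m] \<sigma>[of n]] N[OF that] by linarith
          finally show ?thesis using t by simp
        qed
        then show ?thesis by blast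
      qed
      obtain y where y: "y \<in> carr Y" "(\<lambda>n. nrm Y (\<sigma> n t - y)) \<longlonglongrightarrow> 0"
        using Y.Cauchy_convergent[OF mem cauY] .
      have "(\<lambda>n. \<sigma> n t) \<longlonglongrightarrow> y"
        by (rule tendsto_Y_imp_tendsto[OF mem y])
      then have "y = u t" using u[of t] t LIMSEQ_unique by auto
      with y show ?thesis by simp
    qed
    have unif: "\<exists>N. \<forall>n\<ge>N. (\<forall>t\<in>{0..T}. norm (\<sigma> n t - u t) \<le> e) \<and>
        (\<forall>t\<in>{0<..T}. t powr \<theta> * nrm Y (\<sigma> n t - u t) \<le> e)" if e: "0 < e" for e
    proof -
      obtain N where N: "\<And>m n. N \<le> m \<Longrightarrow> N \<le> n \<Longrightarrow> solution_dist r (\<sigma> m) (\<sigma> n) < e"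
        using cau[OF e] by blast
      have 1: "norm (\<sigma> n t - u t) \<le> e" if n: "N \<le> n" and t: "t \<in> {0..T}" for n t
      proof (rule tendsto_upperbound)
        show "(\<lambda>m. norm (\<sigma> n t - \<sigma> m t)) \<longlonglongrightarrow> norm (\<sigma> n t - u t)"
          by (intro tendsto_intros u t)
        show "\<forall>\<^sub>F m in sequentially. norm (\<sigma> n t - \<sigma> m t) \<le> e"
        proof (rule eventually_sequentiallyI)
          fix m assume "N \<le> m"
          then show "norm (\<sigma> n t - \<sigma> m t) \<le> e"
            using solution_dist_ge(3)[OF \<sigma>[of n] \<sigma>[of m] t] N[OF n] by fastforce
        qed
      qed simp
      have 2: "t powr \<theta> * nrm Y (\<sigma> n t - u t) \<le> e" if n: "N \<le> n" and t: "t \<in> {0<..T}" for n t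
      proof -
        have mem: "\<sigma> n t \<in> carr Y" for n
          by (rule Y.cw_mem[OF solution_ballD(2)[OF \<sigma>] t])
        have "t powr \<theta> * nrm Y (\<sigma> n t - u t) \<le> e + t powr \<theta> * 0"
        proof (rule tendsto_lowerbound)
          show "(\<lambda>m. e + t powr \<theta> * nrm Y (\<sigma> m t - u t)) \<longlonglongrightarrow> e + t powr \<theta> * 0"
            using uY[OF t] by (intro tendsto_intros) auto
          show "\<forall>\<^sub>F m in sequentially. t powr \<theta> * nrm Y (\<sigma> n t - u t) \<le> e + t powr \<theta> * nrm Y (\<sigma> m t - u t)"
          proof (rule eventually_sequentiallyI)
            fix m assume m: "N \<le> m"
            have "t powr \<theta> * nrm Y (\<sigma> n t - \<sigma> m t) \<le> cw_norm T \<theta> Y (\<lambda>t. \<sigma> n t - \<sigma> m t)"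
              by (rule Y.cw_le[OF Y.cw_diff[OF T solution_ballD(2)[OF \<sigma>] solution_ballD(2)[OF \<sigma>]] t])
            also have "\<dots> \<le> e"
              using solution_dist_ge(2)[OF \<sigma>[of n] \<sigma>[of m]] N[OF n m] by linarith
            finally have "t powr \<theta> * nrm Y (\<sigma> n t - \<sigma> m t) \<le> e" .
            moreover have "t powr \<theta> * nrm Y (\<sigma> n t - u t) \<le> t powr \<theta> * (nrm Y (\<sigma> n t - \<sigma> m t) + nrm Y (\<sigma> m t - u t))"
              using uY[OF t] mem by (intro mult_left_mono Y.nrm_triangle) auto
            ultimately show "t powr \<theta> * nrm Y (\<sigma> n t - u t) \<le> e + t powr \<theta> * nrm Y (\<sigma> m t - u t)"
              by (simp add: distrib_left)
          qed
        qed simp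
        then show ?thesis by simp
      qed
      show ?thesis using 1 2 by blast
    qed
    have "continuous_on {0..T} u"
    proof (rule uniform_limit_theorem)
      show "\<forall>\<^sub>F n in sequentially. continuous_on {0..T} (\<sigma> n)"
        using solution_ballD(1)[OF \<sigma>] by simp
      show "uniform_limit {0..T} \<sigma> u sequentially"
        unfolding uniform_limit_iff
      proof (intro allI impI)
        fix e :: real assume "0 < e"
        then obtain N where "\<forall>n\<ge>N. \<forall>t\<in>{0..T}. norm (\<sigma> n t - u t) \<le> e / 2" using unif[of "e / 2"] by auto
        with \<open>0 < e\<close> show "\<forall>\<^sub>F n in sequentially. \<forall>t\<in>{0..T}. dist (\<sigma> n t) (u t) < e"
          by (intro eventually_sequentiallyI[of N]) (fastforce simp: dist_norm)
      qed
    qed simp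
    moreover have "u \<in> cw_space T \<theta> Y"
    proof (rule Y.cw_limit[OF T])
      fix e :: real assume "0 < e"
      then obtain N where N: "\<forall>t\<in>{0<..T}. t powr \<theta> * nrm Y (\<sigma> N t - u t) \<le> e" using unif by blast
      show "\<exists>v\<in>cw_space T \<theta> Y. \<forall>t\<in>{0<..T}. t powr \<theta> * nrm Y (u t - v t) \<le> e"
      proof (intro bexI[of _ "\<sigma> N"] ballI)
        fix t assume t: "t \<in> {0<..T}"
        have "nrm Y (u t - \<sigma> N t) = nrm Y (\<sigma> N t - u t)"
          using uY[OF t] Y.cw_mem[OF solution_ballD(2)[OF \<sigma>] t] by (intro Y.nrm_commute) auto
        with N t show "t powr \<theta> * nrm Y (u t - \<sigma> N t) \<le> e" by simp
      qed (rule solution_ballD(2)[OF \<sigma>])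
    qed (use uY in blast)
    moreover have "norm (u t) \<le> r" if t: "t \<in> {0..T}" for t
      by (rule tendsto_upperbound[OF tendsto_norm[OF u[OF t]]]) (use solution_ballD(4)[OF \<sigma> t] in auto)
    moreover have "cw_norm T \<theta> Y u \<le> r"
    proof (rule Y.cw_norm_le[OF T])
      fix t assume t: "t \<in> {0<..T}"
      have mem: "\<sigma> n t \<in> carr Y" for n
        by (rule Y.cw_mem[OF solution_ballD(2)[OF \<sigma>] t])
      have "t powr \<theta> * nrm Y (u t) \<le> r + t powr \<theta> * 0"
      proof (rule tendsto_lowerbound)
        show "(\<lambda>m. r + t powr \<theta> * nrm Y (\<sigma> m t - u t)) \<longlonglongrightarrow> r + t powr \<theta> * 0"
          using uY[OF t] by (intro tendsto_intros) auto
        have "t powr \<theta> * nrm Y (u t) \<le> r + t powr \<theta> * nrm Y (\<sigma> m t - u t)" for m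
        proof -
          have "t powr \<theta> * nrm Y (\<sigma> m t) \<le> r"
            using Y.cw_le[OF solution_ballD(2)[OF \<sigma>] t] solution_ballD(3)[OF \<sigma>] by (rule order_trans)
          moreover have "t powr \<theta> * nrm Y (u t) \<le> t powr \<theta> * (nrm Y (\<sigma> m t) + nrm Y (u t - \<sigma> m t))"
            using uY[OF t] mem by (intro mult_left_mono Y.nrm_le_add_diff) auto
          moreover have "nrm Y (u t - \<sigma> m t) = nrm Y (\<sigma> m t - u t)"
            using uY[OF t] mem by (intro Y.nrm_commute) auto
          ultimately show ?thesis by (simp add: distrib_left)
        qed
        then show "\<forall>\<^sub>F m in sequentially. t powr \<theta> * nrm Y (u t) \<le> r + t powr \<theta> * nrm Y (\<sigma> m t - u t)"
          by simp
      qed simp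
      then show "t powr \<theta> * nrm Y (u t) \<le> r" by simp
    qed
    ultimately have uB: "u \<in> solution_ball r"
      by (simp add: solution_ball_def u_def)
    have "limitin B.mtopology \<sigma> u sequentially"
      unfolding B.limit_metric_sequentially
    proof (intro conjI allI impI uB)
      fix e :: real assume e: "0 < e"
      then have "0 < e / 4" by simp
      from unif[OF this] obtain N where N: "\<And>n t. N \<le> n \<Longrightarrow> t \<in> {0..T} \<Longrightarrow> norm (\<sigma> n t - u t) \<le> e / 4"
        "\<And>n t. N \<le> n \<Longrightarrow> t \<in> {0<..T} \<Longrightarrow> t powr \<theta> * nrm Y (\<sigma> n t - u t) \<le> e / 4"
        by blast
      have "solution_dist r (\<sigma> n) u < e" if "N \<le> n" for n
      proof -
        have "cw_norm T \<theta> Y (\<lambda>t. \<sigma> n t - u t) \<le> e / 4"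
          by (intro Y.cw_norm_le T N(2) that)
        moreover have "sup_norm (\<lambda>t. \<sigma> n t - u t) \<le> e / 4"
          by (intro sup_norm_le N(1) that)
        ultimately show ?thesis using e uB \<sigma> by (simp add: solution_dist_def)
      qed
      then show "\<exists>N. \<forall>n\<ge>N. \<sigma> n \<in> solution_ball r \<and> solution_dist r (\<sigma> n) u < e"
        using \<sigma> by blast
    qed
    then show "\<exists>u. limitin B.mtopology \<sigma> u sequentially" by (rule exI[of _ u])
  qed
qed

lemma mild_solution_iff:
  assumes "f u \<in> cw_space T \<nu> X"
  shows "mild_solution T S f \<Sigma> u \<longleftrightarrow> (\<forall>t\<in>{0..T}. u t = mild (\<Sigma> u) (f u) t)"
  using mild_integrable[OF assms] by (auto simp: mild_solution_def mild_def)

definition locally_contractive ::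
  "real \<Rightarrow> real \<Rightarrow> ((real \<Rightarrow> 'a) \<Rightarrow> real \<Rightarrow> 'a) \<Rightarrow> ((real \<Rightarrow> 'a) \<Rightarrow> 'a) \<Rightarrow> bool" where
  "locally_contractive c\<^sub>T l f \<Sigma> \<longleftrightarrow>
    (\<forall>v\<in>cw_space T \<theta> Y. f v \<in> cw_space T \<nu> X) \<and>
    (\<forall>t\<in>{0<..T}. f (\<lambda>_. 0) t = 0) \<and>
    (\<forall>L\<in>{0<..<1}. \<forall>v\<in>cw_space T \<theta> Y. \<forall>w\<in>cw_space T \<theta> Y.
       cw_norm T \<theta> Y v + cw_norm T \<theta> Y w \<le> L \<longrightarrow> (\<forall>t\<in>{0<..T}. norm (v t) + norm (w t) \<le> L) \<longrightarrow>
       cw_norm T \<nu> X (\<lambda>t. f v t - f w t) \<le> c\<^sub>T * L powr l * cw_norm T \<theta> Y (\<lambda>t. v t - w t) \<and>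
       norm (\<Sigma> v - \<Sigma> w) \<le> c\<^sub>T * L powr l * cw_norm T \<theta> Y (\<lambda>t. v t - w t))"

definition small_solution ::
  "real \<Rightarrow> ((real \<Rightarrow> 'a) \<Rightarrow> real \<Rightarrow> 'a) \<Rightarrow> ((real \<Rightarrow> 'a) \<Rightarrow> 'a) \<Rightarrow> (real \<Rightarrow> 'a) \<Rightarrow> bool" where
  "small_solution r f \<Sigma> u \<longleftrightarrow>
    continuous_on {0..T} u \<and> u \<in> cw_space T \<theta> Y \<and> mild_solution T S f \<Sigma> u \<and>
    cw_norm T \<theta> Y u \<le> r \<and> (\<forall>t\<in>{0..T}. norm (u t) \<le> r)"

text \<open>
  On the ball of radius \<open>r\<close> the Lipschitz constants are \<open>O(r\<^sup>l)\<close>, so for small \<open>r\<close> the map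
  \<open>v \<mapsto> mild (\<Sigma> v) (f v)\<close> is a contraction.  The smallness of \<open>\<Sigma> 0\<close> and \<open>f 0 = 0\<close> keep it in the ball.
\<close>

lemma small_data_solution:
  fixes l c\<^sub>T :: real
  assumes l: "0 < l" and c\<^sub>T: "0 < c\<^sub>T"
  obtains m r where "0 < m" "0 < r"
    "\<And>f \<Sigma>. locally_contractive c\<^sub>T l f \<Sigma> \<Longrightarrow> norm (\<Sigma> (\<lambda>_. 0)) \<le> m \<Longrightarrow>
      \<exists>u. small_solution r f \<Sigma> u \<and> (\<forall>w. small_solution r f \<Sigma> w \<longrightarrow> (\<forall>t\<in>{0..T}. w t = u t))"
proof -
  have C: "0 < C" using C_ge(1) by linarith
  \<comment> \<open>The Lipschitz hypothesis applies with \<open>L = 2 r\<close>.  Both \<open>f\<close> and \<open>\<Sigma>\<close> contribute \<open>C q\<close> to the Lipschitz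
    constant, so \<open>8 C q < 1\<close> makes it less than \<open>1/4\<close> in each of the two norms.\<close>
  have "((\<lambda>r. 8 * C * c\<^sub>T * (2 * r) powr l) \<longlongrightarrow> 8 * C * c\<^sub>T * 0) (at_right 0)"
    using l by (intro tendsto_mult_left) (auto intro!: tendsto_eq_intros simp: eventually_at_filter)
  then have "\<forall>\<^sub>F r in at_right 0. 8 * C * c\<^sub>T * (2 * r) powr l < 1"
    by (intro order_tendstoD(2)) auto
  moreover have "\<forall>\<^sub>F r in at_right 0. r \<in> {0<..<1 / 2 :: real}"
    by (rule eventually_at_right_real) simp
  ultimately have "\<forall>\<^sub>F r in at_right 0. 8 * C * c\<^sub>T * (2 * r) powr l < 1 \<and> r \<in> {0<..<1 / 2}"
    by (rule eventually_conj)
  from eventually_happens[OF this] obtain r where r: "8 * C * c\<^sub>T * (2 * r) powr l < 1" "0 < r" "2 * r < 1"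
    by (auto simp: trivial_limit_at_right_real)
  define q where "q = c\<^sub>T * (2 * r) powr l"
  have q: "0 \<le> q" "8 * (C * q) < 1" using c\<^sub>T r by (auto simp: q_def mult_ac)
  define m where "m = r / (2 * C)"
  have m: "0 < m" "C * m = r / 2" using r C by (auto simp: m_def)
  show ?thesis
  proof (rule that[OF m(1) r(2)])
    fix f :: "(real \<Rightarrow> 'a) \<Rightarrow> real \<Rightarrow> 'a" and \<Sigma> :: "(real \<Rightarrow> 'a) \<Rightarrow> 'a"
    assume data: "locally_contractive c\<^sub>T l f \<Sigma>" and \<Sigma>0: "norm (\<Sigma> (\<lambda>_. 0)) \<le> m"
    note f = conjunct1[OF data[unfolded locally_contractive_def]]
      and f0 = conjunct1[OF conjunct2[OF data[unfolded locally_contractive_def]]]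
      and lip0 = conjunct2[OF conjunct2[OF data[unfolded locally_contractive_def]]]
    define Q where "Q v \<longleftrightarrow> v \<in> cw_space T \<theta> Y \<and> cw_norm T \<theta> Y v \<le> r \<and> (\<forall>t\<in>{0..T}. norm (v t) \<le> r)" for v
    have Q0: "Q (\<lambda>_. 0)"
      using r Y.cw_zero[of T \<theta>] Y.cw_norm_le[OF T, of \<theta> "\<lambda>_. 0" r] by (auto simp: Q_def)
    have lip: "cw_norm T \<nu> X (\<lambda>t. f v t - f w t) \<le> q * cw_norm T \<theta> Y (\<lambda>t. v t - w t)"
      "norm (\<Sigma> v - \<Sigma> w) \<le> q * cw_norm T \<theta> Y (\<lambda>t. v t - w t)" if v: "Q v" and w: "Q w" for v w
    proof -
      have L: "2 * r \<in> {0<..<1}" using r by auto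
      have "cw_norm T \<theta> Y v + cw_norm T \<theta> Y w \<le> 2 * r" "\<forall>t\<in>{0<..T}. norm (v t) + norm (w t) \<le> 2 * r"
        using v w by (auto simp: Q_def intro: add_mono[of _ r _ r, simplified])
      with lip0[rule_format, OF L, of v w] v w
      show "cw_norm T \<nu> X (\<lambda>t. f v t - f w t) \<le> q * cw_norm T \<theta> Y (\<lambda>t. v t - w t)"
        "norm (\<Sigma> v - \<Sigma> w) \<le> q * cw_norm T \<theta> Y (\<lambda>t. v t - w t)"
        by (auto simp: Q_def q_def)
    qed
    have contr: "cw_norm T \<theta> Y (\<lambda>t. mild (\<Sigma> v) (f v) t - mild (\<Sigma> w) (f w) t) \<le> 1 / 4 * cw_norm T \<theta> Y (\<lambda>t. v t - w t)"
      "t \<in> {0..T} \<Longrightarrow> norm (mild (\<Sigma> v) (f v) t - mild (\<Sigma> w) (f w) t) \<le> 1 / 4 * cw_norm T \<theta> Y (\<lambda>t. v t - w t)"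
      if v: "Q v" and w: "Q w" for v w t
    proof -
      define d where "d = cw_norm T \<theta> Y (\<lambda>t. v t - w t)"
      have fv: "f v \<in> cw_space T \<nu> X" and fw: "f w \<in> cw_space T \<nu> X"
        using f v w by (auto simp: Q_def)
      have h: "(\<lambda>s. f v s - f w s) \<in> cw_space T \<nu> X"
        by (rule X.cw_diff[OF T fv fw])
      have d: "0 \<le> d"
        unfolding d_def using v w by (intro Y.cw_norm_ge0 T Y.cw_diff) (auto simp: Q_def)
      have "C * (norm (\<Sigma> v - \<Sigma> w) + cw_norm T \<nu> X (\<lambda>s. f v s - f w s)) \<le> C * (q * d + q * d)"
        using lip[OF v w] C by (intro mult_left_mono) (auto simp: d_def)
      also have "\<dots> = (2 * (C * q)) * d" by (simp add: algebra_simps)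
      also have "\<dots> \<le> 1 / 4 * d" using q d by (intro mult_right_mono) auto
      finally have le: "C * (norm (\<Sigma> v - \<Sigma> w) + cw_norm T \<nu> X (\<lambda>s. f v s - f w s)) \<le> 1 / 4 * d" .
      have eq: "mild (\<Sigma> v) (f v) t - mild (\<Sigma> w) (f w) t = mild (\<Sigma> v - \<Sigma> w) (\<lambda>s. f v s - f w s) t"
        if "t \<in> {0..T}" for t
        by (rule mild_diff[OF fv fw that])
      have "cw_norm T \<theta> Y (\<lambda>t. mild (\<Sigma> v) (f v) t - mild (\<Sigma> w) (f w) t)
          = cw_norm T \<theta> Y (mild (\<Sigma> v - \<Sigma> w) (\<lambda>s. f v s - f w s))"
        by (rule Y.cw_cong(2)[OF T]) (use eq in auto)
      with mild_cw(2)[OF h, of "\<Sigma> v - \<Sigma> w"] le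
      show "cw_norm T \<theta> Y (\<lambda>t. mild (\<Sigma> v) (f v) t - mild (\<Sigma> w) (f w) t) \<le> 1 / 4 * cw_norm T \<theta> Y (\<lambda>t. v t - w t)"
        by (simp add: d_def)
      show "norm (mild (\<Sigma> v) (f v) t - mild (\<Sigma> w) (f w) t) \<le> 1 / 4 * cw_norm T \<theta> Y (\<lambda>t. v t - w t)"
        if "t \<in> {0..T}"
        using norm_mild_le[OF h that, of "\<Sigma> v - \<Sigma> w"] le eq[OF that] by (simp add: d_def)
    qed
    have bound: "C * (norm (\<Sigma> v) + cw_norm T \<nu> X (f v)) \<le> r" if v: "Q v" for v
    proof -
      have N: "cw_norm T \<theta> Y (\<lambda>t. v t - 0) \<le> r" using v by (simp add: Q_def)
      have "cw_norm T \<nu> X (f v) = cw_norm T \<nu> X (\<lambda>t. f v t - f (\<lambda>_. 0) t)"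
        by (rule X.cw_cong(2)[OF T]) (use f0 in auto)
      also have "\<dots> \<le> q * r"
        using lip(1)[OF v Q0] mult_left_mono[OF N q(1)] by linarith
      finally have 1: "cw_norm T \<nu> X (f v) \<le> q * r" .
      have "norm (\<Sigma> v) \<le> norm (\<Sigma> (\<lambda>_. 0)) + norm (\<Sigma> v - \<Sigma> (\<lambda>_. 0))"
        by (rule norm_triangle_sub)
      also have "\<dots> \<le> m + q * r"
        using \<Sigma>0 lip(2)[OF v Q0] mult_left_mono[OF N q(1)] by linarith
      finally have "C * (norm (\<Sigma> v) + cw_norm T \<nu> X (f v)) \<le> C * (m + q * r + q * r)"
        using 1 C by (intro mult_left_mono) auto
      also have "\<dots> = r / 2 + 2 * (C * q) * r" using m(2) by (simp add: algebra_simps)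
      also have "2 * (C * q) * r \<le> 1 / 4 * r" using q r by (intro mult_right_mono) auto
      finally show ?thesis using r by simp
    qed
    define \<Phi> where "\<Phi> v t = (if t \<in> {0..T} then mild (\<Sigma> v) (f v) t else 0)" for v t
    have ballQ: "Q v" if "v \<in> solution_ball r" for v
      using that by (simp add: Q_def solution_ball_def)
    have \<Phi>_ball: "\<Phi> v \<in> solution_ball r" if "v \<in> solution_ball r" for v
    proof -
      have v: "Q v" by (rule ballQ[OF that])
      have fv: "f v \<in> cw_space T \<nu> X" using f v by (auto simp: Q_def)
      have eq: "\<Phi> v t = mild (\<Sigma> v) (f v) t" if "t \<in> {0<..T}" for t
        using that by (simp add: \<Phi>_def)
      have "continuous_on {0..T} (\<Phi> v)"
        by (rule continuous_on_eq[OF mild_continuous[OF fv]]) (simp add: \<Phi>_def)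
      moreover have "\<Phi> v \<in> cw_space T \<theta> Y \<longleftrightarrow> mild (\<Sigma> v) (f v) \<in> cw_space T \<theta> Y"
        by (rule Y.cw_cong(1)[OF T]) (rule eq)
      moreover have "cw_norm T \<theta> Y (\<Phi> v) = cw_norm T \<theta> Y (mild (\<Sigma> v) (f v))"
        by (rule Y.cw_cong(2)[OF T]) (rule eq)
      moreover have "norm (\<Phi> v t) \<le> r" if "t \<in> {0..T}" for t
        using norm_mild_le[OF fv that, of "\<Sigma> v"] bound[OF v] that by (simp add: \<Phi>_def)
      moreover have "\<Phi> v t = 0" if "t \<notin> {0..T}" for t
        using that by (simp only: \<Phi>_def if_False)
      ultimately show ?thesis
        using mild_cw[OF fv, of "\<Sigma> v"] bound[OF v] by (auto simp: solution_ball_def)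
    qed
    interpret B: Metric_space "solution_ball r" "solution_dist r" by (rule solution_metric)
    obtain u where u: "u \<in> solution_ball r" "\<Phi> u = u"
    proof (rule B.Banach_fixedpoint_thm[OF solution_mcomplete, of \<Phi> "1 / 2"])
      have "(\<lambda>_. 0) \<in> solution_ball r"
        using Q0 by (simp add: Q_def solution_ball_def)
      then show "solution_ball r \<noteq> {}" by blast
      show "\<Phi> \<in> solution_ball r \<rightarrow> solution_ball r" using \<Phi>_ball by blast
      fix v w assume v: "v \<in> solution_ball r" and w: "w \<in> solution_ball r"
      let ?d = "cw_norm T \<theta> Y (\<lambda>t. v t - w t)"
      have "cw_norm T \<theta> Y (\<lambda>t. \<Phi> v t - \<Phi> w t) = cw_norm T \<theta> Y (\<lambda>t. mild (\<Sigma> v) (f v) t - mild (\<Sigma> w) (f w) t)"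
        by (rule Y.cw_cong(2)[OF T]) (auto simp: \<Phi>_def)
      then have "cw_norm T \<theta> Y (\<lambda>t. \<Phi> v t - \<Phi> w t) \<le> 1 / 4 * ?d"
        using contr(1)[OF ballQ[OF v] ballQ[OF w]] by simp
      moreover have "sup_norm (\<lambda>t. \<Phi> v t - \<Phi> w t) \<le> 1 / 4 * ?d"
        by (rule sup_norm_le) (use contr(2)[OF ballQ[OF v] ballQ[OF w]] in \<open>auto simp: \<Phi>_def\<close>)
      moreover have "solution_dist r (\<Phi> v) (\<Phi> w) = cw_norm T \<theta> Y (\<lambda>t. \<Phi> v t - \<Phi> w t) + sup_norm (\<lambda>t. \<Phi> v t - \<Phi> w t)"
        using \<Phi>_ball v w by (simp add: solution_dist_def)
      ultimately show "solution_dist r (\<Phi> v) (\<Phi> w) \<le> 1 / 2 * solution_dist r v w"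
        using solution_dist_ge(2)[OF v w] by linarith
    qed auto
    have uQ: "Q u" by (rule ballQ[OF u(1)])
    have mild_iff: "mild_solution T S f \<Sigma> v \<longleftrightarrow> (\<forall>t\<in>{0..T}. v t = mild (\<Sigma> v) (f v) t)" if "Q v" for v
      using that f by (intro mild_solution_iff) (auto simp: Q_def)
    have "u t = mild (\<Sigma> u) (f u) t" if "t \<in> {0..T}" for t
      using fun_cong[OF u(2), of t] that by (simp add: \<Phi>_def)
    then have u_mild: "mild_solution T S f \<Sigma> u"
      using mild_iff[OF uQ] by blast
    show "\<exists>u. small_solution r f \<Sigma> u \<and> (\<forall>w. small_solution r f \<Sigma> w \<longrightarrow> (\<forall>t\<in>{0..T}. w t = u t))"
    proof (intro exI[of _ u] conjI allI impI)
      show "small_solution r f \<Sigma> u"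
        using solution_ballD[OF u(1)] u_mild by (auto simp: small_solution_def)
      fix w
      assume "small_solution r f \<Sigma> w"
      then have w: "continuous_on {0..T} w \<and> w \<in> cw_space T \<theta> Y \<and> mild_solution T S f \<Sigma> w \<and>
              cw_norm T \<theta> Y w \<le> r \<and> (\<forall>t\<in>{0..T}. norm (w t) \<le> r)"
        by (simp add: small_solution_def)
      then have wQ: "Q w" by (simp add: Q_def)
      have eq: "w t - u t = mild (\<Sigma> w) (f w) t - mild (\<Sigma> u) (f u) t" if "t \<in> {0..T}" for t
        using that w u_mild mild_iff[OF wQ] mild_iff[OF uQ] by metis
      have "cw_norm T \<theta> Y (\<lambda>t. w t - u t) = cw_norm T \<theta> Y (\<lambda>t. mild (\<Sigma> w) (f w) t - mild (\<Sigma> u) (f u) t)"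
        by (rule Y.cw_cong(2)[OF T]) (use eq in auto)
      then have "cw_norm T \<theta> Y (\<lambda>t. w t - u t) \<le> 1 / 4 * cw_norm T \<theta> Y (\<lambda>t. w t - u t)"
        using contr(1)[OF wQ uQ] by simp
      then have 0: "cw_norm T \<theta> Y (\<lambda>t. w t - u t) \<le> 0" by linarith
      show "\<forall>t\<in>{0..T}. w t = u t"
      proof
        fix t assume t: "t \<in> {0..T}"
        have "norm (w t - u t) \<le> 1 / 4 * cw_norm T \<theta> Y (\<lambda>t. w t - u t)"
          unfolding eq[OF t] by (rule contr(2)[OF wQ uQ t])
        with 0 have "norm (w t - u t) \<le> 0" by linarith
        then show "w t = u t" by simp
      qed
    qed
  qed
qed

end

section \<open>Strong solutions\<close>

text \<open>
  If the forcing takes values in a space from which the semigroup maps into \<open>E\<^sub>1\<close> with an integrable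
  singularity, then the mild solution is continuous into \<open>E\<^sub>1\<close>.  It is then differentiable: by
  \<open>u(b) = e\<^bsup>(b-a)A\<^esup> u(a) + \<integral>\<^sub>a\<^sup>b e\<^bsup>(b-s)A\<^esup> f(s) ds\<close>, the increment of \<open>u\<close> over \<open>[a, b]\<close> is an integral over an
  interval of length \<open>b - a\<close> of values close to \<open>A u(t) + f(t)\<close> if \<open>a\<close> and \<open>b\<close> are close to \<open>t\<close>.
\<close>

lemma (in smoothing_semigroup) mild_imp_strong:
  assumes mp: "mild_problem S A E\<^sub>1 T M E\<^sub>1 X \<theta> \<nu> \<alpha> K c"
    and g: "f u \<in> cw_space T \<nu> X" and mild: "mild_solution T S f \<Sigma> u"
  shows "strong_solution T E\<^sub>1 A S f \<Sigma> u"
proof -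
  interpret mild_problem S A E\<^sub>1 T M E\<^sub>1 X \<theta> \<nu> \<alpha> K c by (rule mp)
  have \<nu>0: "0 \<le> \<nu>" by (rule \<nu>(1))
  have g_cont: "continuous_on {0<..T} (f u)"
    using g by (intro continuous_on_of_ntop) (simp add: cw_space_def)
  interpret forced_target S A E\<^sub>1 T M "f u" \<nu> "c * cw_norm T \<nu> X (f u)" E\<^sub>1 \<alpha> "K * cw_norm T \<nu> X (f u)"
    by (rule forced_into_Y[OF g])
  have u: "u t = S t (\<Sigma> u) + w t" if "t \<in> {0..T}" for t
    using mild that by (simp add: mild_solution_def w_def)
  have "continuous_map (top_of_set {0<..T}) (ntop E\<^sub>1) (\<lambda>t. S t (\<Sigma> u) + w t)"
    by (intro E\<^sub>1.continuous_map_add orbit_continuous_Y w_continuous_Y \<nu>0)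
  then have u_E1: "continuous_map (top_of_set {0<..T}) (ntop E\<^sub>1) u"
    by (rule continuous_map_eq) (use u in auto)
  have u_mem: "u t \<in> carr E\<^sub>1" if "t \<in> {0<..T}" for t
    using u_E1 that by (simp add: E\<^sub>1.continuous_map_ntop)
  obtain L where L: "\<And>x. x \<in> carr E\<^sub>1 \<Longrightarrow> norm (A x) \<le> L * nrm E\<^sub>1 x"
    using A_bounded by metis
  have Au_cont: "continuous_on {0<..T} (\<lambda>t. A (u t))"
    unfolding continuous_on_def
  proof
    fix t assume t: "t \<in> {0<..T}"
    have lim: "((\<lambda>s. L * nrm E\<^sub>1 (u s - u t)) \<longlongrightarrow> 0) (at t within {0<..T})"
      using u_E1 t by (intro tendsto_mult_right_zero) (simp add: E\<^sub>1.continuous_map_ntop)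
    show "((\<lambda>s. A (u s)) \<longlongrightarrow> A (u t)) (at t within {0<..T})"
    proof (rule LIM_zero_cancel, rule Lim_null_comparison[OF _ lim])
      have "\<forall>\<^sub>F s in at t within {0<..T}. s \<in> {0<..T}"
        by (simp add: eventually_at_filter)
      then show "\<forall>\<^sub>F s in at t within {0<..T}. norm (A (u s) - A (u t)) \<le> L * nrm E\<^sub>1 (u s - u t)"
      proof eventually_elim
        case (elim s)
        then show ?case
          using L[OF E\<^sub>1.diff_mem[OF u_mem[OF elim] u_mem[OF t]]] A_diff[OF u_mem[OF elim] u_mem[OF t]] by simp
      qed
    qed
  qed
  have increment: "u b - u a = integral {0..b - a} (\<lambda>s. S s (A (u a))) + integral {a..b} (\<lambda>s. S (b - s) (f u s))"
    if ab: "a \<in> {0<..T}" "b \<in> {0<..T}" "a \<le> b" for a b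
  proof -
    have "S b (\<Sigma> u) = S (b - a) (S a (\<Sigma> u))"
      using S_add[of "b - a" a "\<Sigma> u"] ab by simp
    then have "u b = S (b - a) (u a) + integral {a..b} (\<lambda>s. S (b - s) (f u s))"
      using u[of a] u[of b] w_split[of a b] ab by (simp add: S_plus)
    moreover have "integral {0..b - a} (\<lambda>s. S s (A (u a))) = S (b - a) (u a) - u a"
      using ab by (intro integral_unique S_minus_id u_mem) auto
    ultimately show ?thesis by simp
  qed
  have deriv: "(u has_vector_derivative A (u t) + f u t) (at t within {0<..T})" if t: "t \<in> {0<..T}" for t
    unfolding has_vector_derivative_def has_derivative_within_alt
  proof (intro conjI allI impI)
    show "bounded_linear (\<lambda>h. h *\<^sub>R (A (u t) + f u t))"
      by (rule bounded_linear_scaleR_left)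
    fix e :: real assume e: "0 < e"
    have near: "\<exists>d>0. \<forall>\<sigma>\<in>{0..T}. \<forall>s\<in>{0<..T}. \<sigma> < d \<longrightarrow> \<bar>s - t\<bar> < d \<longrightarrow> norm (S \<sigma> (h s) - h t) \<le> e / 2"
      if h: "continuous_on {0<..T} h" for h :: "real \<Rightarrow> 'a"
    proof -
      have "continuous_on ({0..T} \<times> {0<..T}) (\<lambda>p. S (fst p) (h (snd p)))"
        by (intro continuous_on_S continuous_intros continuous_on_compose2[OF h]) auto
      moreover have "(0, t) \<in> {0..T} \<times> {0<..T}" using t by auto
      ultimately obtain d where d: "0 < d"
        "\<And>p. p \<in> {0..T} \<times> {0<..T} \<Longrightarrow> dist p (0, t) < d \<Longrightarrow> dist (S (fst p) (h (snd p))) (S 0 (h t)) < e / 2"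
        using half_gt_zero[OF e] unfolding continuous_on_iff by (metis fst_conv snd_conv)
      have "norm (S \<sigma> (h s) - h t) \<le> e / 2"
        if "\<sigma> \<in> {0..T}" "s \<in> {0<..T}" "\<sigma> < d / 2" "\<bar>s - t\<bar> < d / 2" for \<sigma> s
      proof -
        have "dist (\<sigma>, s) (0, t) \<le> dist \<sigma> 0 + dist s t"
          unfolding dist_Pair_Pair by (rule sqrt_sum_squares_le_sum) auto
        then have "dist (\<sigma>, s) (0, t) < d" using that by (auto simp: dist_real_def)
        with d(2)[of "(\<sigma>, s)"] that show ?thesis by (simp add: S_0 dist_norm)
      qed
      then show ?thesis using d(1) by (intro exI[of _ "d / 2"]) auto
    qed
    from near[OF Au_cont] obtain d1 where d1: "0 < d1" "\<And>\<sigma> s. \<sigma> \<in> {0..T} \<Longrightarrow> s \<in> {0<..T} \<Longrightarrow> \<sigma> < d1 \<Longrightarrow>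
        \<bar>s - t\<bar> < d1 \<Longrightarrow> norm (S \<sigma> (A (u s)) - A (u t)) \<le> e / 2" by blast
    from near[OF g_cont] obtain d2 where d2: "0 < d2" "\<And>\<sigma> s. \<sigma> \<in> {0..T} \<Longrightarrow> s \<in> {0<..T} \<Longrightarrow> \<sigma> < d2 \<Longrightarrow>
        \<bar>s - t\<bar> < d2 \<Longrightarrow> norm (S \<sigma> (f u s) - f u t) \<le> e / 2" by blast
    define d where "d = min d1 d2"
    have d: "0 < d" "d \<le> d1" "d \<le> d2" using d1 d2 by (auto simp: d_def)
    have incr: "norm (u b - u a - (b - a) *\<^sub>R (A (u t) + f u t)) \<le> e * (b - a)"
      if ab: "a \<in> {0<..T}" "b \<in> {0<..T}" "a \<le> b" "b - a < d" "\<bar>a - t\<bar> < d" "\<bar>b - t\<bar> < d" for a b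
    proof -
      have c1: "continuous_on {0..b - a} (\<lambda>s. S s (A (u a)))"
        by (rule continuous_on_subset[OF continuous_on_orbit]) (use ab in auto)
      have c2: "continuous_on {a..b} (\<lambda>s. S (b - s) (f u s))"
        by (rule continuous_on_subset[OF integrand_cont]) (use ab in auto)
      have "integral {0..b - a} (\<lambda>s. S s (A (u a)) - A (u t)) = integral {0..b - a} (\<lambda>s. S s (A (u a))) - (b - a) *\<^sub>R A (u t)"
        using ab by (subst Henstock_Kurzweil_Integration.integral_diff) (auto intro: integrable_continuous_real c1)
      moreover have "norm (integral {0..b - a} (\<lambda>s. S s (A (u a)) - A (u t))) \<le> e / 2 * (b - a - 0)"
        by (rule integral_bound) (use ab d d1(2) c1 in \<open>auto intro!: continuous_intros\<close>)
      moreover have "integral {a..b} (\<lambda>s. S (b - s) (f u s) - f u t) = integral {a..b} (\<lambda>s. S (b - s) (f u s)) - (b - a) *\<^sub>R f u t"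
        using ab by (subst Henstock_Kurzweil_Integration.integral_diff) (auto intro: integrable_continuous_real c2)
      moreover have "norm (integral {a..b} (\<lambda>s. S (b - s) (f u s) - f u t)) \<le> e / 2 * (b - a)"
      proof (rule integral_bound)
        fix s assume "s \<in> {a..b}"
        then show "norm (S (b - s) (f u s) - f u t) \<le> e / 2"
          using ab d by (intro d2(2)) (auto simp: abs_less_iff)
      qed (use ab c2 in \<open>auto intro!: continuous_intros\<close>)
      moreover have "u b - u a - (b - a) *\<^sub>R (A (u t) + f u t) =
          (integral {0..b - a} (\<lambda>s. S s (A (u a))) - (b - a) *\<^sub>R A (u t)) +
          (integral {a..b} (\<lambda>s. S (b - s) (f u s)) - (b - a) *\<^sub>R f u t)"
        using increment[OF ab(1-3)] by (simp add: scaleR_add_right)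
      ultimately have "norm (u b - u a - (b - a) *\<^sub>R (A (u t) + f u t)) \<le> e / 2 * (b - a - 0) + e / 2 * (b - a)"
        by (simp only:) (rule norm_triangle_mono)
      then show ?thesis by (simp add: field_simps)
    qed
    show "\<exists>d>0. \<forall>y\<in>{0<..T}. norm (y - t) < d \<longrightarrow>
        norm (u y - u t - (y - t) *\<^sub>R (A (u t) + f u t)) \<le> e * norm (y - t)"
    proof (intro exI[of _ d] conjI ballI impI d(1))
      fix y assume y: "y \<in> {0<..T}" "norm (y - t) < d"
      show "norm (u y - u t - (y - t) *\<^sub>R (A (u t) + f u t)) \<le> e * norm (y - t)"
      proof (cases "t \<le> y")
        case True
        then show ?thesis using incr[OF t y(1)] y d by simp
      next
        case False
        have eq: "u y - u t - (y - t) *\<^sub>R (A (u t) + f u t) = - (u t - u y - (t - y) *\<^sub>R (A (u t) + f u t))"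
          by (simp add: algebra_simps)
        have "norm (u y - u t - (y - t) *\<^sub>R (A (u t) + f u t)) \<le> e * (t - y)"
          unfolding eq norm_minus_cancel using y d False by (intro incr y(1) t) auto
        then show ?thesis using False by simp
      qed
    qed
  qed
  show ?thesis
  proof -
    have "continuous_on {0<..T} (\<lambda>t. A (u t) + f u t)"
      by (intro continuous_intros Au_cont g_cont)
    then have "\<exists>u'. continuous_on {0<..T} u' \<and>
        (\<forall>t\<in>{0<..T}. (u has_vector_derivative u' t) (at t within {0<..T}) \<and> u' t = A (u t) + f u t)"
      using deriv by (intro exI[of _ "\<lambda>t. A (u t) + f u t"]) simp
    moreover have "u 0 = \<Sigma> u" using u[of 0] T by (simp add: S_0 w_def)
    ultimately show ?thesis
      using mild u_E1 by (simp only: strong_solution_def)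
  qed
qed

section \<open>Existence, uniqueness and regularity for small data\<close>

theorem theorem2p1:
  fixes scl :: "'k::{real_normed_field,banach} \<Rightarrow> 'a::banach \<Rightarrow> 'a"
    and E\<^sub>1 :: "'a nspace"
    and F :: "real \<Rightarrow> 'a nspace \<Rightarrow> 'a nspace \<Rightarrow> 'a nspace"
    and A :: "'a \<Rightarrow> 'a" and S :: "real \<Rightarrow> 'a \<Rightarrow> 'a"
    and T \<gamma> \<theta> \<nu> l c\<^sub>T :: real
  assumes "banach_scalars scl"
    and "banach_space scl E\<^sub>1"
    and "cont_embedded E\<^sub>1 whole_space" and "dense_in E\<^sub>1 whole_space"
    and "\<forall>\<eta>\<in>{0<..<1}. admissible_functor scl \<eta> (F \<eta>)"
    and "generates_analytic scl E\<^sub>1 A S"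
    and "T > 0"
    and "\<gamma> \<in> {0..1}" and "\<theta> \<in> {0<..1}" and "(\<gamma>, \<theta>) \<noteq> (0, 1)"
    and "\<nu> \<in> {0..<1}" and "l > 0" and "c\<^sub>T > 0"
  shows "\<exists>m>0. \<exists>r>0.
    \<forall>(f :: (real \<Rightarrow> 'a) \<Rightarrow> real \<Rightarrow> 'a) (\<Sigma> :: (real \<Rightarrow> 'a) \<Rightarrow> 'a).
      let E = interp F E\<^sub>1; C\<theta> = cw_space T \<theta> (E \<theta>); N\<theta> = cw_norm T \<theta> (E \<theta>);
          C\<nu> = cw_space T \<nu> (E \<gamma>); N\<nu> = cw_norm T \<nu> (E \<gamma>)
      in
        (\<forall>v\<in>C\<theta>. f v \<in> C\<nu>) \<longrightarrow>
        (\<exists>K. \<forall>v\<in>C\<theta>. \<forall>w\<in>C\<theta>. N\<nu> (\<lambda>t. f v t - f w t) \<le> K * N\<theta> (\<lambda>t. v t - w t)) \<longrightarrow>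
        (\<exists>K. \<forall>v\<in>C\<theta>. \<forall>w\<in>C\<theta>. norm (\<Sigma> v - \<Sigma> w) \<le> K * N\<theta> (\<lambda>t. v t - w t)) \<longrightarrow>
        (\<forall>t\<in>{0<..T}. f (\<lambda>_. 0) t = 0) \<longrightarrow>
        (\<forall>L\<in>{0<..<1}. \<forall>v\<in>C\<theta>. \<forall>w\<in>C\<theta>.
           N\<theta> v + N\<theta> w \<le> L \<longrightarrow> (\<forall>t\<in>{0<..T}. norm (v t) + norm (w t) \<le> L) \<longrightarrow>
           N\<nu> (\<lambda>t. f v t - f w t) \<le> c\<^sub>T * L powr l * N\<theta> (\<lambda>t. v t - w t) \<and>
           norm (\<Sigma> v - \<Sigma> w) \<le> c\<^sub>T * L powr l * N\<theta> (\<lambda>t. v t - w t)) \<longrightarrow>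
        norm (\<Sigma> (\<lambda>_. 0)) \<le> m \<longrightarrow>
        (\<exists>u. (continuous_on {0..T} u \<and> u \<in> C\<theta> \<and> mild_solution T S f \<Sigma> u \<and>
               N\<theta> u \<le> r \<and> (\<forall>t\<in>{0..T}. norm (u t) \<le> r)) \<and>
             (\<forall>w. continuous_on {0..T} w \<and> w \<in> C\<theta> \<and> mild_solution T S f \<Sigma> w \<and>
                   N\<theta> w \<le> r \<and> (\<forall>t\<in>{0..T}. norm (w t) \<le> r) \<longrightarrow>
                   (\<forall>t\<in>{0..T}. w t = u t)) \<and>
             (\<gamma> > 0 \<longrightarrow> strong_solution T E\<^sub>1 A S f \<Sigma> u))"
proof -
  have analytic: "analytic_semigroup scl S" and gen: "generator S (carr E\<^sub>1) A"
    using assms(6) by (simp_all only: generates_analytic_def)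
  have c0: "c0_semigroup scl S"
    using analytic[unfolded analytic_semigroup_def] by (rule conjunct1)
  obtain M where M: "1 \<le> M" "\<And>t x. t \<in> {0..T} \<Longrightarrow> norm (S t x) \<le> M * norm x"
    "\<And>t x. t \<in> {0<..T} \<Longrightarrow> \<exists>y. ((\<lambda>s. S s x) has_vector_derivative y) (at t) \<and> norm y \<le> M / t * norm x"
    using analytic_semigroup_estimates[OF analytic, of T] by metis
  have sg: "smoothing_semigroup S A E\<^sub>1 T M"
  proof (rule smoothing_semigroup.intro)
    show "banach_subspace E\<^sub>1"
      by (rule banach_space_imp_subspace[OF assms(1,2)])
    show "\<exists>c. \<forall>x\<in>carr E\<^sub>1. norm x \<le> c * nrm E\<^sub>1 x"
      using assms(3) by (auto simp: cont_embedded_def bounded_by_def)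
  qed (use assms(7) c0 gen M in \<open>auto simp: c0_semigroup_def\<close>)
  interpret interpolation_scale S A E\<^sub>1 T M scl F
  proof (rule interpolation_scale.intro[OF sg], rule interpolation_scale_axioms.intro)
    show "interpolation_functor scl \<eta> (F \<eta>)" if "\<eta> \<in> {0<..<1}" for \<eta>
      using assms(5) that by (simp add: admissible_functor_def)
  qed (use assms(1,2) c0 in \<open>auto simp: c0_semigroup_def\<close>)
  have \<theta>: "\<theta> \<in> {0..1}" "0 < \<theta>" and \<gamma>: "\<gamma> \<in> {0..1}" and \<nu>: "0 \<le> \<nu>" "\<nu> < 1"
    using assms by auto
  let ?Y = "interp F E\<^sub>1 \<theta>" and ?X = "interp F E\<^sub>1 \<gamma>"
  interpret X: banach_subspace ?X by (rule interp_banach[OF \<gamma>])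
  obtain c where c: "0 \<le> c" "\<And>x. x \<in> carr ?X \<Longrightarrow> norm x \<le> c * nrm ?X x"
  proof -
    obtain c where c: "\<And>x. x \<in> carr ?X \<Longrightarrow> norm x \<le> c * nrm ?X x"
      using interp_embedded[OF \<gamma>] by blast
    have "norm x \<le> max 0 c * nrm ?X x" if "x \<in> carr ?X" for x
      using c[OF that] mult_right_mono[of c "max 0 c" "nrm ?X x"] X.nrm_ge0[OF that] by linarith
    then show ?thesis using that[of "max 0 c"] by auto
  qed
  obtain K0 where K0: "0 \<le> K0" "\<And>r x. r \<in> {0<..T} \<Longrightarrow> S r x \<in> carr ?Y"
    "\<And>r x. r \<in> {0<..T} \<Longrightarrow> nrm ?Y (S r x) \<le> K0 * (r powr - \<theta> * norm x)"
    using interp_smoothing[OF \<theta>(1)] by blast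
  have target: "smoothing_target S A E\<^sub>1 T M ?Y"
  proof (rule smoothing_target.intro[OF sg], rule smoothing_target_axioms.intro)
    show "\<exists>C. \<forall>x. S r x \<in> carr ?Y \<and> nrm ?Y (S r x) \<le> C * norm x" if r: "r \<in> {0<..T}" for r
      using K0(2,3)[OF r] by (intro exI[of _ "K0 * r powr - \<theta>"]) (simp add: mult.assoc)
  qed (auto intro: interp_banach interp_embedded \<theta>)
  \<comment> \<open>If \<open>\<theta> < 1\<close> the smoothing from \<open>E\<^sub>0\<close> suffices; if \<open>\<theta> = 1\<close> then \<open>\<gamma> > 0\<close> by assumption.\<close>
  have "\<exists>\<alpha> K. \<alpha> \<le> \<theta> \<and> \<alpha> < 1 \<and> 0 \<le> K \<and> (\<forall>r\<in>{0<..T}. \<forall>x\<in>carr ?X. nrm ?Y (S r x) \<le> K * (r powr - \<alpha> * nrm ?X x))"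
  proof (cases "\<theta> = 1")
    case True
    then have "\<gamma> \<in> {0<..1}" using assms(8,10) by auto
    from interp_to_E1[OF this] obtain K where "0 \<le> K"
      "\<forall>r\<in>{0<..T}. \<forall>x\<in>carr ?X. nrm E\<^sub>1 (S r x) \<le> K * (r powr - (1 - \<gamma>) * nrm ?X x)" by blast
    with True \<open>\<gamma> \<in> {0<..1}\<close> show ?thesis
      by (intro exI[of _ "1 - \<gamma>"] exI[of _ K]) (auto simp: interp_def)
  next
    case False
    have "nrm ?Y (S r x) \<le> (K0 * c) * (r powr - \<theta> * nrm ?X x)" if r: "r \<in> {0<..T}" and x: "x \<in> carr ?X" for r x
    proof -
      have "nrm ?Y (S r x) \<le> K0 * (r powr - \<theta> * norm x)" by (rule K0(3)[OF r])
      also have "\<dots> \<le> K0 * (r powr - \<theta> * (c * nrm ?X x))"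
        using c(2)[OF x] K0(1) by (intro mult_left_mono) auto
      finally show ?thesis by (simp only: mult_ac)
    qed
    then show ?thesis
      using False \<theta> K0(1) c(1) by (intro exI[of _ \<theta>] exI[of _ "K0 * c"]) auto
  qed
  then obtain \<alpha> K1 where \<alpha>: "\<alpha> \<le> \<theta>" "\<alpha> < 1" and K1: "0 \<le> K1"
    "\<And>r x. r \<in> {0<..T} \<Longrightarrow> x \<in> carr ?X \<Longrightarrow> nrm ?Y (S r x) \<le> K1 * (r powr - \<alpha> * nrm ?X x)"
    by blast
  define K where "K = max K0 K1"
  have K: "0 \<le> K" "K0 \<le> K" "K1 \<le> K" using K0 by (auto simp: K_def)
  interpret mild_problem S A E\<^sub>1 T M ?Y ?X \<theta> \<nu> \<alpha> K c
  proof (rule mild_problem.intro[OF target], rule mild_problem_axioms.intro)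
    show "nrm ?Y (S r x) \<le> K * (r powr - \<theta> * norm x)" if r: "r \<in> {0<..T}" for r x
      using K0(3)[OF r, of x] mult_right_mono[OF K(2), of "r powr - \<theta> * norm x"] by simp
    show "nrm ?Y (S r x) \<le> K * (r powr - \<alpha> * nrm ?X x)" if r: "r \<in> {0<..T}" and x: "x \<in> carr ?X" for r x
      using K1(2)[OF r x] mult_right_mono[OF K(3), of "r powr - \<alpha> * nrm ?X x"] X.nrm_ge0[OF x] by simp
  qed (use \<theta> \<nu> \<alpha> K c interp_E1[OF \<theta>(1)] X.banach_subspace_axioms in auto)
  have strong: "strong_solution T E\<^sub>1 A S f \<Sigma> u"
    if "0 < \<gamma>" "f u \<in> cw_space T \<nu> ?X" "mild_solution T S f \<Sigma> u" for f \<Sigma> u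
  proof -
    have \<gamma>': "\<gamma> \<in> {0<..1}" using that(1) \<gamma> by auto
    obtain L where L: "1 \<le> L" "\<And>t x. t \<in> {0<..T} \<Longrightarrow> nrm E\<^sub>1 (S t x) \<le> L / t * norm x"
      using smoothing_E1 by metis
    obtain L' where L': "0 \<le> L'" "\<And>r x. r \<in> {0<..T} \<Longrightarrow> x \<in> carr ?X \<Longrightarrow>
        nrm E\<^sub>1 (S r x) \<le> L' * (r powr - (1 - \<gamma>) * nrm ?X x)"
      using interp_to_E1[OF \<gamma>'] by blast
    define B where "B = max L L'"
    have B: "0 \<le> B" "L \<le> B" "L' \<le> B" using L by (auto simp: B_def)
    have mp: "mild_problem S A E\<^sub>1 T M E\<^sub>1 ?X 1 \<nu> (1 - \<gamma>) B c"
    proof (intro mild_problem.intro smoothing_target.intro[OF sg] smoothing_target_axioms.intro mild_problem_axioms.intro)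
      show "\<exists>C. \<forall>x. S r x \<in> carr E\<^sub>1 \<and> nrm E\<^sub>1 (S r x) \<le> C * norm x" if r: "r \<in> {0<..T}" for r
        using L(2)[OF r] S_smooth[OF r] by blast
      show "nrm E\<^sub>1 (S r x) \<le> B * (r powr - 1 * norm x)" if r: "r \<in> {0<..T}" for r x
      proof -
        have "nrm E\<^sub>1 (S r x) \<le> L * (r powr - 1 * norm x)"
          using L(2)[OF r, of x] r by (simp add: powr_minus_divide)
        also have "\<dots> \<le> B * (r powr - 1 * norm x)"
          by (rule mult_right_mono[OF B(2)]) simp
        finally show ?thesis .
      qed
      show "nrm E\<^sub>1 (S r x) \<le> B * (r powr - (1 - \<gamma>) * nrm ?X x)" if r: "r \<in> {0<..T}" and x: "x \<in> carr ?X" for r x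
        using L'(2)[OF r x] mult_right_mono[OF B(3), of "r powr - (1 - \<gamma>) * nrm ?X x"] X.nrm_ge0[OF x] by simp
      show "\<exists>d. \<forall>x\<in>carr E\<^sub>1. x \<in> carr E\<^sub>1 \<and> nrm E\<^sub>1 x \<le> d * nrm E\<^sub>1 x"
        by (intro exI[of _ 1]) simp
    qed (use \<gamma>' \<nu> B c X_emb emb E\<^sub>1.banach_subspace_axioms X.banach_subspace_axioms in auto)
    show ?thesis by (rule mild_imp_strong[OF mp that(2,3)])
  qed
  obtain m r where m: "0 < m" and r: "0 < r" and sol:
    "\<And>f \<Sigma>. locally_contractive c\<^sub>T l f \<Sigma> \<Longrightarrow> norm (\<Sigma> (\<lambda>_. 0)) \<le> m \<Longrightarrow>
      \<exists>u. small_solution r f \<Sigma> u \<and> (\<forall>w. small_solution r f \<Sigma> w \<longrightarrow> (\<forall>t\<in>{0..T}. w t = u t))"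
    using small_data_solution[OF assms(12,13)] by metis
  show ?thesis
    unfolding Let_def
  proof (rule exI[of _ m], rule conjI[OF m], rule exI[of _ r], rule conjI[OF r], intro allI impI, goal_cases)
    case (1 f \<Sigma>)
    have "locally_contractive c\<^sub>T l f \<Sigma>"
      unfolding locally_contractive_def by (intro conjI 1(1,4,5))
    from sol[OF this 1(6)] obtain u where u: "small_solution r f \<Sigma> u"
      and uniq: "\<forall>w. small_solution r f \<Sigma> w \<longrightarrow> (\<forall>t\<in>{0..T}. w t = u t)"
      by blast
    have "f u \<in> cw_space T \<nu> ?X"
      using u 1(1) by (simp only: small_solution_def)
    then have st: "0 < \<gamma> \<longrightarrow> strong_solution T E\<^sub>1 A S f \<Sigma> u"
      using strong[of f u \<Sigma>] u unfolding small_solution_def by blast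
    show ?case
      by (rule exI[of _ u], rule conjI[OF u[unfolded small_solution_def] conjI[OF uniq[unfolded small_solution_def] st]])
  qed
qed

end
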